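(* Fix a positive integer $p$ and $c\in(0,1)$. For positive integers $n,m$ with $n/m=c$ and $p<n(m-n+1)$, let $\mu_{W_0,p}=\mathrm{E}[W_0^p]$. Define $$A_{p,0}(c)=p-p\left(1-\tfrac1c\right)\log(1-c),$$ $$A_{p,1}(c)=-\frac{p^2}{2}\log(1-c)+\frac{cp\left(12-11c+6(1-p)(c-1)\right)}{12(c-1)},$$ and, for integers $q>1$, $$A_{p,q}(c)=\frac{(cp)^q\left(c+12p-12cp-cq^2\right)}{12cq(q^2-1)(1-c)^q}+\frac{(cp)^q\left(-12p+c(q^2-1)\right)}{12cq(q^2-1)}-\frac{c^q}{q}H_{p,-q}+\sum_{j=1}^{q-1}\frac{B_{2j+2}\,c^{2j}\,(2j)_{q-j}\,(pc)^{q-j}}{4j(j+1)(q-j)!}\left(1-(1-c)^{-j-q}\right).$$ Define $\beta_{p,0}(c)=e^{A_{p,0}(c)}$ and, for $j>0$, $$\beta_{p,j}(c)=e^{A_{p,0}(c)}\sum_{i_1+2i_2+\dots+j\,i_j=j}\ \prod_{r=1}^{j}\frac{A_{p,r}(c)^{i_r}}{i_r!},$$ the sum being over nonnegative integer solutions $(i_1,\dots,i_j)$ of $i_1+2i_2+\dots+j\,i_j=j$. Then $\mu_{W_0,p}$ admits the asymptotic expansion $$\mu_{W_0,p}\sim\sum_{j=0}^\infty\frac{\beta_{p,j}(c)}{n^{2j}}$$ as $n\to\infty$ with $n/m=c$ fixed; that is, for every integer $N\ge0$, $\mu_{W_0,p}=\sum_{j=0}^N\beta_{p,j}(c)\,n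^{-2j}+O\left(n^{-2(N+1)}\right)$.
   Context: $W_0=\frac{\frac1n\operatorname{Tr}(\mathbf{X}\mathbf{X}^\dagger)}{\det(\mathbf{X}\mathbf{X}^\dagger)^{1/n}}$, where $\mathbf{X}$ is an $n\times m$ random matrix whose columns are independent circularly symmetric complex Gaussian vectors in $\mathbb{C}^n$ with mean zero and covariance $N_0\mathbf{I}_n$, for some $N_0>0$ (the law of $W_0$ does not depend on $N_0$). $H_{a,b}=\sum_{j=1}^a j^{-b}$ are the generalized harmonic numbers, so $H_{p,-q}=\sum_{j=1}^p j^q$. $B_k$ are the Bernoulli numbers. $(a)_r=a(a+1)\cdots(a+r-1)$ is the Pochhammer symbol (rising factorial). $\log$ is the natural logarithm. *)

theory Defs
  imports
    "HOL-Probability.Probability"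
    "Jordan_Normal_Form.Schur_Decomposition"
begin

section \<open>Gaussian random matrices\<close>

(* A complex vector of dimension n, viewed as a point of the product space
   (complex, lborel)^n; this is how Lebesgue measure on C^n is accessed below. *)
definition coords :: "nat \<Rightarrow> complex vec \<Rightarrow> nat \<Rightarrow> complex" where
  "coords n v = (\<lambda>i\<in>{..<n}. vec_index v i)"

definition positive_definite :: "nat \<Rightarrow> complex mat \<Rightarrow> bool" where
  "positive_definite n Q \<longleftrightarrow>
     Q \<in> carrier_mat n n \<and> mat_adjoint Q = Q \<and>
     (\<forall>v\<in>carrier_vec n. v \<noteq> 0\<^sub>v n \<longrightarrow> 0 < Re ((Q *\<^sub>v v) \<bullet>c v))"

(* Z is a circularly symmetric complex Gaussian vector in C^n with mean zero and
   (nonsingular) covariance matrix E[Z Z^H] = Q: its density with respect to Lebesgue measure is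
   exp (- z^H Q^(-1) z) / (pi^n det Q).  In particular, for Q = s I the real and imaginary parts of
   every entry have variance s/2 each. *)
definition circ_complex_gaussian ::
  "'a measure \<Rightarrow> nat \<Rightarrow> complex mat \<Rightarrow> ('a \<Rightarrow> complex vec) \<Rightarrow> bool" where
  "circ_complex_gaussian M n Q Z \<longleftrightarrow>
     positive_definite n Q \<and>
     (\<forall>\<omega>\<in>space M. Z \<omega> \<in> carrier_vec n) \<and>
     (\<exists>R\<in>carrier_mat n n. inverts_mat Q R \<and> inverts_mat R Q \<and>
        distributed M (\<Pi>\<^sub>M i\<in>{..<n}. lborel) (\<lambda>\<omega>. coords n (Z \<omega>))
          (\<lambda>z. ennreal (exp (- Re ((R *\<^sub>v Matrix.vec n z) \<bullet>c Matrix.vec n z))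
                         / (pi ^ n * Re (Determinant.det Q)))))"

definition gaussian_matrix ::
  "'a measure \<Rightarrow> nat \<Rightarrow> nat \<Rightarrow> real \<Rightarrow> ('a \<Rightarrow> complex mat) \<Rightarrow> bool" where
  "gaussian_matrix M n m N\<^sub>0 X \<longleftrightarrow>
     prob_space M \<and>
     (\<forall>\<omega>\<in>space M. X \<omega> \<in> carrier_mat n m) \<and>
     prob_space.indep_vars M (\<lambda>_. \<Pi>\<^sub>M i\<in>{..<n}. borel)
       (\<lambda>k \<omega>. coords n (col (X \<omega>) k)) {..<m} \<and>
     (\<forall>k<m. circ_complex_gaussian M n (complex_of_real N\<^sub>0 \<cdot>\<^sub>m 1\<^sub>m n) (\<lambda>\<omega>. col (X \<omega>) k))"

definition mat_trace :: "'a::comm_monoid_add mat \<Rightarrow> 'a" where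
  "mat_trace A = (\<Sum>i<dim_row A. A $$ (i, i))"

(* Trace and determinant of the positive semidefinite matrix X X^H are nonnegative reals, so taking
   Re only changes the type. *)
definition W0 :: "complex mat \<Rightarrow> real" where
  "W0 X = (let n = dim_row X; S = X * mat_adjoint X in
     (1 / real n * Re (mat_trace S)) / (Re (Determinant.det S)) powr (1 / real n))"

definition moment_W0 :: "'a measure \<Rightarrow> ('a \<Rightarrow> complex mat) \<Rightarrow> nat \<Rightarrow> real" where
  "moment_W0 M X p = (\<integral>\<omega>. W0 (X \<omega>) ^ p \<partial>M)"

section \<open>Coefficients of the expansion\<close>

definition gen_harmonic :: "nat \<Rightarrow> int \<Rightarrow> real" where
  "gen_harmonic a b = (\<Sum>j=1..a. real j powi (-b))"

(* The recurrence obtained from x / (exp x - 1) = (\<Sum>n. B n * x^n / n!), so that B 1 = -1/2. *)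
fun bernoulli :: "nat \<Rightarrow> real" where
  "bernoulli 0 = 1"
| "bernoulli (Suc n) = - (\<Sum>k\<le>n. real ((n + 2) choose k) * bernoulli k) / real (n + 2)"

definition coeff_A :: "nat \<Rightarrow> nat \<Rightarrow> real \<Rightarrow> real" where
  "coeff_A p q c =
     (if q = 0 then real p - real p * (1 - 1 / c) * ln (1 - c)
      else if q = 1 then
        - (real p)\<^sup>2 / 2 * ln (1 - c)
        + c * real p * (12 - 11 * c + 6 * (1 - real p) * (c - 1)) / (12 * (c - 1))
      else
        (c * real p) ^ q * (c + 12 * real p - 12 * c * real p - c * (real q)\<^sup>2)
          / (12 * c * real q * ((real q)\<^sup>2 - 1) * (1 - c) ^ q)
        + (c * real p) ^ q * (- 12 * real p + c * ((real q)\<^sup>2 - 1))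
          / (12 * c * real q * ((real q)\<^sup>2 - 1))
        - c ^ q / real q * gen_harmonic p (- int q)
        + (\<Sum>j=1..q-1.
             bernoulli (2 * j + 2) * c ^ (2 * j) * pochhammer (real (2 * j)) (q - j)
               * (real p * c) ^ (q - j)
             / (4 * real j * (real j + 1) * fact (q - j))
             * (1 - (1 - c) powi (- int j - int q))))"

definition index_solutions :: "nat \<Rightarrow> (nat \<Rightarrow> nat) set" where
  "index_solutions j = {i \<in> {1..j} \<rightarrow>\<^sub>E UNIV. (\<Sum>r=1..j. r * i r) = j}"

(* Since sums over infinite sets are 0 by convention, coeff_beta relies on this. *)
lemma finite_index_solutions: "finite (index_solutions j)"
proof (rule finite_subset)
  show "index_solutions j \<subseteq> {1..j} \<rightarrow>\<^sub>E {..j}"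
  proof
    fix i assume i: "i \<in> index_solutions j"
    have "i r \<le> j" if r: "r \<in> {1..j}" for r
    proof -
      have "i r \<le> r * i r" using r by simp
      also have "\<dots> \<le> (\<Sum>r=1..j. r * i r)"
        using r by (intro member_le_sum) auto
      finally show ?thesis using i by (simp add: index_solutions_def)
    qed
    with i show "i \<in> {1..j} \<rightarrow>\<^sub>E {..j}"
      by (auto simp: index_solutions_def PiE_iff)
  qed
  show "finite ({1..j} \<rightarrow>\<^sub>E {..j})"
    by (intro finite_PiE) auto
qed

definition coeff_beta :: "nat \<Rightarrow> nat \<Rightarrow> real \<Rightarrow> real" where
  "coeff_beta p j c =
     (if j = 0 then exp (coeff_A p 0 c)
      else exp (coeff_A p 0 c) *
        (\<Sum>i\<in>index_solutions j. \<Prod>r=1..j. coeff_A p r c ^ i r / fact (i r)))"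

section \<open>The limiting regime\<close>

definition admissible :: "nat \<Rightarrow> real \<Rightarrow> (nat \<times> nat) set" where
  "admissible p c = {(n, m). 0 < n \<and> 0 < m \<and> real n / real m = c \<and>
     real p < real n * (real m - real n + 1)}"

(* n tends to infinity while (n, m) ranges over the admissible pairs; this is the trivial filter
   when there are no such pairs with n large, e.g. for irrational c. *)
definition fixed_ratio_at_top :: "nat \<Rightarrow> real \<Rightarrow> (nat \<times> nat) filter" where
  "fixed_ratio_at_top p c = inf (filtercomap fst at_top) (principal (admissible p c))"

end

theory Submission
  imports Defs "HOL-Real_Asymp.Real_Asymp"
begin

text \<open>
  The expansion comes from a closed formula for the moment. For \<open>\<epsilon> = p / n\<close> the random variable
  \<open>W0 ^ p\<close> is \<open>n ^ (-p) * T ^ p * G powr - \<epsilon>\<close>, where \<open>T\<close> is the squared Frobenius norm of the matrix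
  and \<open>G\<close> is the Gram determinant of its rows. Adding one row multiplies \<open>G\<close> by the squared distance
  of the new row to the span of the old ones, and that distance has a Laplace transform which is a
  power of \<open>1 + t\<close> (\<open>row_laplace\<close>): integrate \<open>exp (- |r|^2 - t |r - w Y|^2)\<close> over the row \<open>r\<close> and the
  coefficients \<open>w\<close> in both orders and complete the square each time. Only translations and dilations
  of Lebesgue measure enter, no rotations. A negative power is a Mellin integral of exponentials,
  so the transform yields the moments of negative order as quotients of gamma values, and induction
  on the number of rows gives those of \<open>G\<close>. The factor \<open>T ^ p\<close> is removed by the same device: \<open>W0 ^ p\<close> is
  invariant under dilations, hence weighting it by \<open>exp (- t * T)\<close> only produces a power of \<open>1 + t\<close>.
  The result (\<open>moment_W0_eq\<close>) is
  \<open>n ^ (-p) * Gamma (n m) / Gamma (n m - p) * (\<Prod>k<n. Gamma (m - k - \<epsilon>) / Gamma (m - k))\<close>.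

  The product of gamma quotients telescopes once \<open>ln (Gamma z)\<close> is written as a difference
  \<open>L z - L (z - 1)\<close>, \<open>L\<close> being the logarithm of the Barnes G-function. It suffices to have this up to
  \<open>O(z ^ (-2 K))\<close>, because all arguments are of size at least a constant times \<open>n\<close> and there are only
  \<open>n\<close> of them. Taking second differences, the equation for \<open>L\<close> becomes
  \<open>L (z + 1) - 2 * L z + L (z - 1) = ln z\<close>; it is solved up to a small error by applying the truncated
  series of the inverse of the operator \<open>exp D + exp (- D) - 2\<close>, where \<open>D\<close> is differentiation, to \<open>ln\<close>, and the coefficients of this
  series are Bernoulli numbers (\<open>barnes_sum_second_difference\<close>). The errors are then summed from
  infinity, where the gamma quotient is known (\<open>sum_ln_Gamma_ratio_barnes\<close>).

  Along \<open>n / m = c\<close> everything left in the logarithm of the moment is a function of \<open>v = 1 / n^2\<close>: the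
  terms with \<open>ln n\<close> and \<open>ln m\<close> cancel, and \<open>\<epsilon> / m = p c v\<close>, \<open>\<epsilon> / (m - n) = p c v / (1 - c)\<close>. Its Taylor
  coefficients are the numbers \<open>coeff_A p q c\<close> (\<open>log_moment_fps_nth\<close>), and exponentiating a power
  series produces the sums over \<open>index_solutions\<close> (\<open>expands_exp\<close>).
\<close>

section \<open>Lebesgue and Gaussian integrals over complex coordinates\<close>

abbreviation cleb :: "'i set \<Rightarrow> ('i \<Rightarrow> complex) measure" where
  "cleb I \<equiv> \<Pi>\<^sub>M _\<in>I. lborel"

abbreviation sq_norm :: "'i set \<Rightarrow> ('i \<Rightarrow> complex) \<Rightarrow> real" where
  "sq_norm I x \<equiv> \<Sum>i\<in>I. (cmod (x i))\<^sup>2"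

abbreviation gauss_weight :: "'i set \<Rightarrow> ('i \<Rightarrow> complex) \<Rightarrow> ennreal" where
  "gauss_weight I x \<equiv> ennreal (exp (- sq_norm I x))"

abbreviation grid :: "nat \<Rightarrow> nat \<Rightarrow> (nat \<times> nat) set" where
  "grid n m \<equiv> {..<n} \<times> {..<m}"

interpretation cleb: product_sigma_finite "\<lambda>_. lborel :: complex measure"
  by standard

lemma sigma_finite_cleb: "finite I \<Longrightarrow> sigma_finite_measure (cleb I)"
  by (rule cleb.sigma_finite)

lemma pair_sigma_finite_cleb: "finite I \<Longrightarrow> finite J \<Longrightarrow> pair_sigma_finite (cleb I) (cleb J)"
  by (simp add: pair_sigma_finite_def sigma_finite_cleb)

lemma nn_integral_lborel_complex_affine:
  fixes f :: "complex \<Rightarrow> ennreal"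
  assumes [measurable]: "f \<in> borel_measurable borel" and c: "c \<noteq> 0"
  shows "(\<integral>\<^sup>+z. f z \<partial>lborel) = ennreal (c\<^sup>2) * (\<integral>\<^sup>+z. f (t + c *\<^sub>R z) \<partial>lborel)"
  by (subst lborel_affine[OF c, of t])
     (simp add: nn_integral_density nn_integral_distr nn_integral_cmult)

text \<open>
  The only changes of variables needed below: a translation and a common dilation of all coordinates.
  A complex coordinate has real dimension 2, hence the exponent.
\<close>
lemma nn_integral_cleb_affine:
  fixes f :: "('i \<Rightarrow> complex) \<Rightarrow> ennreal"
  assumes "finite I" and f: "f \<in> borel_measurable (cleb I)" and c: "c \<noteq> 0"
  shows "(\<integral>\<^sup>+x. f x \<partial>cleb I)
    = ennreal (c ^ (2 * card I)) * (\<integral>\<^sup>+x. f (\<lambda>i\<in>I. t i + c *\<^sub>R x i) \<partial>cleb I)"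
  using assms(1,2)
proof (induction I arbitrary: f)
  case empty
  show ?case
    by (simp add: cleb.nn_integral_empty space_PiM emeasure_PiM_empty)
next
  case (insert i I)
  note [measurable] = insert.prems
  have [measurable]: "finite I" by fact
  have *: "(\<lambda>j\<in>I. t j + c *\<^sub>R x j)(i := t i + c *\<^sub>R y)
      = (\<lambda>j\<in>insert i I. t j + c *\<^sub>R (x(i := y)) j)" for x y
    using insert.hyps by (auto simp: fun_eq_iff)
  have "(\<integral>\<^sup>+x. f x \<partial>cleb (insert i I)) = (\<integral>\<^sup>+x. \<integral>\<^sup>+y. f (x(i := y)) \<partial>lborel \<partial>cleb I)"
    by (rule cleb.product_nn_integral_insert) (use insert in auto)
  also have "\<dots> = (\<integral>\<^sup>+x. ennreal (c\<^sup>2) * (\<integral>\<^sup>+y. f (x(i := t i + c *\<^sub>R y)) \<partial>lborel) \<partial>cleb I)"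
    by (intro nn_integral_cong nn_integral_lborel_complex_affine c)
       (use insert.hyps in measurable)
  also have "\<dots> = ennreal (c\<^sup>2) * (\<integral>\<^sup>+x. \<integral>\<^sup>+y. f (x(i := t i + c *\<^sub>R y)) \<partial>lborel \<partial>cleb I)"
    by (rule nn_integral_cmult) measurable
  also have "(\<integral>\<^sup>+x. \<integral>\<^sup>+y. f (x(i := t i + c *\<^sub>R y)) \<partial>lborel \<partial>cleb I)
     = ennreal (c ^ (2 * card I)) *
       (\<integral>\<^sup>+x. \<integral>\<^sup>+y. f ((\<lambda>j\<in>I. t j + c *\<^sub>R x j)(i := t i + c *\<^sub>R y)) \<partial>lborel \<partial>cleb I)"
    by (rule insert.IH) measurable
  also have "(\<integral>\<^sup>+x. \<integral>\<^sup>+y. f ((\<lambda>j\<in>I. t j + c *\<^sub>R x j)(i := t i + c *\<^sub>R y)) \<partial>lborel \<partial>cleb I)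
     = (\<integral>\<^sup>+x. f (\<lambda>i\<in>insert i I. t i + c *\<^sub>R x i) \<partial>cleb (insert i I))"
    unfolding * by (rule cleb.product_nn_integral_insert[symmetric]) (use insert in auto)
  also have "ennreal (c\<^sup>2) * (ennreal (c ^ (2 * card I)) * A) = ennreal (c ^ (2 * card (insert i I))) * A" for A
    using insert.hyps by (simp add: ennreal_mult'[symmetric] mult.assoc[symmetric] power_add[symmetric] del: power_Suc)
  finally show ?case .
qed

lemma nn_integral_real_gauss:
  assumes a: "0 < a"
  shows "(\<integral>\<^sup>+x. ennreal (exp (- (a * x\<^sup>2))) \<partial>lborel) = ennreal (sqrt (pi / a))"
proof -
  define s where "s = sqrt (1 / (2 * a))"
  have s: "0 < s" "s\<^sup>2 = 1 / (2 * a)"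
    using a by (auto simp: s_def)
  have eq: "exp (- (a * x\<^sup>2)) = sqrt (pi / a) * normal_density 0 s x" for x
    using a by (simp add: normal_density_def s(2))
  have "(\<integral>\<^sup>+x. ennreal (exp (- (a * x\<^sup>2))) \<partial>lborel)
      = (\<integral>\<^sup>+x. ennreal (sqrt (pi / a)) * ennreal (normal_density 0 s x) \<partial>lborel)"
    using a unfolding eq by (intro nn_integral_cong) (simp add: ennreal_mult')
  also have "\<dots> = ennreal (sqrt (pi / a)) * (\<integral>\<^sup>+x. ennreal (normal_density 0 s x) \<partial>lborel)"
    by (rule nn_integral_cmult) measurable
  also have "(\<integral>\<^sup>+x. ennreal (normal_density 0 s x) \<partial>lborel) = ennreal 1"
    using s integral_normal_density[of s 0] integrable_normal_density[of s 0]
    by (subst nn_integral_eq_integral) (auto simp: normal_density_nonneg)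
  finally show ?thesis by simp
qed

lemma nn_integral_complex_gauss:
  assumes a: "0 < a"
  shows "(\<integral>\<^sup>+z. ennreal (exp (- (a * (cmod z)\<^sup>2))) \<partial>lborel) = ennreal (pi / a)"
proof -
  have eq: "ennreal (exp (- (a * (cmod z)\<^sup>2))) = (\<Prod>b\<in>Basis. ennreal (exp (- (a * (z \<bullet> b)\<^sup>2))))" for z
    by (simp add: Basis_complex_def inner_complex_def cmod_power2 ennreal_mult'[symmetric]
        exp_add[symmetric] algebra_simps)
  have "(\<integral>\<^sup>+z. ennreal (exp (- (a * (cmod z)\<^sup>2))) \<partial>lborel)
      = (\<Prod>b\<in>(Basis :: complex set). \<integral>\<^sup>+x. ennreal (exp (- (a * x\<^sup>2))) \<partial>lborel)"
    unfolding eq by (rule nn_integral_lborel_prod) auto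
  also have "\<dots> = ennreal (sqrt (pi / a)) ^ 2"
    using a by (simp add: nn_integral_real_gauss)
  finally show ?thesis
    using a by (simp add: ennreal_power)
qed

lemma nn_integral_cleb_gauss:
  assumes "finite I" and a: "0 < a"
  shows "(\<integral>\<^sup>+x. ennreal (exp (- (a * sq_norm I x))) \<partial>cleb I) = ennreal ((pi / a) ^ card I)"
proof -
  have "(\<integral>\<^sup>+x. ennreal (exp (- (a * sq_norm I x))) \<partial>cleb I)
      = (\<integral>\<^sup>+x. (\<Prod>i\<in>I. ennreal (exp (- (a * (cmod (x i))\<^sup>2)))) \<partial>cleb I)"
    using assms by (simp add: prod_ennreal exp_sum sum_distrib_left sum_negf[symmetric])
  also have "\<dots> = (\<Prod>i\<in>I. ennreal (pi / a))"
    using assms by (subst cleb.product_nn_integral_prod) (auto simp: nn_integral_complex_gauss)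
  finally show ?thesis
    using a by (simp add: ennreal_power)
qed

section \<open>Negative powers as Mellin transforms\<close>

text \<open>
  The Mellin integral below diverges at \<open>x = 0\<close>, so \<open>\<infinity>\<close> is the value there for which the integral
  formula has no exceptional point. Extending it to all \<open>x \<le> 0\<close> makes finiteness of an integral of
  \<open>neg_power s \<circ> f\<close> a proof that \<open>f\<close> is positive almost everywhere.
\<close>
definition neg_power :: "real \<Rightarrow> real \<Rightarrow> ennreal" where
  "neg_power s x = (if x \<le> 0 then \<infinity> else ennreal (x powr - s))"

lemma measurable_neg_power [measurable]: "neg_power s \<in> borel_measurable borel"
  unfolding neg_power_def[abs_def] by measurable

lemma nn_integral_gamma_kernel:
  assumes s: "0 < s" and x: "0 \<le> x"
  shows "(\<integral>\<^sup>+t\<in>{0<..}. ennreal (t powr (s - 1) * exp (- (t * x))) \<partial>lborel) = ennreal (Gamma s) * neg_power s x"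
proof -
  have pos: "(\<integral>\<^sup>+t\<in>{0<..}. ennreal (t powr (s - 1) * exp (- (t * x))) \<partial>lborel) = ennreal (Gamma s) * ennreal (x powr - s)"
    if x: "0 < x" for x
  proof -
    have "ennreal (Gamma s) = (\<integral>\<^sup>+t. ennreal (indicat_real {0..} t * t powr (s - 1) / exp t) \<partial>lborel)"
      using s by (rule Gamma_conv_nn_integral_real)
    also have "\<dots> = ennreal \<bar>x\<bar> * (\<integral>\<^sup>+t. ennreal (indicat_real {0..} (0 + x * t) * (0 + x * t) powr (s - 1) / exp (0 + x * t)) \<partial>lborel)"
      using x by (intro nn_integral_real_affine) auto
    also have "\<dots> = ennreal x * (\<integral>\<^sup>+t. ennreal (x powr (s - 1)) * (ennreal (t powr (s - 1) * exp (- (t * x))) * indicator {0<..} t) \<partial>lborel)"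
      using x by (intro arg_cong2[where f="(*)"] nn_integral_cong)
         (auto split: split_indicator simp: ennreal_mult'[symmetric] powr_mult exp_minus field_simps zero_le_mult_iff)
    also have "\<dots> = ennreal x * (ennreal (x powr (s - 1)) * (\<integral>\<^sup>+t\<in>{0<..}. ennreal (t powr (s - 1) * exp (- (t * x))) \<partial>lborel))"
      by (subst nn_integral_cmult) auto
    also have "\<dots> = ennreal (x powr s) * (\<integral>\<^sup>+t\<in>{0<..}. ennreal (t powr (s - 1) * exp (- (t * x))) \<partial>lborel)"
      using x by (simp add: mult.assoc[symmetric] ennreal_mult'[symmetric] powr_diff)
    finally have "ennreal (Gamma s) * ennreal (x powr - s)
       = ennreal (x powr s * x powr - s) * (\<integral>\<^sup>+t\<in>{0<..}. ennreal (t powr (s - 1) * exp (- (t * x))) \<partial>lborel)"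
      by (simp add: ennreal_mult mult_ac)
    with x show ?thesis
      by (simp add: powr_add[symmetric])
  qed
  show ?thesis
  proof (cases "x = 0")
    case False
    with x pos[of x] show ?thesis by (simp add: neg_power_def)
  next
    case True
    let ?I = "\<integral>\<^sup>+t\<in>{0<..}. ennreal (t powr (s - 1) * exp (- (t * x))) \<partial>lborel"
    have le: "ennreal (Gamma s * real n) \<le> ?I" if n: "0 < n" for n :: nat
    proof -
      have "ennreal (Gamma s * real n) = ennreal (Gamma s) * ennreal ((real n powr (- 1 / s)) powr - s)"
        using n s by (simp add: powr_powr ennreal_mult' Gamma_real_pos less_imp_le)
      also have "\<dots> = (\<integral>\<^sup>+t\<in>{0<..}. ennreal (t powr (s - 1) * exp (- (t * real n powr (- 1 / s)))) \<partial>lborel)"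
        using n by (intro pos[symmetric]) simp
      also have "\<dots> \<le> ?I"
        using True by (intro nn_integral_mono) (auto split: split_indicator simp: mult_left_le)
      finally show ?thesis .
    qed
    have "?I = \<infinity>"
    proof (rule ccontr)
      assume "?I \<noteq> \<infinity>"
      then obtain r where r: "0 \<le> r" "?I = ennreal r"
        by (cases "?I") auto
      obtain n :: nat where n: "r / Gamma s < real n"
        using reals_Archimedean2 by blast
      have G: "0 < Gamma s" using s by (rule Gamma_real_pos)
      have "0 < n" using n r G by (metis divide_nonneg_pos gr0I less_le_not_le of_nat_0)
      from le[OF this] r n G show False
        by (simp add: field_simps)
    qed
    with True Gamma_real_pos[OF s] show ?thesis
      by (simp add: neg_power_def ennreal_mult_top)
  qed
qed

lemma neg_power_mult: "0 < x \<Longrightarrow> 0 \<le> y \<Longrightarrow> neg_power s (x * y) = neg_power s x * neg_power s y"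
  by (auto simp: neg_power_def powr_mult ennreal_mult' mult_le_0_iff ennreal_mult_top)

text \<open>
  Writing \<open>(1 + t) powr - a\<close> as a gamma integral in a second variable \<open>u\<close> and exchanging the order of
  integration leaves gamma integrals only.
\<close>
lemma nn_integral_beta_kernel:
  assumes s: "0 < s" "s < a"
  shows "(\<integral>\<^sup>+t\<in>{0<..}. ennreal (t powr (s - 1) * (1 + t) powr - a) \<partial>lborel)
    = ennreal (Gamma s * Gamma (a - s) / Gamma a)"
proof -
  have G: "0 < Gamma s" "0 < Gamma (a - s)" "0 < Gamma a"
    using s by (auto intro!: Gamma_real_pos)
  let ?B = "\<integral>\<^sup>+t\<in>{0<..}. ennreal (t powr (s - 1) * (1 + t) powr - a) \<partial>lborel"
  have "ennreal (Gamma a) * ?B = (\<integral>\<^sup>+t. ennreal (Gamma a) * (ennreal (t powr (s - 1) * (1 + t) powr - a) * indicator {0<..} t) \<partial>lborel)"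
    by (subst nn_integral_cmult) auto
  also have "\<dots> = (\<integral>\<^sup>+t. \<integral>\<^sup>+u. ennreal (t powr (s - 1) * u powr (a - 1) * exp (- (u * (1 + t)))) *
      indicator {0<..} t * indicator {0<..} u \<partial>lborel \<partial>lborel)"
  proof (intro nn_integral_cong)
    fix t :: real
    show "ennreal (Gamma a) * (ennreal (t powr (s - 1) * (1 + t) powr - a) * indicator {0<..} t)
      = (\<integral>\<^sup>+u. ennreal (t powr (s - 1) * u powr (a - 1) * exp (- (u * (1 + t)))) *
          indicator {0<..} t * indicator {0<..} u \<partial>lborel)"
    proof (cases "0 < t")
      case True
      have "(\<integral>\<^sup>+u. ennreal (t powr (s - 1) * u powr (a - 1) * exp (- (u * (1 + t)))) *
          indicator {0<..} t * indicator {0<..} u \<partial>lborel)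
        = (\<integral>\<^sup>+u. ennreal (t powr (s - 1)) * (ennreal (u powr (a - 1) * exp (- (u * (1 + t)))) * indicator {0<..} u) \<partial>lborel)"
        using True by (intro nn_integral_cong) (simp add: ennreal_mult mult_ac)
      also have "\<dots> = ennreal (t powr (s - 1)) * (ennreal (Gamma a) * neg_power a (1 + t))"
        using s True nn_integral_gamma_kernel[of a "1 + t"] by (subst nn_integral_cmult) auto
      finally show ?thesis
        using True by (simp add: neg_power_def ennreal_mult mult_ac)
    qed simp
  qed
  also have "\<dots> = (\<integral>\<^sup>+u. \<integral>\<^sup>+t. ennreal (t powr (s - 1) * u powr (a - 1) * exp (- (u * (1 + t)))) *
      indicator {0<..} t * indicator {0<..} u \<partial>lborel \<partial>lborel)"
    by (rule lborel_pair.Fubini') measurable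
  also have "\<dots> = (\<integral>\<^sup>+u. ennreal (Gamma s) * (ennreal (u powr (a - s - 1) * exp (- (u * 1))) * indicator {0<..} u) \<partial>lborel)"
  proof (intro nn_integral_cong)
    fix u :: real
    show "(\<integral>\<^sup>+t. ennreal (t powr (s - 1) * u powr (a - 1) * exp (- (u * (1 + t)))) *
      indicator {0<..} t * indicator {0<..} u \<partial>lborel)
      = ennreal (Gamma s) * (ennreal (u powr (a - s - 1) * exp (- (u * 1))) * indicator {0<..} u)"
    proof (cases "0 < u")
      case True
      have "(\<integral>\<^sup>+t. ennreal (t powr (s - 1) * u powr (a - 1) * exp (- (u * (1 + t)))) *
          indicator {0<..} t * indicator {0<..} u \<partial>lborel)
        = (\<integral>\<^sup>+t. ennreal (u powr (a - 1) * exp (- u)) * (ennreal (t powr (s - 1) * exp (- (t * u))) * indicator {0<..} t) \<partial>lborel)"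
      proof (intro nn_integral_cong)
        fix t :: real
        have "exp (- (u * (1 + t))) = exp (- u) * exp (- (t * u))"
          by (simp add: exp_add[symmetric] algebra_simps)
        then show "ennreal (t powr (s - 1) * u powr (a - 1) * exp (- (u * (1 + t)))) *
            indicator {0<..} t * indicator {0<..} u
          = ennreal (u powr (a - 1) * exp (- u)) * (ennreal (t powr (s - 1) * exp (- (t * u))) * indicator {0<..} t)"
          using True by (simp add: ennreal_mult mult_ac)
      qed
      also have "\<dots> = ennreal (u powr (a - 1) * exp (- u)) * (ennreal (Gamma s) * neg_power s u)"
        using s True nn_integral_gamma_kernel[of s u] by (subst nn_integral_cmult) auto
      also have "\<dots> = ennreal (Gamma s) * (ennreal (u powr (a - s - 1) * exp (- u)))"
      proof -
        have "u powr (a - s - 1) = u powr (a - 1) * u powr - s"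
          by (simp add: powr_add[symmetric] algebra_simps)
        then show ?thesis
          using True by (simp add: neg_power_def ennreal_mult mult_ac)
      qed
      finally show ?thesis
        using True by simp
    qed simp
  qed
  also have "\<dots> = ennreal (Gamma s) * (ennreal (Gamma (a - s)) * neg_power (a - s) 1)"
    using s nn_integral_gamma_kernel[of "a - s" 1] by (subst nn_integral_cmult) auto
  also have "\<dots> = ennreal (Gamma s * Gamma (a - s))"
    using G by (simp add: neg_power_def ennreal_mult)
  finally have "ennreal (inverse (Gamma a)) * (ennreal (Gamma a) * ?B) = ennreal (inverse (Gamma a)) * ennreal (Gamma s * Gamma (a - s))"
    by simp
  then show ?thesis
    using G by (simp add: mult.assoc[symmetric] ennreal_mult'[symmetric] field_simps del: mult.assoc)
qed

text \<open>
  A negative power is a mixture of the exponentials \<open>exp (- t * x)\<close>, so a Laplace transform that is a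
  power of \<open>1 + t\<close> determines the negative moments. It is used for the distance of a row to a row
  space and, with a weight \<open>w\<close>, for the squared norm of the whole matrix.
\<close>
lemma nn_integral_neg_power_of_laplace:
  assumes sf: "sigma_finite_measure M"
    and [measurable]: "w \<in> borel_measurable M" "Q \<in> borel_measurable M"
    and Q: "\<And>x. x \<in> space M \<Longrightarrow> 0 \<le> Q x"
    and s: "0 < s" "s < a"
    and laplace: "\<And>t. 0 < t \<Longrightarrow> (\<integral>\<^sup>+x. w x * ennreal (exp (- (t * Q x))) \<partial>M) = C * ennreal ((1 + t) powr - a)"
  shows "(\<integral>\<^sup>+x. w x * neg_power s (Q x) \<partial>M) = C * ennreal (Gamma (a - s) / Gamma a)"
proof -
  have G: "0 < Gamma s" "0 < Gamma (a - s)" "0 < Gamma a"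
    using s by (auto intro!: Gamma_real_pos)
  interpret pair_sigma_finite M lborel
    using sf by (simp add: pair_sigma_finite_def sigma_finite_lborel)
  have "ennreal (Gamma s) * (\<integral>\<^sup>+x. w x * neg_power s (Q x) \<partial>M)
      = (\<integral>\<^sup>+x. w x * (ennreal (Gamma s) * neg_power s (Q x)) \<partial>M)"
    by (subst nn_integral_cmult[symmetric]) (auto simp: mult_ac)
  also have "\<dots> = (\<integral>\<^sup>+x. \<integral>\<^sup>+t. w x * (ennreal (t powr (s - 1) * exp (- (t * Q x))) * indicator {0<..} t) \<partial>lborel \<partial>M)"
    by (intro nn_integral_cong, subst nn_integral_cmult)
       (auto simp: nn_integral_gamma_kernel[OF s(1) Q])
  also have "\<dots> = (\<integral>\<^sup>+t. \<integral>\<^sup>+x. w x * (ennreal (t powr (s - 1) * exp (- (t * Q x))) * indicator {0<..} t) \<partial>M \<partial>lborel)"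
    by (rule Fubini'[symmetric]) measurable
  also have "\<dots> = (\<integral>\<^sup>+t. C * (ennreal (t powr (s - 1) * (1 + t) powr - a) * indicator {0<..} t) \<partial>lborel)"
  proof (intro nn_integral_cong)
    fix t :: real
    show "(\<integral>\<^sup>+x. w x * (ennreal (t powr (s - 1) * exp (- (t * Q x))) * indicator {0<..} t) \<partial>M)
      = C * (ennreal (t powr (s - 1) * (1 + t) powr - a) * indicator {0<..} t)"
    proof (cases "0 < t")
      case True
      have "(\<integral>\<^sup>+x. w x * (ennreal (t powr (s - 1) * exp (- (t * Q x))) * indicator {0<..} t) \<partial>M)
        = (\<integral>\<^sup>+x. ennreal (t powr (s - 1)) * (w x * ennreal (exp (- (t * Q x)))) \<partial>M)"
        using True by (intro nn_integral_cong) (simp add: ennreal_mult mult_ac)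
      also have "\<dots> = ennreal (t powr (s - 1)) * (C * ennreal ((1 + t) powr - a))"
        using laplace[OF True] by (subst nn_integral_cmult) auto
      finally show ?thesis
        using True by (simp add: ennreal_mult mult_ac)
    qed simp
  qed
  also have "\<dots> = C * ennreal (Gamma s * Gamma (a - s) / Gamma a)"
    using nn_integral_beta_kernel[OF s] by (subst nn_integral_cmult) auto
  finally have "ennreal (inverse (Gamma s)) * (ennreal (Gamma s) * (\<integral>\<^sup>+x. w x * neg_power s (Q x) \<partial>M))
      = C * (ennreal (inverse (Gamma s)) * ennreal (Gamma s * Gamma (a - s) / Gamma a))"
    by (simp add: mult_ac)
  then show ?thesis
    using G by (simp add: mult.assoc[symmetric] ennreal_mult'[symmetric] field_simps del: mult.assoc)
qed

section \<open>Squared distances to a row space\<close>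

lemma sum_singleton_times: "(\<Sum>p\<in>{a} \<times> B. f p) = (\<Sum>b\<in>B. f (a, b))"
proof -
  have "{a} \<times> B = Pair a ` B" by auto
  then show ?thesis by (simp add: sum.reindex inj_on_def)
qed

text \<open>
  Under \<open>decomp\<close>, which is the theorem of Pythagoras, \<open>q r\<close> is the squared distance from \<open>r\<close> to the span of
  the vectors \<open>y 0, \<dots>, y (n - 1)\<close>. Integrating \<open>exp (- |r|^2 - t |r - w y|^2)\<close> over \<open>w\<close> first isolates
  \<open>exp (- t * q r)\<close>; integrating over \<open>r\<close> first gives elementary Gaussian integrals. The unknown
  constant \<open>C\<close>, the integral of \<open>exp (- |w y|^2)\<close>, occurs on both sides and cancels; the bound by \<open>K\<close>,
  which expresses linear independence, makes it finite.
\<close>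
lemma row_laplace:
  fixes y :: "nat \<Rightarrow> 'j \<Rightarrow> complex" and q :: "('j \<Rightarrow> complex) \<Rightarrow> real"
  assumes J: "finite J" and q[measurable]: "q \<in> borel_measurable (cleb J)"
    and decomp: "\<And>r. \<exists>w0. \<forall>w. (\<Sum>j\<in>J. (cmod (r j - (\<Sum>i<n. w i * y i j)))\<^sup>2)
        = q r + (\<Sum>j\<in>J. (cmod (\<Sum>i<n. (w i - w0 i) * y i j))\<^sup>2)"
    and K: "0 < K" "\<And>w. sq_norm {..<n} w \<le> K * (\<Sum>j\<in>J. (cmod (\<Sum>i<n. w i * y i j))\<^sup>2)"
    and t: "0 < t"
  shows "(\<integral>\<^sup>+r. gauss_weight J r * ennreal (exp (- (t * q r))) \<partial>cleb J)
    = ennreal (pi ^ card J) * ennreal ((1 + t) powr - (real (card J) - real n))"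
proof -
  define N where "N w = (\<Sum>j\<in>J. (cmod (\<Sum>i<n. w i * y i j))\<^sup>2)" for w :: "nat \<Rightarrow> complex"
  define C where "C = (\<integral>\<^sup>+w. ennreal (exp (- N w)) \<partial>cleb {..<n})"
  note [simp] = J
  have [measurable]: "N \<in> borel_measurable (cleb {..<n})"
    unfolding N_def by measurable
  have N_restrict: "N (\<lambda>i\<in>{..<n}. w i) = N w" for w
    by (simp add: N_def)
  have "C \<le> (\<integral>\<^sup>+w. ennreal (exp (- (1 / K * sq_norm {..<n} w))) \<partial>cleb {..<n})"
    unfolding C_def using K by (intro nn_integral_mono) (simp add: N_def field_simps)
  also have "\<dots> = ennreal ((pi / (1 / K)) ^ card {..<n})"
    by (rule nn_integral_cleb_gauss) (use K in auto)
  finally have C_finite: "C < \<infinity>"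
    by (auto simp: le_less_trans)
  have "C \<noteq> 0"
  proof
    assume "C = 0"
    then have "AE w in cleb {..<n}. ennreal (exp (- N w)) = 0"
      unfolding C_def by (subst (asm) nn_integral_0_iff_AE) auto
    then have "AE w in cleb {..<n}. False"
      by simp
    then have "(\<integral>\<^sup>+w. ennreal (exp (- (1 * sq_norm {..<n} w))) \<partial>cleb {..<n})
        = (\<integral>\<^sup>+w. 0 \<partial>cleb {..<n})"
      by (intro nn_integral_cong_AE) auto
    then show False
      by (subst (asm) nn_integral_cleb_gauss) auto
  qed
  with C_finite obtain c where c: "0 < c" "C = ennreal c"
    by (cases C) (auto simp: less_le)
  have gauss_w: "(\<integral>\<^sup>+w. ennreal (exp (- (a * N (\<lambda>i. w i - w0 i)))) \<partial>cleb {..<n}) = ennreal (c / a ^ n)"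
    if a: "0 < a" for a w0
  proof -
    have [measurable]: "(\<lambda>w. N (\<lambda>i. w i - w0 i)) \<in> borel_measurable (cleb {..<n})"
      unfolding N_def by measurable
    have N_scale: "N (\<lambda>i. (1 / sqrt a) *\<^sub>R w i) = N w / a" for w
    proof -
      have "(\<Sum>i<n. ((1 / sqrt a) *\<^sub>R w i) * y i j) = (1 / sqrt a) *\<^sub>R (\<Sum>i<n. w i * y i j)" for j
        by (simp only: scaleR_sum_right mult_scaleR_left)
      then show ?thesis
        using a by (simp only: N_def norm_scaleR power_mult_distrib sum_distrib_left[symmetric])
          (simp add: power_divide)
    qed
    have eq: "N (\<lambda>i. (\<lambda>i\<in>{..<n}. w0 i + (1 / sqrt a) *\<^sub>R w i) i - w0 i) = N w / a" for w
    proof -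
      have "N (\<lambda>i. (\<lambda>i\<in>{..<n}. w0 i + (1 / sqrt a) *\<^sub>R w i) i - w0 i) = N (\<lambda>i. (1 / sqrt a) *\<^sub>R w i)"
        by (simp add: N_def)
      then show ?thesis by (simp only: N_scale)
    qed
    have "(\<integral>\<^sup>+w. ennreal (exp (- (a * N (\<lambda>i. w i - w0 i)))) \<partial>cleb {..<n})
       = ennreal ((1 / sqrt a) ^ (2 * card {..<n})) * (\<integral>\<^sup>+w. ennreal (exp (- (a * N (\<lambda>i. (\<lambda>i\<in>{..<n}. w0 i + (1 / sqrt a) *\<^sub>R w i) i - w0 i)))) \<partial>cleb {..<n})"
      by (rule nn_integral_cleb_affine) (use a in auto)
    also have "\<dots> = ennreal ((1 / sqrt a) ^ (2 * card {..<n})) * C"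
      unfolding eq using a by (simp add: C_def)
    also have "\<dots> = ennreal (c / a ^ n)"
      using a c by (simp add: power_mult power_divide ennreal_mult'[symmetric])
    finally show ?thesis .
  qed
  have gauss_r: "(\<integral>\<^sup>+r. gauss_weight J r *
      ennreal (exp (- (t * (\<Sum>j\<in>J. (cmod (r j - v j))\<^sup>2)))) \<partial>cleb J)
    = ennreal ((pi / (1 + t)) ^ card J) * ennreal (exp (- (t / (1 + t) * sq_norm J v)))" for v
  proof -
    \<comment> \<open>the minimum over \<open>r\<close> of \<open>|r|^2 + t |r - v|^2\<close> is attained at \<open>r = \<theta> v\<close>\<close>
    define \<theta> where "\<theta> = t / (1 + t)"
    have th: "\<theta> = t * (1 - \<theta>)"
      using t by (simp add: \<theta>_def field_simps)
    have sq: "(cmod (\<theta> *\<^sub>R a + z))\<^sup>2 + t * (cmod (\<theta> *\<^sub>R a + z - a))\<^sup>2 = (1 + t) * (cmod z)\<^sup>2 + \<theta> * (cmod a)\<^sup>2" for a z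
    proof -
      \<comment> \<open>the cross terms vanish because \<open>\<theta> = t * (1 - \<theta>)\<close>\<close>
    have real: "(\<theta> * a + z)\<^sup>2 + t * (\<theta> * a + z - a)\<^sup>2 = (1 + t) * z\<^sup>2 + \<theta> * a\<^sup>2" for a z :: real
      proof -
        have "(\<theta> * a + z)\<^sup>2 + t * (\<theta> * a + z - a)\<^sup>2
          = (1 + t) * z\<^sup>2 + \<theta> * a\<^sup>2 + (\<theta> - t * (1 - \<theta>)) * (2 * a * z - (1 - \<theta>) * a\<^sup>2)"
          by (simp add: power2_eq_square algebra_simps)
        then show ?thesis using th by simp
      qed
      show ?thesis
        using real[of "Re a" "Re z"] real[of "Im a" "Im z"]
        by (simp add: cmod_power2 algebra_simps)
    qed
    have "(\<integral>\<^sup>+r. gauss_weight J r *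
      ennreal (exp (- (t * (\<Sum>j\<in>J. (cmod (r j - v j))\<^sup>2)))) \<partial>cleb J)
     = (\<integral>\<^sup>+r. ennreal (exp (- (\<Sum>j\<in>J. (cmod (r j))\<^sup>2 + t * (cmod (r j - v j))\<^sup>2))) \<partial>cleb J)"
      by (simp add: ennreal_mult[symmetric] exp_add[symmetric] sum.distrib sum_distrib_left)
    also have "\<dots> = ennreal (1 ^ (2 * card J)) * (\<integral>\<^sup>+r. ennreal (exp (- (\<Sum>j\<in>J.
        (cmod ((\<lambda>j\<in>J. \<theta> *\<^sub>R v j + 1 *\<^sub>R r j) j))\<^sup>2 + t * (cmod ((\<lambda>j\<in>J. \<theta> *\<^sub>R v j + 1 *\<^sub>R r j) j - v j))\<^sup>2))) \<partial>cleb J)"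
      by (rule nn_integral_cleb_affine) auto
    also have "\<dots> = (\<integral>\<^sup>+r. ennreal (exp (- (\<Sum>j\<in>J. (1 + t) * (cmod (r j))\<^sup>2 + \<theta> * (cmod (v j))\<^sup>2))) \<partial>cleb J)"
      by (simp add: sq cong: sum.cong)
    also have "\<dots> = (\<integral>\<^sup>+r. ennreal (exp (- ((1 + t) * sq_norm J r))) *
        ennreal (exp (- (\<theta> * sq_norm J v))) \<partial>cleb J)"
      by (simp add: ennreal_mult[symmetric] exp_add[symmetric] sum.distrib sum_distrib_left)
    also have "\<dots> = ennreal ((pi / (1 + t)) ^ card J) * ennreal (exp (- (\<theta> * sq_norm J v)))"
      using t by (subst nn_integral_multc) (auto simp: nn_integral_cleb_gauss)
    finally show ?thesis
      by (simp add: \<theta>_def)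
  qed
  \<comment> \<open>the two evaluations of the double integral, compared in \<open>eq\<close>\<close>
  define A where "A = (\<integral>\<^sup>+r. gauss_weight J r * ennreal (exp (- (t * q r))) \<partial>cleb J)"
  interpret W: pair_sigma_finite "cleb {..<n}" "cleb J"
    by (rule pair_sigma_finite_cleb) auto
  have "A * ennreal (c / t ^ n) = (\<integral>\<^sup>+r. gauss_weight J r * ennreal (exp (- (t * q r))) * ennreal (c / t ^ n) \<partial>cleb J)"
    unfolding A_def by (rule nn_integral_multc[symmetric]) measurable
  also have "\<dots> = (\<integral>\<^sup>+r. \<integral>\<^sup>+w. gauss_weight J r *
      ennreal (exp (- (t * (\<Sum>j\<in>J. (cmod (r j - (\<Sum>i<n. w i * y i j)))\<^sup>2)))) \<partial>cleb {..<n} \<partial>cleb J)"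
  proof (intro nn_integral_cong)
    fix r :: "'j \<Rightarrow> complex"
    obtain w0 where w0: "\<And>w. (\<Sum>j\<in>J. (cmod (r j - (\<Sum>i<n. w i * y i j)))\<^sup>2) = q r + N (\<lambda>i. w i - w0 i)"
      using decomp[of r] by (auto simp: N_def)
    have [measurable]: "(\<lambda>w. N (\<lambda>i. w i - w0 i)) \<in> borel_measurable (cleb {..<n})"
      unfolding N_def by measurable
    have "(\<integral>\<^sup>+w. gauss_weight J r *
      ennreal (exp (- (t * (\<Sum>j\<in>J. (cmod (r j - (\<Sum>i<n. w i * y i j)))\<^sup>2)))) \<partial>cleb {..<n})
      = (\<integral>\<^sup>+w. (gauss_weight J r * ennreal (exp (- (t * q r)))) *
          ennreal (exp (- (t * N (\<lambda>i. w i - w0 i)))) \<partial>cleb {..<n})"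
      unfolding w0 by (simp add: ennreal_mult[symmetric] exp_add[symmetric] algebra_simps)
    also have "\<dots> = (gauss_weight J r * ennreal (exp (- (t * q r)))) * ennreal (c / t ^ n)"
      by (subst nn_integral_cmult) (auto simp: gauss_w t)
    finally show "gauss_weight J r * ennreal (exp (- (t * q r))) * ennreal (c / t ^ n)
      = (\<integral>\<^sup>+w. gauss_weight J r *
      ennreal (exp (- (t * (\<Sum>j\<in>J. (cmod (r j - (\<Sum>i<n. w i * y i j)))\<^sup>2)))) \<partial>cleb {..<n})" ..
  qed
  also have "\<dots> = (\<integral>\<^sup>+w. \<integral>\<^sup>+r. gauss_weight J r *
      ennreal (exp (- (t * (\<Sum>j\<in>J. (cmod (r j - (\<Sum>i<n. w i * y i j)))\<^sup>2)))) \<partial>cleb J \<partial>cleb {..<n})"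
    by (rule W.Fubini') measurable
  also have "\<dots> = (\<integral>\<^sup>+w. ennreal ((pi / (1 + t)) ^ card J) * ennreal (exp (- (t / (1 + t) * N (\<lambda>i. w i - 0)))) \<partial>cleb {..<n})"
    unfolding gauss_r by (simp add: N_def)
  also have "\<dots> = ennreal ((pi / (1 + t)) ^ card J) * ennreal (c / (t / (1 + t)) ^ n)"
    using t gauss_w[of "t / (1 + t)" "\<lambda>_. 0"] by (subst nn_integral_cmult) auto
  finally have eq: "A * ennreal (c / t ^ n) = ennreal ((pi / (1 + t)) ^ card J) * ennreal (c / (t / (1 + t)) ^ n)" .
  have "A = A * ennreal (c / t ^ n) * ennreal (t ^ n / c)"
    using t c by (simp add: mult.assoc ennreal_mult'[symmetric])
  also have "\<dots> = ennreal ((pi / (1 + t)) ^ card J * (1 + t) ^ n)"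
    using t c unfolding eq by (simp add: ennreal_mult'[symmetric] power_divide)
  also have "(pi / (1 + t)) ^ card J * (1 + t) ^ n = pi ^ card J * (1 + t) powr - (real (card J) - real n)"
    using t by (simp add: powr_diff powr_realpow power_divide)
  finally show ?thesis
    by (simp add: A_def ennreal_mult')
qed

section \<open>Gram determinants\<close>

definition gram_mat :: "nat \<Rightarrow> nat \<Rightarrow> (nat \<times> nat \<Rightarrow> complex) \<Rightarrow> complex mat" where
  "gram_mat n m x = Matrix.mat n n (\<lambda>(i, k). \<Sum>j<m. x (i, j) * cnj (x (k, j)))"

definition gram_det :: "nat \<Rightarrow> nat \<Rightarrow> (nat \<times> nat \<Rightarrow> complex) \<Rightarrow> real" where
  "gram_det n m x = Re (Determinant.det (gram_mat n m x))"

lemma gram_mat_carrier [simp]: "gram_mat n m x \<in> carrier_mat n n"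
  by (simp add: gram_mat_def)

lemma gram_mat_index:
  "i < n \<Longrightarrow> k < n \<Longrightarrow> gram_mat n m x $$ (i, k) = (\<Sum>j<m. x (i, j) * cnj (x (k, j)))"
  by (simp add: gram_mat_def)

lemma mat_adjoint_carrier: "A \<in> carrier_mat n m \<Longrightarrow> mat_adjoint A \<in> carrier_mat m n"
  by (auto simp: mat_adjoint_def mat_of_rows_def)

lemma mat_adjoint_index:
  "i < dim_col A \<Longrightarrow> j < dim_row A \<Longrightarrow> mat_adjoint A $$ (i, j) = conjugate (A $$ (j, i))"
  by (simp add: mat_adjoint_def mat_of_rows_def)

lemma mult_mat_adjoint_eq_gram_mat:
  assumes A: "A \<in> carrier_mat n m" and x: "\<And>i j. i < n \<Longrightarrow> j < m \<Longrightarrow> x (i, j) = A $$ (i, j)"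
  shows "A * mat_adjoint A = gram_mat n m x"
proof (rule eq_matI)
  fix i k assume "i < dim_row (gram_mat n m x)" "k < dim_col (gram_mat n m x)"
  then show "(A * mat_adjoint A) $$ (i, k) = gram_mat n m x $$ (i, k)"
    using A mat_adjoint_carrier[OF A]
    by (auto simp: gram_mat_def scalar_prod_def mat_adjoint_index x atLeast0LessThan intro!: sum.cong)
qed (use A mat_adjoint_carrier[OF A] in \<open>auto simp: gram_mat_def\<close>)

lemma gram_mat_cong: "(\<And>i j. i < n \<Longrightarrow> j < m \<Longrightarrow> x (i, j) = y (i, j)) \<Longrightarrow> gram_mat n m x = gram_mat n m y"
  by (auto simp: gram_mat_def intro!: eq_matI sum.cong)

lemma gram_det_cong: "(\<And>i j. i < n \<Longrightarrow> j < m \<Longrightarrow> x (i, j) = y (i, j)) \<Longrightarrow> gram_det n m x = gram_det n m y"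
  unfolding gram_det_def by (subst gram_mat_cong) auto

lemma measurable_gram_det:
  assumes "grid n m \<subseteq> I"
  shows "gram_det n m \<in> borel_measurable (cleb I)"
proof -
  have "gram_det n m = (\<lambda>x. Re (\<Sum>p\<in>{p. p permutes {0..<n}}. signof p *
      (\<Prod>i = 0..<n. \<Sum>j<m. x (i, j) * cnj (x (p i, j)))))"
  proof
    fix x
    show "gram_det n m x = Re (\<Sum>p\<in>{p. p permutes {0..<n}}. signof p *
      (\<Prod>i = 0..<n. \<Sum>j<m. x (i, j) * cnj (x (p i, j))))"
      unfolding gram_det_def by (subst det_def'[OF gram_mat_carrier])
       (auto simp: gram_mat_def permutes_in_image intro!: arg_cong[where f=Re] sum.cong prod.cong)
  qed
  moreover have "(\<lambda>x. Re (\<Sum>p\<in>{p. p permutes {0..<n}}. signof p *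
      (\<Prod>i = 0..<n. \<Sum>j<m. x (i, j) * cnj (x (p i, j))))) \<in> borel_measurable (cleb I)"
  proof (rule measurable_compose[where g=Re])
    show "(\<lambda>x. \<Sum>p\<in>{p. p permutes {0..<n}}. signof p *
      (\<Prod>i = 0..<n. \<Sum>j<m. x (i, j) * cnj (x (p i, j)))) \<in> borel_measurable (cleb I)"
    proof (intro borel_measurable_sum borel_measurable_times borel_measurable_prod)
      fix p i j assume "p \<in> {p. p permutes {0..<n}}" "i \<in> {0..<n}" "j \<in> {..<m}"
      then have "(i, j) \<in> I" "(p i, j) \<in> I"
        using assms by (auto simp: permutes_in_image subset_eq)
      moreover have [measurable]: "cnj \<in> borel_measurable borel"
        by (intro borel_measurable_continuous_onI continuous_intros)
      ultimately show "(\<lambda>x. x (i, j)) \<in> borel_measurable (cleb I)" "(\<lambda>x. cnj (x (p i, j))) \<in> borel_measurable (cleb I)"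
        by measurable
    qed auto
  qed auto
  ultimately show ?thesis by simp
qed

text \<open>
  Subtracting a combination of the first \<open>n\<close> rows from row \<open>n\<close> is a unipotent congruence of the Gram
  matrix and keeps its determinant. If the difference is orthogonal to the other rows, the new Gram
  matrix is block diagonal.
\<close>
lemma det_gram_mat_Suc:
  fixes x :: "nat \<times> nat \<Rightarrow> complex" and w :: "nat \<Rightarrow> complex" and n :: nat
  defines "e \<equiv> \<lambda>j. x (n, j) - (\<Sum>i<n. w i * x (i, j))"
  assumes orth: "\<And>k. k < n \<Longrightarrow> (\<Sum>j<m. e j * cnj (x (k, j))) = 0"
  shows "Determinant.det (gram_mat (Suc n) m x)
    = Determinant.det (gram_mat n m x) * complex_of_real (sq_norm {..<m} e)"
proof -
  define x' where "x' = (\<lambda>(i, j). if i = n then e j else x (i, j))"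
  define L where "L = Matrix.mat (Suc n) (Suc n) (\<lambda>(i, k). if i = k then 1 else if i = n then w k else 0)"
  define U where "U = Matrix.mat (Suc n) (Suc n) (\<lambda>(k, i). cnj (L $$ (i, k)))"
  have L: "L \<in> carrier_mat (Suc n) (Suc n)" and U: "U \<in> carrier_mat (Suc n) (Suc n)"
    by (auto simp: L_def U_def)
  have x: "x (i, j) = (\<Sum>k<Suc n. L $$ (i, k) * x' (k, j))" if "i < Suc n" for i j
  proof (cases "i = n")
    case True
    then show ?thesis by (simp add: L_def x'_def e_def)
  next
    case False
    with that have "(\<Sum>k<Suc n. L $$ (i, k) * x' (k, j)) = (\<Sum>k<Suc n. if k = i then x (i, j) else 0)"
      by (intro sum.cong) (auto simp: L_def x'_def)
    also have "\<dots> = x (i, j)" using that by simp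
    finally show ?thesis ..
  qed
  have "gram_mat (Suc n) m x = L * gram_mat (Suc n) m x' * U"
  proof (rule eq_matI)
    fix i k assume "i < dim_row (L * gram_mat (Suc n) m x' * U)" "k < dim_col (L * gram_mat (Suc n) m x' * U)"
    then have ik: "i < Suc n" "k < Suc n" using L U by auto
    have "gram_mat (Suc n) m x $$ (i, k)
        = (\<Sum>j<m. (\<Sum>a<Suc n. L $$ (i, a) * x' (a, j)) * cnj (\<Sum>b<Suc n. L $$ (k, b) * x' (b, j)))"
      using ik by (simp add: gram_mat_def x del: sum.lessThan_Suc)
    also have "\<dots> = (\<Sum>j<m. \<Sum>b<Suc n. \<Sum>a<Suc n. L $$ (i, a) * (x' (a, j) * cnj (x' (b, j))) * cnj (L $$ (k, b)))"
      by (simp add: sum_distrib_left sum_distrib_right mult_ac del: sum.lessThan_Suc)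
    also have "\<dots> = (\<Sum>b<Suc n. \<Sum>j<m. \<Sum>a<Suc n. L $$ (i, a) * (x' (a, j) * cnj (x' (b, j))) * cnj (L $$ (k, b)))"
      by (rule sum.swap)
    also have "\<dots> = (\<Sum>b<Suc n. \<Sum>a<Suc n. \<Sum>j<m. L $$ (i, a) * (x' (a, j) * cnj (x' (b, j))) * cnj (L $$ (k, b)))"
      by (rule sum.cong[OF refl], rule sum.swap)
    also have "\<dots> = (\<Sum>b<Suc n. (\<Sum>a<Suc n. L $$ (i, a) * (\<Sum>j<m. x' (a, j) * cnj (x' (b, j)))) * cnj (L $$ (k, b)))"
      by (simp add: sum_distrib_left sum_distrib_right mult_ac del: sum.lessThan_Suc)
    also have "\<dots> = (L * gram_mat (Suc n) m x' * U) $$ (i, k)"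
      using ik L by (simp add: gram_mat_def scalar_prod_def U_def atLeast0LessThan del: sum.lessThan_Suc)
    finally show "gram_mat (Suc n) m x $$ (i, k) = (L * gram_mat (Suc n) m x' * U) $$ (i, k)" .
  qed (use L U in \<open>auto simp: gram_mat_def\<close>)
  moreover have "Determinant.det L = 1"
    by (subst det_lower_triangular[OF _ L]) (auto simp: L_def prod_list_diag_prod)
  moreover have "Determinant.det U = 1"
    by (subst det_upper_triangular[OF _ U]) (auto simp: U_def L_def prod_list_diag_prod upper_triangular_def)
  moreover have "Determinant.det (gram_mat (Suc n) m x')
      = Determinant.det (gram_mat n m x) * complex_of_real (sq_norm {..<m} e)"
  proof -
  have "gram_mat (Suc n) m x' = four_block_mat (gram_mat n m x) (0\<^sub>m n 1) (0\<^sub>m 1 n)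
      (Matrix.mat 1 1 (\<lambda>_. complex_of_real (sq_norm {..<m} e)))" (is "_ = ?B")
  proof (rule eq_matI)
    fix i k assume "i < dim_row ?B" "k < dim_col ?B"
    then have ik: "i < Suc n" "k < Suc n" by (auto simp: gram_mat_def)
    have orth': "(\<Sum>j<m. x (k, j) * cnj (e j)) = 0" if "k < n" for k
    proof -
      have "(\<Sum>j<m. x (k, j) * cnj (e j)) = cnj (\<Sum>j<m. e j * cnj (x (k, j)))"
        by (simp add: mult.commute)
      then show ?thesis using orth[OF that] by simp
    qed
    show "gram_mat (Suc n) m x' $$ (i, k) = ?B $$ (i, k)"
      using ik by (auto simp: gram_mat_def x'_def orth orth' less_Suc_eq complex_norm_square[symmetric])
  qed (auto simp: gram_mat_def)
    then show ?thesis
      by (simp only:, subst det_four_block_mat_upper_right_zero_col[OF gram_mat_carrier refl])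
         (auto simp: det_single)
  qed
  ultimately show ?thesis
    by (simp only: det_mult[OF mult_carrier_mat[OF L gram_mat_carrier] U] det_mult[OF L gram_mat_carrier]) simp
qed

lemma mat_inverse_sums:
  assumes "Determinant.det G \<noteq> (0 :: complex)" "G \<in> carrier_mat n n"
  shows "\<exists>H. (\<forall>i<n. \<forall>k<n. (\<Sum>l<n. H i l * G $$ (l, k)) = (if i = k then 1 else 0)) \<and>
    (\<forall>i<n. \<forall>k<n. (\<Sum>l<n. G $$ (i, l) * H l k) = (if i = k then 1 else 0))"
proof -
  from det_non_zero_imp_unit[OF assms(2,1)] obtain B where B: "B \<in> carrier_mat n n" "B * G = 1\<^sub>m n" "G * B = 1\<^sub>m n"
    unfolding Units_def ring_mat_simps mem_Collect_eq by blast
  have "(\<Sum>l<n. B $$ (i, l) * G $$ (l, k)) = (if i = k then 1 else 0)"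
      "(\<Sum>l<n. G $$ (i, l) * B $$ (l, k)) = (if i = k then 1 else 0)" if ik: "i < n" "k < n" for i k
  proof -
    have "(B * G) $$ (i, k) = (\<Sum>l<n. B $$ (i, l) * G $$ (l, k))"
         "(G * B) $$ (i, k) = (\<Sum>l<n. G $$ (i, l) * B $$ (l, k))"
      using ik B(1) assms(2) by (auto simp: scalar_prod_def atLeast0LessThan)
    then show "(\<Sum>l<n. B $$ (i, l) * G $$ (l, k)) = (if i = k then 1 else 0)"
        "(\<Sum>l<n. G $$ (i, l) * B $$ (l, k)) = (if i = k then 1 else 0)"
      using ik B by auto
  qed
  then show ?thesis
    by (intro exI[of _ "\<lambda>i k. B $$ (i, k)"]) simp
qed

text \<open>
  Rows with an invertible Gram matrix \<open>G\<close> have a bounded left inverse: the coefficients \<open>w\<close> are recovered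
  from the combination \<open>w x\<close> by multiplying with \<open>x^H G^(-1)\<close>, and Cauchy--Schwarz bounds each of them.
\<close>
lemma gram_rows_coercive:
  assumes det: "Determinant.det (gram_mat n m x) \<noteq> 0"
  shows "\<exists>K>0. \<forall>w. sq_norm {..<n} w \<le> K * (\<Sum>j<m. (cmod (\<Sum>i<n. w i * x (i, j)))\<^sup>2)"
proof -
  obtain H where H: "\<And>i k. i < n \<Longrightarrow> k < n \<Longrightarrow> (\<Sum>l<n. gram_mat n m x $$ (i, l) * H l k) = (if i = k then 1 else 0)"
    using mat_inverse_sums[OF det gram_mat_carrier] by metis
  define P where "P j i = (\<Sum>k<n. cnj (x (k, j)) * H k i)" for j i
  have w: "w i = (\<Sum>j<m. (\<Sum>l<n. w l * x (l, j)) * P j i)" if i: "i < n" for w i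
  proof -
    have "(\<Sum>j<m. (\<Sum>l<n. w l * x (l, j)) * P j i)
        = (\<Sum>j<m. \<Sum>l<n. \<Sum>k<n. w l * ((x (l, j) * cnj (x (k, j))) * H k i))"
      unfolding P_def by (intro sum.cong refl, subst sum_product) (simp add: mult_ac)
    also have "\<dots> = (\<Sum>l<n. \<Sum>j<m. \<Sum>k<n. w l * ((x (l, j) * cnj (x (k, j))) * H k i))"
      by (rule sum.swap)
    also have "\<dots> = (\<Sum>l<n. \<Sum>k<n. \<Sum>j<m. w l * ((x (l, j) * cnj (x (k, j))) * H k i))"
      by (rule sum.cong[OF refl], rule sum.swap)
    also have "\<dots> = (\<Sum>l<n. w l * (\<Sum>k<n. gram_mat n m x $$ (l, k) * H k i))"
      by (simp add: gram_mat_index sum_distrib_left sum_distrib_right mult.assoc cong: sum.cong_simp)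
    also have "\<dots> = (\<Sum>l<n. if l = i then w i else 0)"
      using i by (intro sum.cong) (auto simp: H)
    also have "\<dots> = w i" using i by simp
    finally show ?thesis ..
  qed
  define K where "K = 1 + (\<Sum>i<n. \<Sum>j<m. (cmod (P j i))\<^sup>2)"
  show ?thesis
  proof (intro exI[of _ K] conjI allI)
    show "0 < K"
      unfolding K_def by (intro add_pos_nonneg sum_nonneg) auto
    fix w :: "nat \<Rightarrow> complex"
    define N where "N = (\<Sum>j<m. (cmod (\<Sum>i<n. w i * x (i, j)))\<^sup>2)"
    have N: "0 \<le> N" unfolding N_def by (intro sum_nonneg) auto
    have "(cmod (w i))\<^sup>2 \<le> N * (\<Sum>j<m. (cmod (P j i))\<^sup>2)" if i: "i < n" for i
    proof -
      have "cmod (w i) = cmod (\<Sum>j<m. (\<Sum>l<n. w l * x (l, j)) * P j i)"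
        by (simp only: w[OF i, of w, symmetric])
      also have "\<dots> \<le> (\<Sum>j<m. cmod (\<Sum>l<n. w l * x (l, j)) * cmod (P j i))"
        unfolding norm_mult[symmetric] by (rule norm_sum)
      finally have "cmod (w i) \<le> (\<Sum>j<m. cmod (\<Sum>l<n. w l * x (l, j)) * cmod (P j i))" .
      then have "(cmod (w i))\<^sup>2 \<le> (\<Sum>j<m. cmod (\<Sum>l<n. w l * x (l, j)) * cmod (P j i))\<^sup>2"
        by (rule power_mono) simp
      also have "\<dots> \<le> N * (\<Sum>j<m. (cmod (P j i))\<^sup>2)"
        unfolding N_def by (rule Cauchy_Schwarz_ineq_sum)
      finally show ?thesis .
    qed
    then have "sq_norm {..<n} w \<le> (\<Sum>i<n. N * (\<Sum>j<m. (cmod (P j i))\<^sup>2))"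
      by (intro sum_mono) auto
    also have "\<dots> = (K - 1) * N"
      by (simp add: K_def sum_distrib_left[symmetric] mult.commute[of _ N])
    also have "\<dots> \<le> K * N"
      using N by (intro mult_right_mono) auto
    finally show "sq_norm {..<n} w \<le> K * (\<Sum>j<m. (cmod (\<Sum>i<n. w i * x (i, j)))\<^sup>2)"
      by (simp add: N_def)
  qed
qed

text \<open>
  The coefficients \<open>w0\<close> of the orthogonal projection of row \<open>n\<close> onto the span of the earlier rows solve the
  normal equations; the quotient of consecutive Gram determinants is the squared norm of the
  remainder.
\<close>
lemma gram_det_Suc_decomp:
  assumes det: "gram_det n m x \<noteq> 0"
  shows "\<exists>w0. \<forall>w. (\<Sum>j<m. (cmod (x (n, j) - (\<Sum>i<n. w i * x (i, j))))\<^sup>2)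
     = gram_det (Suc n) m x / gram_det n m x + (\<Sum>j<m. (cmod (\<Sum>i<n. (w i - w0 i) * x (i, j)))\<^sup>2)"
proof -
  have det': "Determinant.det (gram_mat n m x) \<noteq> 0"
    using det by (auto simp: gram_det_def)
  obtain H where H: "\<And>i k. i < n \<Longrightarrow> k < n \<Longrightarrow> (\<Sum>l<n. H i l * gram_mat n m x $$ (l, k)) = (if i = k then 1 else 0)"
    using mat_inverse_sums[OF det' gram_mat_carrier] by metis
  define b where "b k = (\<Sum>j<m. x (n, j) * cnj (x (k, j)))" for k
  define w0 where "w0 i = (\<Sum>k<n. b k * H k i)" for i
  define e where "e j = x (n, j) - (\<Sum>i<n. w0 i * x (i, j))" for j
  have orth: "(\<Sum>j<m. e j * cnj (x (k, j))) = 0" if k: "k < n" for k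
  proof -
    have "(\<Sum>j<m. (\<Sum>i<n. w0 i * x (i, j)) * cnj (x (k, j))) = (\<Sum>j<m. \<Sum>i<n. w0 i * (x (i, j) * cnj (x (k, j))))"
      by (simp add: sum_distrib_right mult.assoc)
    also have "\<dots> = (\<Sum>i<n. \<Sum>j<m. w0 i * (x (i, j) * cnj (x (k, j))))"
      by (rule sum.swap)
    also have "\<dots> = (\<Sum>i<n. w0 i * gram_mat n m x $$ (i, k))"
      using k by (intro sum.cong refl) (simp add: gram_mat_index sum_distrib_left)
    also have "\<dots> = (\<Sum>i<n. \<Sum>l<n. b l * (H l i * gram_mat n m x $$ (i, k)))"
      by (simp add: w0_def sum_distrib_right mult.assoc)
    also have "\<dots> = (\<Sum>l<n. \<Sum>i<n. b l * (H l i * gram_mat n m x $$ (i, k)))"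
      by (rule sum.swap)
    also have "\<dots> = (\<Sum>l<n. b l * (\<Sum>i<n. H l i * gram_mat n m x $$ (i, k)))"
      by (simp add: sum_distrib_left)
    also have "\<dots> = (\<Sum>l<n. if l = k then b k else 0)"
      using k by (intro sum.cong) (auto simp: H)
    also have "\<dots> = b k" using k by simp
    finally show ?thesis
      by (simp add: e_def b_def left_diff_distrib sum_subtractf)
  qed
  have "Determinant.det (gram_mat (Suc n) m x)
      = Determinant.det (gram_mat n m x) * complex_of_real (sq_norm {..<m} e)"
    using orth unfolding e_def by (rule det_gram_mat_Suc)
  then have q: "gram_det (Suc n) m x / gram_det n m x = sq_norm {..<m} e"
    using det by (simp add: gram_det_def)
  show ?thesis
  proof (intro exI[of _ w0] allI)
    fix w :: "nat \<Rightarrow> complex"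
    define v where "v i = w i - w0 i" for i
    define u where "u j = (\<Sum>i<n. v i * x (i, j))" for j
    have cross: "(\<Sum>j<m. e j * cnj (u j)) = 0"
    proof -
      have "(\<Sum>j<m. e j * cnj (u j)) = (\<Sum>j<m. \<Sum>i<n. cnj (v i) * (e j * cnj (x (i, j))))"
        by (simp add: u_def sum_distrib_left mult_ac)
      also have "\<dots> = (\<Sum>i<n. \<Sum>j<m. cnj (v i) * (e j * cnj (x (i, j))))"
        by (rule sum.swap)
      also have "\<dots> = 0"
        by (simp add: sum_distrib_left[symmetric] orth)
      finally show ?thesis .
    qed
    have "x (n, j) - (\<Sum>i<n. w i * x (i, j)) = e j - u j" for j
      by (simp add: e_def u_def v_def left_diff_distrib sum_subtractf)
    moreover have "(cmod (e j - u j))\<^sup>2 = (cmod (e j))\<^sup>2 + (cmod (u j))\<^sup>2 - 2 * Re (e j * cnj (u j))" for j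
      by (simp only: cmod_power2) (simp add: power2_eq_square algebra_simps)
    ultimately have eq: "(\<Sum>j<m. (cmod (x (n, j) - (\<Sum>i<n. w i * x (i, j))))\<^sup>2)
        = sq_norm {..<m} e + sq_norm {..<m} u - 2 * Re (\<Sum>j<m. e j * cnj (u j))"
      by (simp add: sum.distrib sum_subtractf sum_distrib_left)
    show "(\<Sum>j<m. (cmod (x (n, j) - (\<Sum>i<n. w i * x (i, j))))\<^sup>2)
     = gram_det (Suc n) m x / gram_det n m x + (\<Sum>j<m. (cmod (\<Sum>i<n. (w i - w0 i) * x (i, j)))\<^sup>2)"
      using eq[unfolded cross] unfolding q by (simp add: u_def v_def)
  qed
qed

section \<open>Moments of the Gram determinant\<close>

lemma gram_det_Suc_laplace:
  assumes det: "gram_det n m x \<noteq> 0" and t: "0 < t"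
  defines "J \<equiv> {n} \<times> {..<m}"
  shows "(\<integral>\<^sup>+r. gauss_weight J r *
      ennreal (exp (- (t * (gram_det (Suc n) m (merge (grid n m) J (x, r)) / gram_det n m x)))) \<partial>cleb J)
    = ennreal (pi ^ m) * ennreal ((1 + t) powr - (real m - real n))"
proof -
  let ?I = "grid n m"
  have card: "card J = m" and J: "finite J"
    by (auto simp: J_def)
  have det': "Determinant.det (gram_mat n m x) \<noteq> 0"
    using det by (auto simp: gram_det_def)
  from gram_rows_coercive[OF det'] obtain K where K: "0 < K"
    "\<forall>w. sq_norm {..<n} w \<le> K * (\<Sum>j<m. (cmod (\<Sum>i<n. w i * x (i, j)))\<^sup>2)"
    by blast
  have meas: "(\<lambda>r. gram_det (Suc n) m (merge ?I J (x, r)) / gram_det n m x) \<in> borel_measurable (cleb J)"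
  proof -
    have "(\<lambda>r. gram_det (Suc n) m (merge ?I J (x, r))) = (\<lambda>r. gram_det (Suc n) m (merge ?I J (restrict x ?I, r)))"
      by (intro ext gram_det_cong) (auto simp: merge_def J_def less_Suc_eq)
    moreover have "gram_det (Suc n) m \<in> borel_measurable (cleb (?I \<union> J))"
      by (rule measurable_gram_det) (auto simp: J_def less_Suc_eq)
    moreover have "restrict x ?I \<in> space (cleb ?I)"
      by (auto simp: space_PiM)
    then have "(\<lambda>r. merge ?I J (restrict x ?I, r)) \<in> measurable (cleb J) (cleb (?I \<union> J))"
      by (rule measurable_compose[OF measurable_Pair1' measurable_merge])
    ultimately show ?thesis by (simp add: measurable_compose)
  qed
  have "(\<integral>\<^sup>+r. gauss_weight J r *
      ennreal (exp (- (t * (gram_det (Suc n) m (merge ?I J (x, r)) / gram_det n m x)))) \<partial>cleb J)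
    = ennreal (pi ^ card J) * ennreal ((1 + t) powr - (real (card J) - real n))"
  proof (rule row_laplace[OF J meas _ K(1) _ t, where y="\<lambda>i p. x (i, snd p)"])
    fix r
    let ?x = "merge ?I J (x, r)"
    have g: "gram_det n m ?x = gram_det n m x"
      by (rule gram_det_cong) (auto simp: merge_def)
    have x: "?x (i, j) = x (i, j)" if "i < n" "j < m" for i j
      using that by (auto simp: merge_def)
    have r: "?x (n, j) = r (n, j)" if "j < m" for j
      using that by (auto simp: merge_def J_def)
    from gram_det_Suc_decomp[of n m ?x] det obtain w0 where w0:
      "\<And>w. (\<Sum>j<m. (cmod (?x (n, j) - (\<Sum>i<n. w i * ?x (i, j))))\<^sup>2)
        = gram_det (Suc n) m ?x / gram_det n m x + (\<Sum>j<m. (cmod (\<Sum>i<n. (w i - w0 i) * ?x (i, j)))\<^sup>2)"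
      unfolding g by auto
    show "\<exists>w0. \<forall>w. (\<Sum>p\<in>J. (cmod (r p - (\<Sum>i<n. w i * x (i, snd p))))\<^sup>2)
        = gram_det (Suc n) m ?x / gram_det n m x + (\<Sum>p\<in>J. (cmod (\<Sum>i<n. (w i - w0 i) * x (i, snd p)))\<^sup>2)"
    proof (intro exI[of _ w0] allI)
      fix w
      show "(\<Sum>p\<in>J. (cmod (r p - (\<Sum>i<n. w i * x (i, snd p))))\<^sup>2)
        = gram_det (Suc n) m ?x / gram_det n m x + (\<Sum>p\<in>J. (cmod (\<Sum>i<n. (w i - w0 i) * x (i, snd p)))\<^sup>2)"
        using w0[of w] by (simp add: J_def sum_singleton_times x[unfolded J_def] r[unfolded J_def] cong: sum.cong_simp)
    qed
  next
    fix w :: "nat \<Rightarrow> complex"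
    show "sq_norm {..<n} w \<le> K * (\<Sum>p\<in>J. (cmod (\<Sum>i<n. w i * x (i, snd p)))\<^sup>2)"
      using K(2)[rule_format, of w] by (simp add: J_def sum_singleton_times)
  qed
  then show ?thesis by (simp add: card)
qed

lemma gram_det_ratio_nonneg:
  assumes "gram_det n m x \<noteq> 0"
  shows "0 \<le> gram_det (Suc n) m x / gram_det n m x"
proof -
  obtain w0 where w0: "\<And>w. (\<Sum>j<m. (cmod (x (n, j) - (\<Sum>i<n. w i * x (i, j))))\<^sup>2)
     = gram_det (Suc n) m x / gram_det n m x + (\<Sum>j<m. (cmod (\<Sum>i<n. (w i - w0 i) * x (i, j)))\<^sup>2)"
    using gram_det_Suc_decomp[OF assms] by auto
  have "0 \<le> (\<Sum>j<m. (cmod (x (n, j) - (\<Sum>i<n. w0 i * x (i, j))))\<^sup>2)"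
    by (intro sum_nonneg) auto
  also have "\<dots> = gram_det (Suc n) m x / gram_det n m x"
    by (simp add: w0)
  finally show ?thesis .
qed

abbreviation gamma_quotients :: "nat \<Rightarrow> nat \<Rightarrow> real \<Rightarrow> real" where
  "gamma_quotients n m s \<equiv> \<Prod>k<n. Gamma (real m - real k - s) / Gamma (real m - real k)"

text \<open>
  The integral over the last row contributes one gamma quotient. It can be evaluated only where the
  earlier rows are independent; this holds almost everywhere because the integral for \<open>n\<close> rows is
  finite.
\<close>
lemma nn_integral_gram_det_power:
  assumes "n \<le> m" and s: "0 < s" "s < real m - real n + 1"
  shows "(\<integral>\<^sup>+x. gauss_weight (grid n m) x * neg_power s (gram_det n m x)
      \<partial>cleb (grid n m))
    = ennreal (pi ^ (n * m) * gamma_quotients n m s)"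
  using assms(1,3)
proof (induction n)
  case 0
  show ?case
    by (simp add: cleb.nn_integral_empty space_PiM emeasure_PiM_empty gram_det_def neg_power_def gram_mat_def)
next
  case (Suc n)
  let ?I = "grid n m" and ?J = "{n} \<times> {..<m}"
  let ?c = "pi ^ (n * m) * gamma_quotients n m s"
  let ?\<gamma> = "Gamma (real m - real n - s) / Gamma (real m - real n)"
  have nm: "n < m" using Suc.prems by simp
  have un: "{..<Suc n} \<times> {..<m} = ?I \<union> ?J" and dis: "?I \<inter> ?J = {}"
    by (auto simp: less_Suc_eq)
  have meas: "gram_det (Suc n) m \<in> borel_measurable (cleb (?I \<union> ?J))"
    by (rule measurable_gram_det) (auto simp: less_Suc_eq)
  have meas_n: "gram_det n m \<in> borel_measurable (cleb ?I)"
    by (rule measurable_gram_det) auto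
  note [measurable] = meas meas_n
  have pos: "0 < ?c" "0 < ?\<gamma>"
    using Suc.prems s nm by (auto intro!: mult_pos_pos prod_pos divide_pos_pos Gamma_real_pos)
  have IH: "(\<integral>\<^sup>+x. gauss_weight ?I x * neg_power s (gram_det n m x) \<partial>cleb ?I) = ennreal ?c"
    using Suc by simp
  have "AE x in cleb ?I. gauss_weight ?I x * neg_power s (gram_det n m x) \<noteq> \<infinity>"
    by (rule nn_integral_noteq_infinite) (auto simp: IH)
  then have ae: "AE x in cleb ?I. 0 < gram_det n m x"
    by eventually_elim (auto simp: neg_power_def ennreal_mult_top split: if_splits)
  have inner: "(\<integral>\<^sup>+r. gauss_weight (?I \<union> ?J) (merge ?I ?J (x, r)) *
        neg_power s (gram_det (Suc n) m (merge ?I ?J (x, r))) \<partial>cleb ?J)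
      = gauss_weight ?I x * neg_power s (gram_det n m x) * ennreal (pi ^ m * ?\<gamma>)"
    if x: "0 < gram_det n m x" "x \<in> space (cleb ?I)" for x
  proof -
    define q where "q r = gram_det (Suc n) m (merge ?I ?J (x, r)) / gram_det n m x" for r
    have g: "gram_det n m (merge ?I ?J (x, r)) = gram_det n m x" for r
      by (rule gram_det_cong) (auto simp: merge_def)
    have q0: "0 \<le> q r" for r
      using gram_det_ratio_nonneg[of n m "merge ?I ?J (x, r)"] x by (simp add: g q_def)
    have [measurable]: "q \<in> borel_measurable (cleb ?J)"
      unfolding q_def using x(2) by measurable
    have "(\<integral>\<^sup>+r. gauss_weight (?I \<union> ?J) (merge ?I ?J (x, r)) *
        neg_power s (gram_det (Suc n) m (merge ?I ?J (x, r))) \<partial>cleb ?J)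
      = (\<integral>\<^sup>+r. (gauss_weight ?I x * neg_power s (gram_det n m x)) *
         (gauss_weight ?J r * neg_power s (q r)) \<partial>cleb ?J)"
    proof (intro nn_integral_cong)
      fix r
      have "sq_norm (?I \<union> ?J) (merge ?I ?J (x, r))
          = sq_norm ?I (merge ?I ?J (x, r)) + sq_norm ?J (merge ?I ?J (x, r))"
        by (rule sum.union_disjoint) (use dis in auto)
      also have "sq_norm ?I (merge ?I ?J (x, r)) = sq_norm ?I x"
        by (intro sum.cong) (auto simp: merge_def)
      also have "sq_norm ?J (merge ?I ?J (x, r)) = sq_norm ?J r"
        by (intro sum.cong) (auto simp: merge_def)
      finally have e: "sq_norm (?I \<union> ?J) (merge ?I ?J (x, r))
        = sq_norm ?I x + sq_norm ?J r" .
      have "gram_det (Suc n) m (merge ?I ?J (x, r)) = gram_det n m x * q r"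
        using x by (simp add: q_def)
      then have "neg_power s (gram_det (Suc n) m (merge ?I ?J (x, r))) = neg_power s (gram_det n m x) * neg_power s (q r)"
        using x q0 by (simp add: neg_power_mult)
      then show "gauss_weight (?I \<union> ?J) (merge ?I ?J (x, r)) *
        neg_power s (gram_det (Suc n) m (merge ?I ?J (x, r)))
        = (gauss_weight ?I x * neg_power s (gram_det n m x)) *
         (gauss_weight ?J r * neg_power s (q r))"
        unfolding e by (simp add: exp_add exp_diff exp_minus ennreal_mult[symmetric] mult_ac flip: exp_minus)
          (simp add: ennreal_mult mult_ac exp_diff divide_inverse flip: exp_minus)
    qed
    also have "\<dots> = (gauss_weight ?I x * neg_power s (gram_det n m x)) *
        (\<integral>\<^sup>+r. gauss_weight ?J r * neg_power s (q r) \<partial>cleb ?J)"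
      by (rule nn_integral_cmult) measurable
    also have "(\<integral>\<^sup>+r. gauss_weight ?J r * neg_power s (q r) \<partial>cleb ?J) = ennreal (pi ^ m) * ennreal ?\<gamma>"
    proof (rule nn_integral_neg_power_of_laplace)
      fix t :: real assume "0 < t"
      then show "(\<integral>\<^sup>+r. gauss_weight ?J r * ennreal (exp (- (t * q r))) \<partial>cleb ?J)
        = ennreal (pi ^ m) * ennreal ((1 + t) powr - (real m - real n))"
        unfolding q_def using x by (intro gram_det_Suc_laplace) auto
    qed (use s Suc.prems q0 in \<open>auto intro!: sigma_finite_cleb\<close>)
    finally show ?thesis
      by (simp only: ennreal_mult'[OF zero_le_power[OF pi_ge_zero]])
  qed
  have "(\<integral>\<^sup>+x. gauss_weight (?I \<union> ?J) x * neg_power s (gram_det (Suc n) m x)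
      \<partial>cleb (?I \<union> ?J))
    = (\<integral>\<^sup>+x. \<integral>\<^sup>+r. gauss_weight (?I \<union> ?J) (merge ?I ?J (x, r)) *
        neg_power s (gram_det (Suc n) m (merge ?I ?J (x, r))) \<partial>cleb ?J \<partial>cleb ?I)"
    by (rule cleb.product_nn_integral_fold[OF dis]) auto
  also have "\<dots> = (\<integral>\<^sup>+x. gauss_weight ?I x * neg_power s (gram_det n m x) * ennreal (pi ^ m * ?\<gamma>) \<partial>cleb ?I)"
  proof (rule nn_integral_cong_AE)
    show "AE x in cleb ?I. (\<integral>\<^sup>+r. gauss_weight (?I \<union> ?J) (merge ?I ?J (x, r)) *
        neg_power s (gram_det (Suc n) m (merge ?I ?J (x, r))) \<partial>cleb ?J)
      = gauss_weight ?I x * neg_power s (gram_det n m x) * ennreal (pi ^ m * ?\<gamma>)"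
      using ae AE_space by eventually_elim (rule inner)
  qed
  also have "\<dots> = ennreal ?c * ennreal (pi ^ m * ?\<gamma>)"
    using IH by (subst nn_integral_multc) auto
  also have "\<dots> = ennreal (?c * (pi ^ m * ?\<gamma>))"
    by (rule ennreal_mult'[symmetric]) (rule less_imp_le[OF pos(1)])
  also have "?c * (pi ^ m * ?\<gamma>) = pi ^ (Suc n * m) * gamma_quotients (Suc n) m s"
    by (simp add: power_add mult_ac)
  finally show ?case
    by (simp only: un)
qed

section \<open>The law of the matrix entries\<close>

lemma density_cleb_prod:
  assumes I: "finite I" and g[measurable]: "g \<in> borel_measurable borel"
    and prob: "prob_space (density lborel g)"
  shows "density (cleb I) (\<lambda>z. \<Prod>i\<in>I. g (z i)) = (\<Pi>\<^sub>M i\<in>I. density lborel g)"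
proof -
  interpret prob_space "density lborel g" by (rule prob)
  interpret product_sigma_finite "\<lambda>_. density lborel g" ..
  show ?thesis
  proof (rule PiM_eqI[OF I])
    show "sets (density (cleb I) (\<lambda>z. \<Prod>i\<in>I. g (z i))) = sets (\<Pi>\<^sub>M i\<in>I. density lborel g)"
      unfolding sets_density by (intro sets_PiM_cong) auto
    fix A assume A: "\<And>i. i \<in> I \<Longrightarrow> A i \<in> sets (density lborel g)"
    then have [measurable]: "\<And>i. i \<in> I \<Longrightarrow> A i \<in> sets borel" by simp
    have PA: "Pi\<^sub>E I A \<in> sets (cleb I)"
      using A I by (intro sets_PiM_I_finite) auto
    have "emeasure (density (cleb I) (\<lambda>z. \<Prod>i\<in>I. g (z i))) (Pi\<^sub>E I A)
        = (\<integral>\<^sup>+z. (\<Prod>i\<in>I. g (z i)) * indicator (Pi\<^sub>E I A) z \<partial>cleb I)"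
      using PA by (intro emeasure_density) auto
    also have "\<dots> = (\<integral>\<^sup>+z. (\<Prod>i\<in>I. g (z i) * indicator (A i) (z i)) \<partial>cleb I)"
    proof (intro nn_integral_cong)
      fix z assume "z \<in> space (cleb I)"
      then have "indicator (Pi\<^sub>E I A) z = (\<Prod>i\<in>I. indicator (A i) (z i) :: ennreal)"
        using I by (auto simp: indicator_def space_PiM PiE_iff prod_zero_iff)
      then show "(\<Prod>i\<in>I. g (z i)) * indicator (Pi\<^sub>E I A) z = (\<Prod>i\<in>I. g (z i) * indicator (A i) (z i))"
        by (simp add: prod.distrib)
    qed
    also have "\<dots> = (\<Prod>i\<in>I. \<integral>\<^sup>+z. g z * indicator (A i) z \<partial>lborel)"
      using I by (intro cleb.product_nn_integral_prod) auto
    also have "\<dots> = (\<Prod>i\<in>I. emeasure (density lborel g) (A i))"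
      using A by (intro prod.cong) (auto simp: emeasure_density)
    finally show "emeasure (density (cleb I) (\<lambda>z. \<Prod>i\<in>I. g (z i))) (Pi\<^sub>E I A)
      = (\<Prod>i\<in>I. emeasure (density lborel g) (A i))" .
  qed
qed

definition gauss_density :: "real \<Rightarrow> complex \<Rightarrow> ennreal" where
  "gauss_density s z = ennreal (exp (- ((cmod z)\<^sup>2 / s)) / (pi * s))"

lemma measurable_gauss_density [measurable]: "gauss_density s \<in> borel_measurable borel"
  unfolding gauss_density_def[abs_def] by measurable

lemma prob_space_gauss_density:
  assumes s: "0 < s"
  shows "prob_space (density lborel (gauss_density s))"
proof
  have "emeasure (density lborel (gauss_density s)) (space (density lborel (gauss_density s)))
      = (\<integral>\<^sup>+z. gauss_density s z \<partial>lborel)"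
    by (simp add: emeasure_density)
  also have "\<dots> = (\<integral>\<^sup>+z. ennreal (1 / (pi * s)) * ennreal (exp (- (1 / s * (cmod z)\<^sup>2))) \<partial>lborel)"
    using s by (intro nn_integral_cong) (simp add: gauss_density_def ennreal_mult'[symmetric])
  also have "\<dots> = ennreal (1 / (pi * s)) * ennreal (pi / (1 / s))"
    using s nn_integral_complex_gauss[of "1 / s"] by (subst nn_integral_cmult) auto
  also have "\<dots> = 1"
    using s by (simp add: ennreal_mult'[symmetric])
  finally show "emeasure (density lborel (gauss_density s)) (space (density lborel (gauss_density s))) = 1" .
qed

lemma prod_gauss_density:
  assumes s: "0 < s" and I: "finite I"
  shows "(\<Prod>i\<in>I. gauss_density s (z i)) = ennreal (exp (- (sq_norm I z / s)) / (pi * s) ^ card I)"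
  using s I by (simp add: gauss_density_def prod_ennreal prod_dividef exp_sum sum_divide_distrib sum_negf[symmetric])

text \<open>
  For a scalar covariance matrix the quadratic form in the density is \<open>|z|^2 / s\<close>, so the density factors
  over the coordinates.
\<close>
lemma circ_complex_gaussian_scalar_distr:
  assumes s: "0 < s" and Z: "circ_complex_gaussian M n (complex_of_real s \<cdot>\<^sub>m 1\<^sub>m n) Z"
  shows "distr M (cleb {..<n}) (\<lambda>\<omega>. coords n (Z \<omega>)) = (\<Pi>\<^sub>M i\<in>{..<n}. density lborel (gauss_density s))"
    and "(\<lambda>\<omega>. coords n (Z \<omega>)) \<in> measurable M (cleb {..<n})"
proof -
  from Z obtain R where R: "R \<in> carrier_mat n n" "inverts_mat (complex_of_real s \<cdot>\<^sub>m 1\<^sub>m n) R"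
    and D: "distributed M (cleb {..<n}) (\<lambda>\<omega>. coords n (Z \<omega>))
          (\<lambda>z. ennreal (exp (- Re ((R *\<^sub>v Matrix.vec n z) \<bullet>c Matrix.vec n z))
                         / (pi ^ n * Re (Determinant.det (complex_of_real s \<cdot>\<^sub>m 1\<^sub>m n)))))"
    unfolding circ_complex_gaussian_def by auto
  have Rij: "complex_of_real s * R $$ (i, j) = (if i = j then 1 else 0)" if "i < n" "j < n" for i j
  proof -
    have "(complex_of_real s \<cdot>\<^sub>m 1\<^sub>m n) * R = complex_of_real s \<cdot>\<^sub>m R"
      using R(1) by (simp add: mult_smult_assoc_mat[of _ n n])
    then have "complex_of_real s \<cdot>\<^sub>m R = 1\<^sub>m n"
      using R(2) by (simp add: inverts_mat_def)
    then have "(complex_of_real s \<cdot>\<^sub>m R) $$ (i, j) = 1\<^sub>m n $$ (i, j)" by simp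
    then show ?thesis using that R(1) by auto
  qed
  have Rij': "R $$ (i, j) = (if i = j then 1 / complex_of_real s else 0)" if "i < n" "j < n" for i j
    using Rij[OF that] s by (auto simp: field_simps split: if_splits)
  have Rv: "Re ((R *\<^sub>v Matrix.vec n z) \<bullet>c Matrix.vec n z) = sq_norm {..<n} z / s" for z
  proof -
    have "vec_index (R *\<^sub>v Matrix.vec n z) i = z i / complex_of_real s" if i: "i < n" for i
    proof -
      have "vec_index (R *\<^sub>v Matrix.vec n z) i = (\<Sum>j<n. R $$ (i, j) * z j)"
        using i R(1) by (simp add: scalar_prod_def atLeast0LessThan)
      also have "\<dots> = (\<Sum>j<n. if j = i then z i / complex_of_real s else 0)"
        using i by (intro sum.cong) (auto simp: Rij')
      finally show ?thesis using i by simp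
    qed
    then have "(R *\<^sub>v Matrix.vec n z) \<bullet>c Matrix.vec n z = (\<Sum>i<n. z i / complex_of_real s * cnj (z i))"
      by (simp add: scalar_prod_def atLeast0LessThan)
    also have "\<dots> = complex_of_real (sq_norm {..<n} z / s)"
      by (simp add: sum_divide_distrib complex_norm_square del: of_real_power)
    finally show ?thesis by simp
  qed
  have det: "Determinant.det (complex_of_real s \<cdot>\<^sub>m 1\<^sub>m n) = complex_of_real (s ^ n)"
    by simp
  have dens: "(\<lambda>z. ennreal (exp (- Re ((R *\<^sub>v Matrix.vec n z) \<bullet>c Matrix.vec n z))
                         / (pi ^ n * Re (Determinant.det (complex_of_real s \<cdot>\<^sub>m 1\<^sub>m n)))))
     = (\<lambda>z. \<Prod>i\<in>{..<n}. gauss_density s (z i))"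
    unfolding Rv det using s by (simp add: prod_gauss_density power_mult_distrib)
  show "(\<lambda>\<omega>. coords n (Z \<omega>)) \<in> measurable M (cleb {..<n})"
    using distributed_measurable[OF D] .
  show "distr M (cleb {..<n}) (\<lambda>\<omega>. coords n (Z \<omega>)) = (\<Pi>\<^sub>M i\<in>{..<n}. density lborel (gauss_density s))"
    unfolding distributed_distr_eq_density[OF D] dens
    by (rule density_cleb_prod) (auto intro: prob_space_gauss_density s)
qed

definition entries :: "nat \<Rightarrow> nat \<Rightarrow> complex mat \<Rightarrow> nat \<times> nat \<Rightarrow> complex" where
  "entries n m A = (\<lambda>p\<in>grid n m. A $$ p)"

text \<open>
  The columns are independent and each of them has independent entries, so the probability of a box
  factors over all entries, and boxes determine the law.
\<close>
lemma gaussian_matrix_entries: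
  assumes s: "0 < s" and X: "gaussian_matrix M n m s X"
  defines "I \<equiv> grid n m"
  shows "(\<lambda>\<omega>. entries n m (X \<omega>)) \<in> measurable M (cleb I)"
    and "distr M (cleb I) (\<lambda>\<omega>. entries n m (X \<omega>)) = density (cleb I)
      (\<lambda>x. ennreal (exp (- (sq_norm I x / s)) / (pi * s) ^ (n * m)))"
proof -
  let ?\<gamma> = "density lborel (gauss_density s)"
  interpret M: prob_space M using X by (simp add: gaussian_matrix_def)
  interpret \<gamma>: prob_space ?\<gamma> by (rule prob_space_gauss_density[OF s])
  interpret \<gamma>p: product_sigma_finite "\<lambda>_. ?\<gamma>" ..
  have X_carrier: "X \<omega> \<in> carrier_mat n m" if "\<omega> \<in> space M" for \<omega>
    using X that by (simp add: gaussian_matrix_def)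
  have I: "finite I" by (simp add: I_def)
  define c where "c k \<omega> = coords n (col (X \<omega>) k)" for k \<omega>
  have indep: "M.indep_vars (\<lambda>_. \<Pi>\<^sub>M i\<in>{..<n}. borel) c {..<m}"
    using X unfolding gaussian_matrix_def c_def[abs_def] by simp
  have G: "circ_complex_gaussian M n (complex_of_real s \<cdot>\<^sub>m 1\<^sub>m n) (\<lambda>\<omega>. col (X \<omega>) k)" if "k < m" for k
    using X that by (simp add: gaussian_matrix_def)
  have sets_eq: "sets (\<Pi>\<^sub>M i\<in>{..<n}. borel) = sets (cleb {..<n})"
    by (rule sets_PiM_cong) auto
  have sets_eq': "sets (\<Pi>\<^sub>M i\<in>{..<n}. borel) = sets (\<Pi>\<^sub>M i\<in>{..<n}. ?\<gamma>)"
    by (rule sets_PiM_cong) auto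
  have c_meas: "c k \<in> measurable M (cleb {..<n})" if "k < m" for k
    using circ_complex_gaussian_scalar_distr(2)[OF s G[OF that]] by (simp add: c_def[abs_def])
  have c_distr: "distr M (\<Pi>\<^sub>M i\<in>{..<n}. borel) (c k) = (\<Pi>\<^sub>M i\<in>{..<n}. ?\<gamma>)" if "k < m" for k
    using circ_complex_gaussian_scalar_distr(1)[OF s G[OF that]]
    by (simp add: c_def[abs_def] sets_eq cong: distr_cong)
  have entry: "entries n m (X \<omega>) (i, k) = c k \<omega> i" if "\<omega> \<in> space M" "i < n" "k < m" for \<omega> i k
    using X_carrier[OF that(1)] that by (simp add: entries_def c_def coords_def)
  show meas: "(\<lambda>\<omega>. entries n m (X \<omega>)) \<in> measurable M (cleb I)"
  proof (rule measurable_PiM_single')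
    fix p assume "p \<in> I"
    then obtain i k where p: "p = (i, k)" "i < n" "k < m" by (auto simp: I_def)
    have "(\<lambda>\<omega>. c k \<omega> i) \<in> measurable M lborel"
      using p by (intro measurable_compose[OF c_meas[OF p(3)] measurable_component_singleton]) auto
    moreover have "(\<lambda>\<omega>. entries n m (X \<omega>) p) \<in> measurable M lborel \<longleftrightarrow> (\<lambda>\<omega>. c k \<omega> i) \<in> measurable M lborel"
      using entry p by (intro measurable_cong) auto
    ultimately show "(\<lambda>\<omega>. entries n m (X \<omega>) p) \<in> measurable M lborel" by simp
  next
    show "(\<lambda>\<omega> p. entries n m (X \<omega>) p) \<in> space M \<rightarrow> (\<Pi>\<^sub>E p\<in>I. space lborel)"
      unfolding entries_def I_def by (simp add: PiE_iff extensional_def Pi_iff)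
  qed
  have "distr M (cleb I) (\<lambda>\<omega>. entries n m (X \<omega>)) = (\<Pi>\<^sub>M p\<in>I. ?\<gamma>)"
  proof (rule \<gamma>p.PiM_eqI[OF I])
    show "sets (distr M (cleb I) (\<lambda>\<omega>. entries n m (X \<omega>))) = sets (\<Pi>\<^sub>M p\<in>I. ?\<gamma>)"
      unfolding sets_distr by (intro sets_PiM_cong) auto
    fix A assume A: "\<And>p. p \<in> I \<Longrightarrow> A p \<in> sets ?\<gamma>"
    have PA: "Pi\<^sub>E I A \<in> sets (cleb I)"
      using A I by (intro sets_PiM_I_finite) auto
    define B where "B k = Pi\<^sub>E {..<n} (\<lambda>i. A (i, k))" for k
    have B: "B k \<in> sets (\<Pi>\<^sub>M i\<in>{..<n}. borel)" if "k < m" for k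
      using A that unfolding B_def by (intro sets_PiM_I_finite) (auto simp: I_def)
    have Bmeas: "M.prob (c k -` B k \<inter> space M) = measure (\<Pi>\<^sub>M i\<in>{..<n}. ?\<gamma>) (B k)" if k: "k < m" for k
    proof -
      have "c k \<in> measurable M (\<Pi>\<^sub>M i\<in>{..<n}. borel)"
        using c_meas[OF k] by (simp add: measurable_cong_sets[OF refl sets_eq])
      then show ?thesis
        unfolding c_distr[OF k, symmetric] using B[OF k] by (simp add: measure_distr)
    qed
    have in_PA: "entries n m (X \<omega>) \<in> Pi\<^sub>E I A \<longleftrightarrow> (\<forall>i<n. \<forall>k<m. c k \<omega> i \<in> A (i, k))"
      if "\<omega> \<in> space M" for \<omega>
    proof -
      have "entries n m (X \<omega>) \<in> Pi\<^sub>E I A \<longleftrightarrow> (\<forall>p\<in>I. entries n m (X \<omega>) p \<in> A p)"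
        by (simp add: PiE_iff entries_def I_def)
      also have "\<dots> \<longleftrightarrow> (\<forall>i<n. \<forall>k<m. c k \<omega> i \<in> A (i, k))"
        by (auto simp: I_def entry[OF that])
      finally show ?thesis .
    qed
    have in_B: "c k \<omega> \<in> B k \<longleftrightarrow> (\<forall>i<n. c k \<omega> i \<in> A (i, k))" for k \<omega>
      by (auto simp: B_def PiE_iff c_def coords_def)
    have eq: "(\<lambda>\<omega>. entries n m (X \<omega>)) -` Pi\<^sub>E I A \<inter> space M = {\<omega> \<in> space M. \<forall>k\<in>{..<m}. c k \<omega> \<in> B k}"
      by (auto simp: in_PA in_B)
    have "M.prob {\<omega> \<in> space M. \<forall>k\<in>{..<m}. c k \<omega> \<in> B k} = (\<Prod>k<m. M.prob (c k -` B k \<inter> space M))"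
    proof (cases "m = 0")
      case True
      then show ?thesis by (simp add: M.prob_space)
    next
      case False
      have "{\<omega> \<in> space M. \<forall>k\<in>{..<m}. c k \<omega> \<in> B k} = (\<Inter>k\<in>{..<m}. c k -` B k \<inter> space M)"
        using False by auto
      then show ?thesis
        by (simp only:) (rule M.indep_varsD[OF indep], use False B in auto)
    qed
    also have "\<dots> = (\<Prod>k<m. \<Prod>i<n. measure ?\<gamma> (A (i, k)))"
    proof (intro prod.cong refl)
      fix k assume "k \<in> {..<m}"
      then have k: "k < m" by simp
      have "measure (\<Pi>\<^sub>M i\<in>{..<n}. ?\<gamma>) (B k) = (\<Prod>i<n. measure ?\<gamma> (A (i, k)))"
        unfolding B_def measure_def using A k
        by (subst \<gamma>p.emeasure_PiM) (auto simp: I_def \<gamma>.emeasure_eq_measure prod_ennreal prod_nonneg)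
      then show "M.prob (c k -` B k \<inter> space M) = (\<Prod>i<n. measure ?\<gamma> (A (i, k)))"
        using Bmeas[OF k] by simp
    qed
    also have "\<dots> = (\<Prod>i<n. \<Prod>k<m. measure ?\<gamma> (A (i, k)))"
      by (rule prod.swap)
    also have "\<dots> = (\<Prod>p\<in>I. measure ?\<gamma> (A p))"
      unfolding I_def by (simp add: prod.cartesian_product)
    finally show "emeasure (distr M (cleb I) (\<lambda>\<omega>. entries n m (X \<omega>))) (Pi\<^sub>E I A) = (\<Prod>p\<in>I. emeasure ?\<gamma> (A p))"
      using PA meas by (simp add: emeasure_distr eq M.emeasure_eq_measure \<gamma>.emeasure_eq_measure prod_ennreal)
  qed
  also have "\<dots> = density (cleb I) (\<lambda>x. \<Prod>p\<in>I. gauss_density s (x p))"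
    by (rule density_cleb_prod[symmetric]) (use I in \<open>auto intro: prob_space_gauss_density s\<close>)
  also have "\<dots> = density (cleb I)
      (\<lambda>x. ennreal (exp (- (sq_norm I x / s)) / (pi * s) ^ (n * m)))"
    by (simp add: prod_gauss_density[OF s I]) (simp add: I_def)
  finally show "distr M (cleb I) (\<lambda>\<omega>. entries n m (X \<omega>)) = density (cleb I)
      (\<lambda>x. ennreal (exp (- (sq_norm I x / s)) / (pi * s) ^ (n * m)))" .
qed

section \<open>The exact moment\<close>

lemma gram_det_scale: "gram_det n m (\<lambda>p. complex_of_real c * x p) = (c ^ 2) ^ n * gram_det n m x"
proof -
  have "gram_mat n m (\<lambda>p. complex_of_real c * x p) = complex_of_real (c ^ 2) \<cdot>\<^sub>m gram_mat n m x"
    by (rule eq_matI) (auto simp: gram_mat_def sum_distrib_left power2_eq_square mult_ac intro!: sum.cong)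
  then have "Determinant.det (gram_mat n m (\<lambda>p. complex_of_real c * x p))
      = complex_of_real ((c ^ 2) ^ n) * Determinant.det (gram_mat n m x)"
    by (simp add: gram_mat_def)
  then show ?thesis
    unfolding gram_det_def by (simp del: of_real_power)
qed

lemma gram_det_zero_entries:
  assumes "0 < n" "\<And>i j. i < n \<Longrightarrow> j < m \<Longrightarrow> x (i, j) = 0"
  shows "gram_det n m x = 0"
proof -
  have "gram_det n m x = gram_det n m (\<lambda>p. complex_of_real 0 * x p)"
    by (rule gram_det_cong) (simp add: assms(2))
  also have "\<dots> = 0"
    using assms(1) by (simp only: gram_det_scale) simp
  finally show ?thesis .
qed

text \<open>
  Up to the constant \<open>n ^ p\<close> this is \<open>W0 ^ p\<close> wherever the Gram determinant is positive. The value
  \<open>\<infinity>\<close> of \<open>neg_power\<close> elsewhere keeps the invariance under dilations at every point.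
\<close>
definition ratio_power :: "nat \<Rightarrow> nat \<Rightarrow> nat \<Rightarrow> (nat \<times> nat \<Rightarrow> complex) \<Rightarrow> ennreal" where
  "ratio_power n m p x = ennreal (sq_norm (grid n m) x ^ p) * neg_power (real p / real n) (gram_det n m x)"

lemma measurable_ratio_power [measurable]:
  "ratio_power n m p \<in> borel_measurable (cleb (grid n m))"
  using measurable_gram_det[of n m "grid n m"]
  unfolding ratio_power_def[abs_def] by measurable

lemma ratio_power_scale:
  assumes n: "0 < n" and c: "0 < c"
  shows "ratio_power n m p (\<lambda>q\<in>grid n m. 0 + c *\<^sub>R x q) = ratio_power n m p x"
proof -
  let ?I = "grid n m"
  have "gram_det n m (\<lambda>q\<in>?I. 0 + c *\<^sub>R x q) = gram_det n m (\<lambda>q. complex_of_real c * x q)"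
    by (rule gram_det_cong) (simp add: scaleR_conv_of_real)
  then have g: "gram_det n m (\<lambda>q\<in>?I. 0 + c *\<^sub>R x q) = (c ^ 2) ^ n * gram_det n m x"
    by (simp only: gram_det_scale)
  have T: "(\<Sum>q\<in>?I. (cmod ((\<lambda>q\<in>?I. 0 + c *\<^sub>R x q) q))\<^sup>2) = c ^ 2 * sq_norm ?I x"
    using c by (simp add: power_mult_distrib sum_distrib_left)
  have np: "neg_power (real p / real n) ((c ^ 2) ^ n * y) = ennreal (1 / (c ^ 2) ^ p) * neg_power (real p / real n) y" for y
  proof (cases "0 < y")
    case True
    have "((c ^ 2) ^ n) powr - (real p / real n) = ((c ^ 2) powr real n) powr - (real p / real n)"
      using c by (simp only: powr_realpow zero_less_power)
    also have "\<dots> = (c ^ 2) powr - real p"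
      unfolding powr_powr using n by simp
    also have "\<dots> = 1 / (c ^ 2) ^ p"
      using c by (simp only: powr_minus_divide powr_realpow zero_less_power)
    finally have "((c ^ 2) ^ n) powr - (real p / real n) = 1 / (c ^ 2) ^ p" .
    with True c show ?thesis
      by (simp add: neg_power_def powr_mult ennreal_mult'[symmetric] mult_le_0_iff not_le)
  next
    case False
    with c show ?thesis
      by (simp add: neg_power_def mult_le_0_iff ennreal_mult_top)
  qed
  have "ennreal ((c ^ 2 * y) ^ p) * ennreal (1 / (c ^ 2) ^ p) = ennreal (y ^ p)" if "0 \<le> y" for y
    using c that by (simp add: ennreal_mult[symmetric] power_mult_distrib)
  then show ?thesis
    unfolding ratio_power_def g T np
    by (simp add: mult.assoc[symmetric] sum_nonneg)
qed

lemma nn_integral_ratio_power_scale: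
  assumes n: "0 < n" and a: "0 < a"
  shows "(\<integral>\<^sup>+x. ratio_power n m p x * ennreal (exp (- (a * sq_norm (grid n m) x))) \<partial>cleb (grid n m))
    = ennreal (1 / a ^ (n * m)) *
      (\<integral>\<^sup>+x. ratio_power n m p x * gauss_weight (grid n m) x \<partial>cleb (grid n m))"
proof -
  let ?I = "grid n m"
  \<comment> \<open>this dilation turns \<open>a * |x|^2\<close> into \<open>|x|^2\<close>\<close>
  let ?c = "1 / sqrt a"
  have c: "0 < ?c" using a by simp
  have T: "a * (\<Sum>q\<in>?I. (cmod ((\<lambda>q\<in>?I. 0 + ?c *\<^sub>R x q) q))\<^sup>2) = sq_norm ?I x" for x
    using a by (simp add: power_mult_distrib power_divide sum_divide_distrib[symmetric])
  have "(\<integral>\<^sup>+x. ratio_power n m p x * ennreal (exp (- (a * sq_norm ?I x))) \<partial>cleb ?I)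
     = ennreal (?c ^ (2 * card ?I)) * (\<integral>\<^sup>+x. ratio_power n m p (\<lambda>q\<in>?I. 0 + ?c *\<^sub>R x q) *
         ennreal (exp (- (a * (\<Sum>q\<in>?I. (cmod ((\<lambda>q\<in>?I. 0 + ?c *\<^sub>R x q) q))\<^sup>2)))) \<partial>cleb ?I)"
    by (rule nn_integral_cleb_affine) (use c in auto)
  also have "\<dots> = ennreal (?c ^ (2 * card ?I)) * (\<integral>\<^sup>+x. ratio_power n m p x * gauss_weight ?I x \<partial>cleb ?I)"
    by (simp only: T ratio_power_scale[OF n c])
  also have "?c ^ (2 * card ?I) = 1 / a ^ (n * m)"
    using a by (simp add: power_mult power_divide)
  finally show ?thesis .
qed

lemma AE_gram_det_pos:
  assumes "n \<le> m"
  shows "AE x in cleb (grid n m). 0 < gram_det n m x"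
proof -
  let ?I = "grid n m"
  have [measurable]: "gram_det n m \<in> borel_measurable (cleb ?I)"
    by (rule measurable_gram_det) simp
  \<comment> \<open>an exponent below 1 makes the integral finite for all \<open>n \<le> m\<close>\<close>
  have "AE x in cleb ?I. gauss_weight ?I x * neg_power (1/2) (gram_det n m x) \<noteq> \<infinity>"
    using assms by (intro nn_integral_noteq_infinite) (auto simp: nn_integral_gram_det_power)
  then show ?thesis
    by eventually_elim (auto simp: neg_power_def ennreal_mult_top split: if_splits)
qed

lemma admissible_imp_le:
  fixes p n m :: nat
  assumes adm: "real p < real n * (real m - real n + 1)"
  shows "n \<le> m"
proof (rule ccontr)
  assume "\<not> n \<le> m"
  then have "real m - real n + 1 \<le> 0" by simp
  then have "real n * (real m - real n + 1) \<le> 0" by (simp add: mult_nonneg_nonpos)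
  with adm show False by simp
qed

text \<open>
  Multiplying \<open>ratio_power\<close> by \<open>T powr - p\<close>, where \<open>T\<close> is the squared norm, leaves the negative power of
  the Gram determinant, whose integral is known. By dilation invariance the Laplace transform of \<open>T\<close>
  with weight \<open>ratio_power\<close> is a power of \<open>1 + t\<close>, so the same integral is also the wanted one times a
  gamma quotient.
\<close>
lemma nn_integral_ratio_power:
  assumes p: "0 < p" and n: "0 < n" and adm: "real p < real n * (real m - real n + 1)"
  shows "(\<integral>\<^sup>+x. ratio_power n m p x * gauss_weight (grid n m) x \<partial>cleb (grid n m))
    = ennreal (pi ^ (n * m) * gamma_quotients n m (real p / real n)
        * (Gamma (real (n * m)) / Gamma (real (n * m) - real p)))"
proof -
  let ?I = "grid n m"
  define T where "T x = sq_norm ?I x" for x :: "nat \<times> nat \<Rightarrow> complex"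
  define C where "C = (\<integral>\<^sup>+x. ratio_power n m p x * ennreal (exp (- T x)) \<partial>cleb ?I)"
  define D where "D = pi ^ (n * m) * gamma_quotients n m (real p / real n)"
  have mn: "n \<le> m" by (rule admissible_imp_le[OF adm])
  have pn: "real p / real n < real m - real n + 1"
    using adm n by (simp add: field_simps)
  have pnm: "real p < real (n * m)"
  proof -
    have "real n * (real m - real n + 1) \<le> real n * real m"
      using n by (intro mult_left_mono) auto
    with adm show ?thesis by simp
  qed
  have T0: "0 \<le> T x" for x unfolding T_def by (intro sum_nonneg) auto
  have [measurable]: "T \<in> borel_measurable (cleb ?I)" unfolding T_def by measurable
  have [measurable]: "gram_det n m \<in> borel_measurable (cleb ?I)"
    by (rule measurable_gram_det) simp
  have laplace: "(\<integral>\<^sup>+x. (ratio_power n m p x * ennreal (exp (- T x))) * neg_power (real p) (T x) \<partial>cleb ?I)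
      = C * ennreal (Gamma (real (n * m) - real p) / Gamma (real (n * m)))"
  proof (rule nn_integral_neg_power_of_laplace)
    fix t :: real assume t: "0 < t"
    have "(\<integral>\<^sup>+x. ratio_power n m p x * ennreal (exp (- T x)) * ennreal (exp (- (t * T x))) \<partial>cleb ?I)
       = (\<integral>\<^sup>+x. ratio_power n m p x * ennreal (exp (- ((1 + t) * T x))) \<partial>cleb ?I)"
      by (simp add: mult.assoc ennreal_mult[symmetric] exp_add[symmetric] distrib_right)
    also have "\<dots> = ennreal (1 / (1 + t) ^ (n * m)) * C"
      unfolding T_def C_def using t n by (intro nn_integral_ratio_power_scale) auto
    finally show "(\<integral>\<^sup>+x. ratio_power n m p x * ennreal (exp (- T x)) * ennreal (exp (- (t * T x))) \<partial>cleb ?I)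
        = C * ennreal ((1 + t) powr - real (n * m))"
      using t by (simp add: powr_minus_divide powr_realpow mult.commute del: of_nat_mult)
  qed (use p pnm T0 in \<open>auto intro!: sigma_finite_cleb\<close>)
  have "(\<integral>\<^sup>+x. (ratio_power n m p x * ennreal (exp (- T x))) * neg_power (real p) (T x) \<partial>cleb ?I)
      = (\<integral>\<^sup>+x. ennreal (exp (- T x)) * neg_power (real p / real n) (gram_det n m x) \<partial>cleb ?I)"
  proof (rule nn_integral_cong_AE)
    show "AE x in cleb ?I. (ratio_power n m p x * ennreal (exp (- T x))) * neg_power (real p) (T x)
        = ennreal (exp (- T x)) * neg_power (real p / real n) (gram_det n m x)"
      using AE_gram_det_pos[OF mn]
    proof eventually_elim
      case (elim x)
      have "T x \<noteq> 0"
      proof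
        assume "T x = 0"
        then have "\<forall>q\<in>?I. (cmod (x q))\<^sup>2 = 0"
          unfolding T_def by (subst (asm) sum_nonneg_eq_0_iff) auto
        then have "gram_det n m x = 0"
          by (intro gram_det_zero_entries n) auto
        with elim show False by simp
      qed
      with T0[of x] have T: "0 < T x" by simp
      then have "ennreal (T x ^ p) * neg_power (real p) (T x) = 1"
        by (simp add: neg_power_def powr_minus_divide powr_realpow ennreal_mult[symmetric])
      then have "ratio_power n m p x * neg_power (real p) (T x) = neg_power (real p / real n) (gram_det n m x)"
        unfolding ratio_power_def T_def[symmetric] by (metis (no_types) mult.commute mult.left_commute mult_1)
      then show ?case by (metis (no_types) mult.commute mult.assoc)
    qed
  qed
  also have "\<dots> = ennreal D"
    unfolding T_def D_def using mn pn p n by (intro nn_integral_gram_det_power) auto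
  finally have D: "ennreal D = C * ennreal (Gamma (real (n * m) - real p) / Gamma (real (n * m)))"
    using laplace by simp
  have G: "0 < Gamma (real (n * m) - real p)" "0 < Gamma (real (n * m))"
    using p pnm by (auto intro!: Gamma_real_pos)
  have "C = C * ennreal (Gamma (real (n * m) - real p) / Gamma (real (n * m))) *
      ennreal (Gamma (real (n * m)) / Gamma (real (n * m) - real p))"
    using G by (simp add: mult.assoc ennreal_mult'[symmetric])
  also have "\<dots> = ennreal (D * (Gamma (real (n * m)) / Gamma (real (n * m) - real p)))"
    unfolding D[symmetric] by (intro ennreal_mult''[symmetric] divide_nonneg_nonneg less_imp_le G)
  finally show ?thesis by (simp add: C_def D_def T_def)
qed

text \<open>
  The variance \<open>s\<close> enters through a dilation, under which the integrand \<open>ratio_power\<close> is invariant, and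
  therefore cancels.
\<close>
theorem moment_W0_eq:
  assumes X: "gaussian_matrix M n m s X" and s: "0 < s"
    and p: "0 < p" and n: "0 < n" and adm: "real p < real n * (real m - real n + 1)"
  shows "moment_W0 M X p = Gamma (real (n * m)) / Gamma (real (n * m) - real p) / real n ^ p
    * gamma_quotients n m (real p / real n)"
proof -
  let ?I = "grid n m"
  interpret M: prob_space M using X by (simp add: gaussian_matrix_def)
  have X_carrier: "X \<omega> \<in> carrier_mat n m" if "\<omega> \<in> space M" for \<omega>
    using X that by (simp add: gaussian_matrix_def)
  have mn: "n \<le> m" by (rule admissible_imp_le[OF adm])
  define T where "T x = sq_norm ?I x" for x :: "nat \<times> nat \<Rightarrow> complex"
  define w where "w x = (1 / real n * T x) / gram_det n m x powr (1 / real n)" for x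
  have T0: "0 \<le> T x" for x unfolding T_def by (intro sum_nonneg) auto
  have [measurable]: "T \<in> borel_measurable (cleb ?I)" unfolding T_def by measurable
  have [measurable]: "gram_det n m \<in> borel_measurable (cleb ?I)"
    by (rule measurable_gram_det) simp
  have [measurable]: "w \<in> borel_measurable (cleb ?I)" unfolding w_def by measurable
  have [measurable]: "(\<lambda>\<omega>. entries n m (X \<omega>)) \<in> measurable M (cleb ?I)"
    by (rule gaussian_matrix_entries[OF s X])
  have W: "W0 (X \<omega>) = w (entries n m (X \<omega>))" if \<omega>: "\<omega> \<in> space M" for \<omega>
  proof -
    let ?A = "X \<omega>"
    have A: "?A \<in> carrier_mat n m" using X_carrier[OF \<omega>] .
    have g: "?A * mat_adjoint ?A = gram_mat n m (entries n m ?A)"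
      by (rule mult_mat_adjoint_eq_gram_mat[OF A]) (simp add: entries_def)
    have "Re (mat_trace (gram_mat n m x)) = (\<Sum>i<n. \<Sum>j<m. (cmod (x (i, j)))\<^sup>2)" for x
      by (simp add: mat_trace_def gram_mat_def complex_norm_square[symmetric] del: of_real_power)
    then have "Re (mat_trace (gram_mat n m x)) = T x" for x
      by (simp add: T_def sum.cartesian_product)
    then show ?thesis
      using A by (simp add: W0_def Let_def g w_def gram_det_def)
  qed
  have w0: "0 \<le> w x" for x
    using T0 by (simp add: w_def)
  have "(\<integral>\<^sup>+\<omega>. ennreal (W0 (X \<omega>) ^ p) \<partial>M) = (\<integral>\<^sup>+\<omega>. ennreal (w (entries n m (X \<omega>)) ^ p) \<partial>M)"
    by (intro nn_integral_cong) (simp add: W)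
  also have "\<dots> = (\<integral>\<^sup>+x. ennreal (w x ^ p) \<partial>distr M (cleb ?I) (\<lambda>\<omega>. entries n m (X \<omega>)))"
    by (subst nn_integral_distr) auto
  also have "\<dots> = (\<integral>\<^sup>+x. ennreal (exp (- (T x / s)) / (pi * s) ^ (n * m)) * ennreal (w x ^ p) \<partial>cleb ?I)"
    unfolding gaussian_matrix_entries(2)[OF s X] T_def[symmetric]
    by (rule nn_integral_density) measurable
  also have "\<dots> = (\<integral>\<^sup>+x. ennreal (1 / ((pi * s) ^ (n * m) * real n ^ p)) * (ratio_power n m p x * ennreal (exp (- (1 / s * T x)))) \<partial>cleb ?I)"
  proof (rule nn_integral_cong_AE)
    show "AE x in cleb ?I. ennreal (exp (- (T x / s)) / (pi * s) ^ (n * m)) * ennreal (w x ^ p)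
      = ennreal (1 / ((pi * s) ^ (n * m) * real n ^ p)) * (ratio_power n m p x * ennreal (exp (- (1 / s * T x))))"
      using AE_gram_det_pos[OF mn]
    proof eventually_elim
      case (elim x)
      have "(gram_det n m x powr (1 / real n)) ^ p = gram_det n m x powr (real p / real n)"
        using elim by (simp add: powr_realpow[symmetric] powr_powr)
      then have "w x ^ p = 1 / real n ^ p * (T x ^ p * gram_det n m x powr - (real p / real n))"
        by (simp add: w_def power_mult_distrib power_divide powr_minus_divide)
      moreover have "ratio_power n m p x = ennreal (T x ^ p * gram_det n m x powr - (real p / real n))"
        using elim T0[of x] by (simp add: ratio_power_def T_def neg_power_def ennreal_mult sum_nonneg)
      ultimately show ?case
        using s T0[of x] by (simp add: ennreal_mult'[symmetric] mult_ac)
    qed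
  qed
  also have "\<dots> = ennreal (1 / ((pi * s) ^ (n * m) * real n ^ p)) *
      (\<integral>\<^sup>+x. ratio_power n m p x * ennreal (exp (- (1 / s * T x))) \<partial>cleb ?I)"
    by (rule nn_integral_cmult) measurable
  also have "\<dots> = ennreal (1 / ((pi * s) ^ (n * m) * real n ^ p)) * (ennreal (1 / (1 / s) ^ (n * m)) *
      ennreal (pi ^ (n * m) * gamma_quotients n m (real p / real n)
        * (Gamma (real (n * m)) / Gamma (real (n * m) - real p))))"
    unfolding T_def using s n by (subst nn_integral_ratio_power_scale) (auto simp: nn_integral_ratio_power[OF p n adm])
  also have "\<dots> = ennreal (1 / ((pi * s) ^ (n * m) * real n ^ p) * (1 / (1 / s) ^ (n * m) *
      (pi ^ (n * m) * gamma_quotients n m (real p / real n)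
        * (Gamma (real (n * m)) / Gamma (real (n * m) - real p)))))"
    using s by (simp add: ennreal_mult'[symmetric] del: of_nat_mult times_divide_eq_left times_divide_eq_right)
  also have "1 / ((pi * s) ^ (n * m) * real n ^ p) * (1 / (1 / s) ^ (n * m) *
      (pi ^ (n * m) * gamma_quotients n m (real p / real n)
        * (Gamma (real (n * m)) / Gamma (real (n * m) - real p))))
     = Gamma (real (n * m)) / Gamma (real (n * m) - real p) / real n ^ p
    * gamma_quotients n m (real p / real n)" (is "_ = ?R")
    using s by (simp add: power_mult_distrib power_divide mult_ac del: of_nat_mult)
  finally have eq: "(\<integral>\<^sup>+\<omega>. ennreal (W0 (X \<omega>) ^ p) \<partial>M) = ennreal ?R" .
  have "0 \<le> ?R"
  proof -
    have "0 < Gamma (real m - real k - real p / real n) / Gamma (real m - real k)" if "k < n" for k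
    proof -
      have "real p / real n < real m - real n + 1"
        using adm n by (simp add: field_simps)
      with that mn show ?thesis by (intro divide_pos_pos Gamma_real_pos) auto
    qed
    moreover have "real p < real (n * m)"
    proof -
      have "real n * (real m - real n + 1) \<le> real n * real m"
        using n by (intro mult_left_mono) auto
      with adm show ?thesis by simp
    qed
    then have "0 < Gamma (real (n * m)) / Gamma (real (n * m) - real p)"
      using p by (intro divide_pos_pos Gamma_real_pos) auto
    ultimately show ?thesis
      by (intro mult_nonneg_nonneg[OF divide_nonneg_nonneg[OF less_imp_le]] prod_nonneg)
         (simp_all add: less_imp_le del: of_nat_mult)
  qed
  moreover have "moment_W0 M X p = enn2real (\<integral>\<^sup>+\<omega>. ennreal (W0 (X \<omega>) ^ p) \<partial>M)"
    unfolding moment_W0_def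
  proof (rule integral_eq_nn_integral)
    show "(\<lambda>\<omega>. W0 (X \<omega>) ^ p) \<in> borel_measurable M"
      by (subst measurable_cong[where g="\<lambda>\<omega>. w (entries n m (X \<omega>)) ^ p"]) (auto simp: W)
    show "AE \<omega> in M. 0 \<le> W0 (X \<omega>) ^ p"
      using AE_space by eventually_elim (simp add: W w0)
  qed
  ultimately show ?thesis by (simp only: eq enn2real_ennreal)
qed

section \<open>Bernoulli numbers and the inverse of the second difference\<close>

definition bernoulli_fps :: "real fps" where
  "bernoulli_fps = Abs_fps (\<lambda>k. bernoulli k / fact k)"

lemma bernoulli_fps_exp: "bernoulli_fps * (fps_exp 1 - 1) = fps_X"
proof (rule fps_ext)
  fix N
  show "fps_nth (bernoulli_fps * (fps_exp 1 - 1)) N = fps_nth (fps_X :: real fps) N"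
  proof (cases N)
    case 0
    then show ?thesis by (simp add: fps_mult_nth)
  next
    case (Suc n)
    have "fps_nth (bernoulli_fps * (fps_exp 1 - 1)) N
        = (\<Sum>k\<le>Suc n. bernoulli k / fact k * (if k = Suc n then 0 else 1 / fact (Suc n - k)))"
      unfolding Suc fps_mult_nth bernoulli_fps_def by (intro sum.cong) (auto simp: atLeast0AtMost)
    also have "\<dots> = (\<Sum>k\<le>n. bernoulli k / fact k * (1 / fact (Suc n - k)))"
      by (simp add: mult.commute del: fact_Suc)
    also have "\<dots> = (\<Sum>k\<le>n. real (Suc n choose k) * bernoulli k / fact (Suc n))"
      by (intro sum.cong) (auto simp: binomial_fact simp del: fact_Suc)
    also have "\<dots> = (\<Sum>k\<le>n. real (Suc n choose k) * bernoulli k) / fact (Suc n)"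
      by (simp add: sum_divide_distrib)
    also have "\<dots> = (if n = 0 then 1 else 0)"
    proof (cases n)
      case (Suc l)
      have "(\<Sum>k\<le>n. real (Suc n choose k) * bernoulli k) 
         = (\<Sum>k\<le>l. real ((l + 2) choose k) * bernoulli k) + real (l + 2) * bernoulli (Suc l)"
        by (simp add: Suc del: bernoulli.simps binomial_Suc_Suc)
      also have "\<dots> = 0"
        by (simp add: field_simps)
      finally show ?thesis using Suc by simp
    qed simp
    finally show ?thesis by (simp add: Suc fps_X_def)
  qed
qed

text \<open>
  The coefficients of \<open>x^2 / (exp x + exp (- x) - 2)\<close> in powers of \<open>x^2\<close>.
\<close>
definition inv_diff2_coeff :: "nat \<Rightarrow> real" where
  "inv_diff2_coeff k = (1 - 2 * real k) * bernoulli (2 * k) / fact (2 * k)"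

text \<open>
  With \<open>B = x / (exp x - 1)\<close> the first factor \<open>B - x B'\<close> equals \<open>x^2 exp x / (exp x - 1)^2\<close>, and
  \<open>exp x + exp (- x) - 2 = exp (- x) (exp x - 1)^2\<close>.
\<close>
lemma inv_diff2_fps:
  "(bernoulli_fps - fps_X * fps_deriv bernoulli_fps) * (fps_exp 1 + fps_exp (-1) - 2) = fps_X ^ 2"
proof -
  let ?B = bernoulli_fps and ?E = "fps_exp 1 :: real fps" and ?F = "fps_exp (-1) :: real fps"
  have EF: "?E * ?F = 1"
    by (simp add: fps_exp_add_mult[symmetric])
  have B: "?B * (?E - 1) = fps_X" by (rule bernoulli_fps_exp)
  have "fps_deriv (?B * (?E - 1)) = 1" by (simp add: B)
  then have d: "fps_deriv ?B * (?E - 1) + ?B * ?E = 1"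
    by (simp add: fps_deriv_mult algebra_simps)
  have "(?B - fps_X * fps_deriv ?B) * (?E + ?F - 2) = (?B - fps_X * fps_deriv ?B) * (?E - 1) * (?E - 1) * ?F"
  proof -
    have "(?E - 1) * (?E - 1) * ?F = ?E + ?F - 2"
    proof -
      have "(?E - 1) * (?E - 1) * ?F = ?E * (?E * ?F) - ?E * ?F - ?E * ?F + ?F"
        by (simp add: algebra_simps)
      also have "\<dots> = ?E + ?F - 2"
        by (simp only: EF mult_1_right) simp
      finally show ?thesis .
    qed
    then show ?thesis by (simp add: mult.assoc)
  qed
  also have "(?B - fps_X * fps_deriv ?B) * (?E - 1) = fps_X * ?B * ?E"
  proof -
    have "fps_deriv ?B * (?E - 1) = 1 - ?B * ?E"
      using d by (simp add: eq_diff_eq)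
    note d' = this
    have "(?B - fps_X * fps_deriv ?B) * (?E - 1) = ?B * (?E - 1) - fps_X * (fps_deriv ?B * (?E - 1))"
      by (simp add: algebra_simps)
    also have "\<dots> = fps_X - fps_X * (1 - ?B * ?E)"
      by (simp only: B d')
    also have "\<dots> = fps_X * ?B * ?E"
      by (simp add: algebra_simps)
    finally show ?thesis .
  qed
  also have "fps_X * ?B * ?E * (?E - 1) * ?F = fps_X * fps_X"
  proof -
    have "fps_X * ?B * ?E * (?E - 1) * ?F = fps_X * (?B * (?E - 1)) * (?E * ?F)"
      by (simp only: mult_ac)
    then show ?thesis by (simp only: B EF mult_1_right)
  qed
  finally show ?thesis by (simp add: power2_eq_square)
qed

text \<open>
  Only even powers have to be compared. The odd Bernoulli numbers drop out since the other factor is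
  an even series.
\<close>
lemma inv_diff2_coeff_conv:
  "(\<Sum>k<s. inv_diff2_coeff k * (2 / fact (2 * (s - k)))) = (if s = 1 then 1 else 0)"
proof -
  let ?Q = "bernoulli_fps - fps_X * fps_deriv bernoulli_fps"
  let ?R = "fps_exp 1 + fps_exp (-1) - 2 :: real fps"
  have Q: "fps_nth ?Q i = (1 - real i) * bernoulli i / fact i" for i
    by (cases i) (auto simp: bernoulli_fps_def algebra_simps diff_divide_distrib add_divide_distrib simp del: bernoulli.simps fact_Suc)
  have R: "fps_nth ?R i = (if odd i \<or> i = 0 then 0 else 2 / fact i)" for i
    by (auto simp: fps_numeral_nth)
  have "(\<Sum>k<s. inv_diff2_coeff k * (2 / fact (2 * (s - k)))) = (\<Sum>k<s. fps_nth ?Q (2 * k) * fps_nth ?R (2 * s - 2 * k))"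
    unfolding Q R by (intro sum.cong) (auto simp: inv_diff2_coeff_def diff_mult_distrib2)
  also have "\<dots> = (\<Sum>i\<in>(\<lambda>k. 2 * k) ` {..<s}. fps_nth ?Q i * fps_nth ?R (2 * s - i))"
    by (subst sum.reindex) (auto simp: inj_on_def)
  also have "\<dots> = (\<Sum>i\<le>2 * s. fps_nth ?Q i * fps_nth ?R (2 * s - i))"
  proof (rule sum.mono_neutral_left)
    show "\<forall>i\<in>{..2 * s} - (\<lambda>k. 2 * k) ` {..<s}. fps_nth ?Q i * fps_nth ?R (2 * s - i) = 0"
    proof
      fix i assume i: "i \<in> {..2 * s} - (\<lambda>k. 2 * k) ` {..<s}"
      have "odd (2 * s - i) \<or> 2 * s - i = 0"
      proof (cases "even i")
        case True
        then obtain k where "i = 2 * k" by (elim evenE)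
        with i show ?thesis by auto
      qed (use i in auto)
      then show "fps_nth ?Q i * fps_nth ?R (2 * s - i) = 0" by (simp only: R if_True mult_zero_right)
    qed
  qed auto
  also have "\<dots> = fps_nth (?Q * ?R) (2 * s)"
    by (simp add: fps_mult_nth atLeast0AtMost)
  also have "\<dots> = (if s = 1 then 1 else 0)"
    unfolding inv_diff2_fps by (simp add: fps_X_power_iff)
  finally show ?thesis .
qed

section \<open>Truncated logarithm of the Barnes function\<close>

text \<open>
  Successive derivatives, shifted so that \<open>ln\<close> has index 2. The first two members are antiderivatives
  of \<open>ln\<close>.
\<close>
definition ln_tower :: "nat \<Rightarrow> real \<Rightarrow> real" where
  "ln_tower i z = (if i = 0 then z\<^sup>2 / 2 * ln z - 3 / 4 * z\<^sup>2
     else if i = 1 then z * ln z - z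
     else if i = 2 then ln z
     else (-1) ^ (i + 1) * fact (i - 3) / z ^ (i - 2))"

lemma ln_tower_deriv:
  assumes z: "0 < z"
  shows "(ln_tower i has_real_derivative ln_tower (Suc i) z) (at z)"
proof -
  consider "i = 0" | "i = 1" | "i = 2" | j where "i = j + 3"
    by (metis add.commute add_2_eq_Suc' add_Suc_right less_2_cases not_less_iff_gr_or_eq numeral_3_eq_3 One_nat_def Suc_1 le_Suc_ex not_less_eq_eq linorder_not_less)
  then show ?thesis
  proof cases
    case 1
    then show ?thesis
      using z unfolding ln_tower_def[abs_def]
      by (auto intro!: derivative_eq_intros simp: field_simps power2_eq_square)
  next
    case 2
    then show ?thesis
      using z unfolding ln_tower_def[abs_def]
      by (auto intro!: derivative_eq_intros simp: field_simps)
  next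
    case 3
    then show ?thesis
      using z unfolding ln_tower_def[abs_def]
      by (auto intro!: derivative_eq_intros simp: field_simps)
  next
    case 4
    have "((\<lambda>z. (-1) ^ (j + 4) * fact j / z ^ (j + 1)) has_real_derivative
        (-1) ^ (j + 5) * fact (j + 1) / z ^ (j + 2)) (at z)"
    proof (rule DERIV_cong)
      have p: "((\<lambda>z. z ^ (j + 1)) has_real_derivative real (j + 1) * z ^ j) (at z)"
        using DERIV_pow[of "j + 1" z] by simp
      show "((\<lambda>z. (-1) ^ (j + 4) * fact j / z ^ (j + 1)) has_real_derivative
         (0 * z ^ (j + 1) - ((-1) ^ (j + 4) * fact j) * (real (j + 1) * z ^ j)) / (z ^ (j + 1) * z ^ (j + 1))) (at z)"
        by (rule DERIV_divide[OF DERIV_const p]) (use z in simp)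
      have "z ^ (j + 1) * z ^ (j + 1) = z ^ (j + 2) * z ^ j"
        by (simp add: power_add[symmetric])
      moreover have "(-1) ^ (j + 5) * fact (j + 1) = - ((-1) ^ (j + 4) * fact j * real (j + 1))"
        by (simp add: power_add mult.commute)
      ultimately show "(0 * z ^ (j + 1) - ((-1) ^ (j + 4) * fact j) * (real (j + 1) * z ^ j)) / (z ^ (j + 1) * z ^ (j + 1))
          = (-1) ^ (j + 5) * fact (j + 1) / z ^ (j + 2)"
        using z by (simp only: mult_zero_left diff_0 mult.assoc[symmetric] minus_divide_left[symmetric]) simp
    qed
    then show ?thesis
      unfolding 4 ln_tower_def[abs_def] by (simp add: add.commute)
  qed
qed


lemma ln_tower_central_diff:
  assumes z: "1 < z" and R: "0 < R" and iR: "3 \<le> i + 2 * R"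
  shows "\<bar>ln_tower i (z + 1) + ln_tower i (z - 1) - 2 * ln_tower i z
      - (\<Sum>r=1..<R. 2 / fact (2 * r) * ln_tower (i + 2 * r) z)\<bar>
    \<le> 2 * fact (i + 2 * R - 3) / (z - 1) ^ (i + 2 * R - 2)"
proof -
  let ?n = "2 * R"
  have T: "\<exists>t. \<bar>t - z\<bar> < 1 \<and> ln_tower i (z + h)
      = (\<Sum>m<?n. ln_tower (i + m) z / fact m * h ^ m) + ln_tower (i + ?n) t / fact ?n * h ^ ?n"
    if h: "h = 1 \<or> h = -1" for h :: real
  proof -
    have "\<exists>t. (if z + h < z then z + h < t \<and> t < z else z < t \<and> t < z + h) \<and>
       ln_tower i (z + h) = (\<Sum>m<?n. ln_tower (i + m) z / fact m * ((z + h) - z) ^ m)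
         + ln_tower (i + ?n) t / fact ?n * ((z + h) - z) ^ ?n"
      by (rule Taylor[where a = "z - 1" and b = "z + 1"])
         (use z R h in \<open>auto intro!: ln_tower_deriv\<close>)
    then obtain t where "if z + h < z then z + h < t \<and> t < z else z < t \<and> t < z + h"
       "ln_tower i (z + h) = (\<Sum>m<?n. ln_tower (i + m) z / fact m * ((z + h) - z) ^ m)
         + ln_tower (i + ?n) t / fact ?n * ((z + h) - z) ^ ?n"
      by blast
    then show ?thesis using h by (intro exI[of _ t]) (auto split: if_splits)
  qed
  obtain t1 where t1: "\<bar>t1 - z\<bar> < 1" "ln_tower i (z + 1)
      = (\<Sum>m<?n. ln_tower (i + m) z / fact m) + ln_tower (i + ?n) t1 / fact ?n"
    using T[of 1] by auto
  obtain t2 where t2: "\<bar>t2 - z\<bar> < 1" "ln_tower i (z - 1)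
      = (\<Sum>m<?n. ln_tower (i + m) z / fact m * (-1) ^ m) + ln_tower (i + ?n) t2 / fact ?n"
    using T[of "-1"] by auto
  have bound: "\<bar>ln_tower (i + ?n) t / fact ?n\<bar> \<le> fact (i + ?n - 3) / (z - 1) ^ (i + ?n - 2)"
    if t: "\<bar>t - z\<bar> < 1" for t
  proof -
    have t': "z - 1 \<le> t" "0 < t" "0 < z - 1" using t z by auto
    have "\<bar>ln_tower (i + ?n) t\<bar> = fact (i + ?n - 3) / t ^ (i + ?n - 2)"
      using iR t' by (auto simp: ln_tower_def abs_mult power_abs)
    also have "\<dots> \<le> fact (i + ?n - 3) / (z - 1) ^ (i + ?n - 2)"
      using t' by (intro divide_left_mono power_mono mult_pos_pos) auto
    finally have b: "\<bar>ln_tower (i + ?n) t\<bar> \<le> fact (i + ?n - 3) / (z - 1) ^ (i + ?n - 2)" .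
    have "\<bar>ln_tower (i + ?n) t / fact ?n\<bar> = \<bar>ln_tower (i + ?n) t\<bar> / fact ?n" by simp
    also have "\<dots> \<le> \<bar>ln_tower (i + ?n) t\<bar> / 1"
      by (intro divide_left_mono) (auto simp: fact_ge_1)
    finally show ?thesis using b by simp
  qed
  have "(\<Sum>m<?n. ln_tower (i + m) z / fact m) + (\<Sum>m<?n. ln_tower (i + m) z / fact m * (-1) ^ m)
      = (\<Sum>m<?n. if even m then 2 / fact m * ln_tower (i + m) z else 0)"
    unfolding sum.distrib[symmetric] by (intro sum.cong) auto
  also have "\<dots> = (\<Sum>r<R. 2 / fact (2 * r) * ln_tower (i + 2 * r) z)"
    by (induction R) auto
  also have "\<dots> = 2 * ln_tower i z + (\<Sum>r=1..<R. 2 / fact (2 * r) * ln_tower (i + 2 * r) z)"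
    using R by (simp add: lessThan_atLeast0 sum.atLeast_Suc_lessThan)
  finally have "ln_tower i (z + 1) + ln_tower i (z - 1) - 2 * ln_tower i z
      - (\<Sum>r=1..<R. 2 / fact (2 * r) * ln_tower (i + 2 * r) z)
    = ln_tower (i + ?n) t1 / fact ?n + ln_tower (i + ?n) t2 / fact ?n"
    unfolding t1(2) t2(2) by simp
  also have "\<bar>\<dots>\<bar> \<le> \<bar>ln_tower (i + ?n) t1 / fact ?n\<bar> + \<bar>ln_tower (i + ?n) t2 / fact ?n\<bar>"
    by (rule abs_triangle_ineq)
  also have "\<dots> \<le> fact (i + ?n - 3) / (z - 1) ^ (i + ?n - 2) + fact (i + ?n - 3) / (z - 1) ^ (i + ?n - 2)"
    by (intro add_mono bound t1(1) t2(1))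
  finally show ?thesis
    by simp
qed

text \<open>
  With \<open>D\<close> for differentiation this is \<open>(\<Sum>k\<le>K. inv_diff2_coeff k * D ^ (2 * k - 2)) ln\<close>, the beginning of the
  asymptotic series of the logarithm of the Barnes function, up to an affine function of \<open>z\<close>. Affine
  functions cancel in the second-order differences for which it is used.
\<close>
definition barnes_sum :: "nat \<Rightarrow> real \<Rightarrow> real" where
  "barnes_sum K z = (\<Sum>k\<le>K. inv_diff2_coeff k * ln_tower (2 * k) z)"

text \<open>
  By Taylor's formula the second difference is \<open>\<Sum>r\<ge>1. 2 / (2 r)! * D ^ (2 * r)\<close> up to a remainder. Expanding
  every summand of \<open>barnes_sum\<close> to the same total order \<open>2 * K + 2\<close>, the coefficients of all derivatives of
  \<open>ln\<close> vanish by \<open>inv_diff2_coeff_conv\<close> and only \<open>ln\<close> itself remains.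
\<close>
lemma barnes_sum_second_difference:
  obtains C where "0 \<le> C" "\<And>z. 1 < z \<Longrightarrow>
    \<bar>barnes_sum K (z + 1) + barnes_sum K (z - 1) - 2 * barnes_sum K z - ln z\<bar> \<le> C / (z - 1) ^ (2 * K + 2)"
proof -
  define C where "C = (\<Sum>k\<le>K. \<bar>inv_diff2_coeff k\<bar> * (2 * fact (2 * K + 1)))"
  show ?thesis
  proof (rule that[of C])
    show "0 \<le> C" unfolding C_def by (intro sum_nonneg) auto
    fix z :: real assume z: "1 < z"
    define S where "S k = (\<Sum>r=1..<K + 2 - k. 2 / fact (2 * r) * ln_tower (2 * k + 2 * r) z)" for k
    have b: "\<bar>ln_tower (2 * k) (z + 1) + ln_tower (2 * k) (z - 1) - 2 * ln_tower (2 * k) z - S k\<bar>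
        \<le> 2 * fact (2 * K + 1) / (z - 1) ^ (2 * K + 2)" if "k \<le> K" for k
    proof -
      have e: "2 * k + 2 * (K + 2 - k) - 3 = 2 * K + 1" "2 * k + 2 * (K + 2 - k) - 2 = 2 * K + 2"
        using that by auto
      show ?thesis
        using ln_tower_central_diff[of z "K + 2 - k" "2 * k"] z that
        unfolding e S_def by simp
    qed
    have "(\<Sum>k\<le>K. inv_diff2_coeff k * S k) = ln z"
    proof -
      have "(\<Sum>k\<le>K. inv_diff2_coeff k * S k)
         = (\<Sum>k\<le>K. \<Sum>s\<in>{k<..K + 1}. inv_diff2_coeff k * (2 / fact (2 * (s - k))) * ln_tower (2 * s) z)"
      proof (intro sum.cong refl)
        fix k assume "k \<in> {..K}"
        then have "S k = (\<Sum>s\<in>{k<..K + 1}. (2 / fact (2 * (s - k))) * ln_tower (2 * s) z)"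
          unfolding S_def
          by (intro sum.reindex_bij_witness[of _ "\<lambda>s. s - k" "\<lambda>r. r + k"]) (auto simp: algebra_simps)
        then show "inv_diff2_coeff k * S k = (\<Sum>s\<in>{k<..K + 1}. inv_diff2_coeff k * (2 / fact (2 * (s - k))) * ln_tower (2 * s) z)"
          by (simp add: sum_distrib_left mult.assoc)
      qed
      also have "\<dots> = (\<Sum>s\<in>{1..K + 1}. \<Sum>k<s. inv_diff2_coeff k * (2 / fact (2 * (s - k))) * ln_tower (2 * s) z)"
        unfolding sum.Sigma[OF finite_atMost ballI[OF finite_greaterThanAtMost]]
          sum.Sigma[OF finite_atLeastAtMost ballI[OF finite_lessThan]]
        by (rule sum.reindex_bij_witness[of _ "\<lambda>(s, k). (k, s)" "\<lambda>(k, s). (s, k)"]) auto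
      also have "\<dots> = (\<Sum>s\<in>{1..K + 1}. (if s = 1 then 1 else 0) * ln_tower (2 * s) z)"
        unfolding sum_distrib_right[symmetric] inv_diff2_coeff_conv ..
      also have "\<dots> = (\<Sum>s\<in>{1..K + 1}. if s = 1 then ln_tower (2 * s) z else 0)"
        by (intro sum.cong) auto
      also have "\<dots> = ln z"
        by (subst sum.delta) (auto simp: ln_tower_def)
      finally show ?thesis .
    qed
    then have "barnes_sum K (z + 1) + barnes_sum K (z - 1) - 2 * barnes_sum K z - ln z
      = (\<Sum>k\<le>K. inv_diff2_coeff k * (ln_tower (2 * k) (z + 1) + ln_tower (2 * k) (z - 1) - 2 * ln_tower (2 * k) z - S k))"
      by (simp add: barnes_sum_def sum_distrib_left algebra_simps sum.distrib sum_subtractf)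
    also have "\<bar>\<dots>\<bar> \<le> (\<Sum>k\<le>K. \<bar>inv_diff2_coeff k\<bar> * (2 * fact (2 * K + 1) / (z - 1) ^ (2 * K + 2)))"
      by (rule order_trans[OF sum_abs], unfold abs_mult, intro sum_mono mult_left_mono b) auto
    also have "\<dots> = C / (z - 1) ^ (2 * K + 2)"
      by (simp add: C_def sum_divide_distrib)
    finally show "\<bar>barnes_sum K (z + 1) + barnes_sum K (z - 1) - 2 * barnes_sum K z - ln z\<bar> \<le> C / (z - 1) ^ (2 * K + 2)" .
  qed
qed

section \<open>Products of gamma quotients\<close>

text \<open>
  This is Gauss's limit formula for \<open>Gamma (1 - e)\<close>, read as a statement about the quotient of two gamma values
  at large arguments.
\<close>
lemma ln_Gamma_shift_tendsto:
  assumes e: "0 \<le> e" "e < 1"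
  shows "(\<lambda>k. ln (Gamma (real k - e)) - ln (Gamma (real k)) + e * ln (real k)) \<longlonglongrightarrow> 0"
proof -
  have G: "0 < Gamma (1 - e)" using e by (intro Gamma_real_pos) auto
  have "(\<lambda>n. Gamma_series (1 - e) n / Gamma (1 - e)) \<longlonglongrightarrow> Gamma (1 - e) / Gamma (1 - e)"
    by (intro tendsto_divide Gamma_series_LIMSEQ tendsto_const) (use G in auto)
  then have "(\<lambda>n. ln (Gamma_series (1 - e) n / Gamma (1 - e))) \<longlonglongrightarrow> ln 1"
    using G by (intro tendsto_ln) auto
  moreover have "(\<lambda>n. e * ln (real n + 2) + (1 - e) * ln (real n) - ln (real n + 1)) \<longlonglongrightarrow> 0"
    by real_asymp
  ultimately have lim: "(\<lambda>n. - ln (Gamma_series (1 - e) n / Gamma (1 - e)) +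
      (e * ln (real n + 2) + (1 - e) * ln (real n) - ln (real n + 1))) \<longlonglongrightarrow> - ln 1 + 0"
    by (intro tendsto_add tendsto_minus)
  have "(\<lambda>n. ln (Gamma (real (n + 2) - e)) - ln (Gamma (real (n + 2))) + e * ln (real (n + 2))) \<longlonglongrightarrow> 0"
  proof (rule Lim_transform_eventually)
    show "(\<lambda>n. - ln (Gamma_series (1 - e) n / Gamma (1 - e)) +
      (e * ln (real n + 2) + (1 - e) * ln (real n) - ln (real n + 1))) \<longlonglongrightarrow> 0"
      using lim by simp
    show "\<forall>\<^sub>F n in sequentially. - ln (Gamma_series (1 - e) n / Gamma (1 - e)) +
      (e * ln (real n + 2) + (1 - e) * ln (real n) - ln (real n + 1))
       = ln (Gamma (real (n + 2) - e)) - ln (Gamma (real (n + 2))) + e * ln (real (n + 2))"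
      using eventually_gt_at_top[of 0]
    proof eventually_elim
      case (elim n)
      have pos: "0 < Gamma (real (n + 2) - e)" "0 < Gamma (real (n + 1))" "0 < Gamma (real (n + 2))"
        using e by (auto intro!: Gamma_real_pos)
      have nz: "Gamma (real (n + 2) - e) \<noteq> 0" "Gamma (real (n + 1)) \<noteq> 0" "Gamma (real (n + 2)) \<noteq> 0"
        using pos by linarith+
      have "1 - e \<notin> \<int>\<^sub>\<le>\<^sub>0" using e by (auto elim!: nonpos_Ints_cases)
      then have "pochhammer (1 - e) (n + 1) = Gamma (1 - e + real (n + 1)) / Gamma (1 - e)"
        by (rule pochhammer_Gamma)
      also have "1 - e + real (n + 1) = real (n + 2) - e" by simp
      finally have "Gamma_series (1 - e) n / Gamma (1 - e)
          = Gamma (real (n + 1)) * exp ((1 - e) * ln (real n)) / Gamma (real (n + 2) - e)"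
        using G by (simp add: Gamma_series_def Gamma_fact[symmetric] add.commute)
      then have 1: "ln (Gamma_series (1 - e) n / Gamma (1 - e))
          = ln (Gamma (real (n + 1))) + (1 - e) * ln (real n) - ln (Gamma (real (n + 2) - e))"
        using nz by (simp only:) (simp add: ln_div ln_mult)
      have "Gamma (real (n + 2)) = real (n + 1) * Gamma (real (n + 1))"
        using Gamma_plus1[of "real (n + 1)"] by (simp add: add_ac nonpos_Ints_def)
      then have 2: "ln (Gamma (real (n + 2))) = ln (real n + 1) + ln (Gamma (real (n + 1)))"
        using nz by (simp only:) (simp add: ln_mult add.commute)
      show ?case unfolding 1 2 by (simp add: algebra_simps)
    qed
  qed
  then show ?thesis by (rule LIMSEQ_offset)
qed

definition barnes_diff :: "nat \<Rightarrow> real \<Rightarrow> real" where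
  "barnes_diff K z = barnes_sum K z - barnes_sum K (z - 1)"

lemma inv_diff2_coeff_0: "inv_diff2_coeff 0 = 1" and inv_diff2_coeff_1: "inv_diff2_coeff 1 = - 1 / 12"
  by (simp_all add: inv_diff2_coeff_def numeral_2_eq_2)

lemma barnes_diff_shift_tendsto:
  assumes e: "0 \<le> e" "e < 1"
  shows "((\<lambda>z. barnes_diff K (z - e) - barnes_diff K z + e * ln z) \<longlongrightarrow> 0) at_top"
proof -
  define d where "d i z = ln_tower i (z - e) - ln_tower i (z - e - 1) - (ln_tower i z - ln_tower i (z - 1))" for i z
  have d0: "((\<lambda>z. d 0 z + e * ln z) \<longlongrightarrow> 0) at_top"
  \<comment> \<open>mean value theorem twice: on \<open>{z - e..z}\<close>, then on an interval of length 1\<close>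
  proof (rule Lim_null_comparison)
    show "((\<lambda>z :: real. ln z - ln (z - 2)) \<longlongrightarrow> 0) at_top"
      by real_asymp
    show "\<forall>\<^sub>F z in at_top. norm (d 0 z + e * ln z) \<le> ln z - ln (z - 2)"
      using eventually_gt_at_top[of 2]
    proof eventually_elim
      case (elim z)
      show ?case
      proof (cases "e = 0")
        case True
        then show ?thesis using elim by (simp add: d_def)
      next
        case False
        with e have e0: "0 < e" by simp
        have "\<exists>t. z - e < t \<and> t < z \<and> (ln_tower 0 z - ln_tower 0 (z - 1)) - (ln_tower 0 (z - e) - ln_tower 0 (z - e - 1))
            = (z - (z - e)) * (ln_tower 1 t - ln_tower 1 (t - 1))"
          using e e0 elim by (intro MVT2) (auto intro!: derivative_eq_intros DERIV_chain2[OF ln_tower_deriv] ln_tower_deriv[of _ 0, simplified])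
        then obtain t where t: "z - e < t" "t < z" "d 0 z = - (e * (ln_tower 1 t - ln_tower 1 (t - 1)))"
          unfolding d_def by auto
        have "\<exists>x. t - 1 < x \<and> x < t \<and> ln_tower 1 t - ln_tower 1 (t - 1) = (t - (t - 1)) * ln_tower 2 x"
          using t e elim by (intro MVT2) (auto intro!: ln_tower_deriv[of _ 1, simplified] simp: numeral_2_eq_2)
        then obtain x where x: "t - 1 < x" "x < t" "d 0 z = - (e * ln x)"
          using t(3) by (auto simp: ln_tower_def)
        have "norm (d 0 z + e * ln z) = e * (ln z - ln x)"
        proof -
          have "d 0 z + e * ln z = e * (ln z - ln x)" by (simp add: x right_diff_distrib)
          moreover have "ln x \<le> ln z" using x t e elim by (subst ln_le_cancel_iff) auto
          ultimately show ?thesis using e by (simp add: abs_mult)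
        qed
        also have "\<dots> \<le> 1 * (ln z - ln (z - 2))"
        proof (rule mult_mono)
          have "ln (z - 2) \<le> ln x" using x t e elim by (subst ln_le_cancel_iff) auto
          then show "ln z - ln x \<le> ln z - ln (z - 2)" by simp
          show "0 \<le> ln z - ln x" using x t e elim by simp
        qed (use e in auto)
        finally show ?thesis by simp
      qed
    qed
  qed
  \<comment> \<open>the remaining terms tend to 0 separately\<close>
  have dk: "(d (2 * k) \<longlongrightarrow> 0) at_top" if "1 \<le> k" for k
  proof (cases "k = 1")
    case True
    then show ?thesis
      unfolding d_def[abs_def] ln_tower_def by simp real_asymp
  next
    case False
    with that have k: "2 \<le> k" by simp
    have t: "((\<lambda>z. ln_tower (2 * k) (z - a)) \<longlongrightarrow> 0) at_top" for a
    proof -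
      have "filterlim (\<lambda>z. (z - a) ^ (2 * k - 2)) at_infinity at_top"
        using k by (intro filterlim_at_top_imp_at_infinity filterlim_pow_at_top) (auto, real_asymp)
      then have "((\<lambda>z. (-1) ^ (2 * k + 1) * fact (2 * k - 3) / (z - a) ^ (2 * k - 2)) \<longlongrightarrow> 0) at_top"
        by (rule tendsto_divide_0[OF tendsto_const])
      moreover have "ln_tower (2 * k) (z - a) = (-1) ^ (2 * k + 1) * fact (2 * k - 3) / (z - a) ^ (2 * k - 2)" for z
        using k by (simp add: ln_tower_def)
      ultimately show ?thesis by simp
    qed
    have "((\<lambda>z. ln_tower (2 * k) (z - e) - ln_tower (2 * k) (z - (e + 1)) - (ln_tower (2 * k) (z - 0) - ln_tower (2 * k) (z - 1))) \<longlongrightarrow> 0 - 0 - (0 - 0)) at_top"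
      by (intro tendsto_diff t)
    then show ?thesis by (simp add: d_def[abs_def] algebra_simps)
  qed
  have eq: "barnes_diff K (z - e) - barnes_diff K z + e * ln z
     = (d 0 z + e * ln z) + (\<Sum>k=1..K. inv_diff2_coeff k * d (2 * k) z)" for z
  proof -
    have "barnes_diff K (z - e) - barnes_diff K z = (\<Sum>k\<le>K. inv_diff2_coeff k * d (2 * k) z)"
      by (simp add: barnes_diff_def barnes_sum_def d_def right_diff_distrib sum_subtractf)
    also have "\<dots> = d 0 z + (\<Sum>k=1..K. inv_diff2_coeff k * d (2 * k) z)"
      by (simp add: atMost_atLeast0 sum.atLeast_Suc_atMost inv_diff2_coeff_0)
    finally show ?thesis by simp
  qed
  have "((\<lambda>z. (d 0 z + e * ln z) + (\<Sum>k=1..K. inv_diff2_coeff k * d (2 * k) z)) \<longlongrightarrow> 0 + (\<Sum>k=1..K. inv_diff2_coeff k * 0)) at_top"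
    by (intro tendsto_add tendsto_sum tendsto_mult tendsto_const d0 dk) auto
  then show ?thesis unfolding eq by simp
qed

text \<open>
  The difference \<open>E\<close> of \<open>barnes_diff\<close> and \<open>ln \<circ> Gamma\<close> has increments of order \<open>z ^ (-2 * K - 2)\<close>, but need not
  be small itself. The difference of two of its values at distance \<open>e\<close> tends to 0 at infinity, so it is
  bounded by the sum of its later increments. The constant does not depend on \<open>e\<close>; this matters because
  \<open>e = p / n\<close> varies with \<open>n\<close>.
\<close>
lemma ln_Gamma_ratio_barnes:
  obtains C where "0 \<le> C" "\<And>e k. 0 \<le> e \<Longrightarrow> e < 1 \<Longrightarrow> 3 \<le> k \<Longrightarrow>
    \<bar>ln (Gamma (real k - e)) - ln (Gamma (real k)) - (barnes_diff K (real k - e) - barnes_diff K (real k))\<bar>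
      \<le> C / (real k - 2) ^ (2 * K)"
proof -
  obtain C0 where C0: "0 \<le> C0" "\<And>z. 1 < z \<Longrightarrow>
    \<bar>barnes_sum K (z + 1) + barnes_sum K (z - 1) - 2 * barnes_sum K z - ln z\<bar> \<le> C0 / (z - 1) ^ (2 * K + 2)"
    using barnes_sum_second_difference by blast
  \<comment> \<open>two of the powers in the bound for the increments are spent on this convergent majorant\<close>
  define S where "S = (\<Sum>i. inverse (real (Suc i) ^ 2))"
  have summable: "summable (\<lambda>i. inverse (real (Suc i) ^ 2))"
    using inverse_power_summable[of 2, where 'a=real] by (subst summable_Suc_iff) auto
  have S: "0 \<le> S" unfolding S_def by (intro suminf_nonneg summable) auto
  define E where "E z = barnes_diff K z - ln (Gamma z)" for z
  have E: "\<bar>E (z + 1) - E z\<bar> \<le> C0 / (z - 1) ^ (2 * K + 2)" if z: "1 < z" for z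
  proof -
    have "Gamma (z + 1) = z * Gamma z"
      using z by (intro Gamma_plus1) (auto elim!: nonpos_Ints_cases)
    moreover have "Gamma z \<noteq> 0" using Gamma_real_pos[of z] z by linarith
    ultimately have "ln (Gamma (z + 1)) = ln z + ln (Gamma z)"
      using z by (simp add: ln_mult)
    then have "E (z + 1) - E z = barnes_sum K (z + 1) + barnes_sum K (z - 1) - 2 * barnes_sum K z - ln z"
      by (simp add: E_def barnes_diff_def)
    with C0(2)[OF z] show ?thesis by simp
  qed
  show ?thesis
  proof (rule that[of "2 * C0 * S"])
    show "0 \<le> 2 * C0 * S" using C0 S by simp
    fix e :: real and k :: nat assume e: "0 \<le> e" "e < 1" and k: "3 \<le> k"
    define h where "h j = E (real j - e) - E (real j)" for j
    have step: "\<bar>h (Suc j) - h j\<bar> \<le> 2 * C0 / (real j - 2) ^ (2 * K + 2)" if j: "3 \<le> j" for j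
    proof -
      have "h (Suc j) - h j = (E (real j - e + 1) - E (real j - e)) - (E (real j + 1) - E (real j))"
        by (simp add: h_def algebra_simps)
      then have "\<bar>h (Suc j) - h j\<bar> \<le> \<bar>E (real j - e + 1) - E (real j - e)\<bar> + \<bar>E (real j + 1) - E (real j)\<bar>"
        by linarith
      also have "\<dots> \<le> C0 / (real j - e - 1) ^ (2 * K + 2) + C0 / (real j - 1) ^ (2 * K + 2)"
        using j e by (intro add_mono E) auto
      also have "\<dots> \<le> C0 / (real j - 2) ^ (2 * K + 2) + C0 / (real j - 2) ^ (2 * K + 2)"
        using j e C0 by (intro add_mono divide_left_mono power_mono mult_pos_pos zero_less_power) auto
      finally show ?thesis by simp
    qed
    have h_lim: "h \<longlonglongrightarrow> 0"
    proof -
      have "(\<lambda>j. barnes_diff K (real j - e) - barnes_diff K (real j) + e * ln (real j)) \<longlonglongrightarrow> 0"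
        by (rule filterlim_compose[OF barnes_diff_shift_tendsto[OF e] filterlim_real_sequentially])
      from tendsto_diff[OF this ln_Gamma_shift_tendsto[OF e]] show ?thesis
        by (simp add: h_def[abs_def] E_def algebra_simps)
    qed
    have bound: "\<bar>h k\<bar> \<le> \<bar>h (k + J)\<bar> + 2 * C0 * S / (real k - 2) ^ (2 * K)" for J
    proof -
      have "\<bar>h (k + J) - h k\<bar> = \<bar>\<Sum>i<J. h (Suc (k + i)) - h (k + i)\<bar>"
        using sum_lessThan_telescope[of "\<lambda>i. h (k + i)" J] by simp
      also have "\<dots> \<le> (\<Sum>i<J. \<bar>h (Suc (k + i)) - h (k + i)\<bar>)"
        by (rule sum_abs)
      also have "\<dots> \<le> (\<Sum>i<J. 2 * C0 / (real k - 2) ^ (2 * K) * inverse (real (Suc i) ^ 2))"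
      proof (rule sum_mono)
        fix i
        have "\<bar>h (Suc (k + i)) - h (k + i)\<bar> \<le> 2 * C0 / (real (k + i) - 2) ^ (2 * K + 2)"
          using k by (intro step) auto
        also have "\<dots> \<le> 2 * C0 / ((real k - 2) ^ (2 * K) * real (Suc i) ^ 2)"
        proof (intro divide_left_mono)
          have "(real k - 2) ^ (2 * K) * real (Suc i) ^ 2 \<le> (real (k + i) - 2) ^ (2 * K) * (real (k + i) - 2) ^ 2"
            using k by (intro mult_mono power_mono) auto
          then show "(real k - 2) ^ (2 * K) * real (Suc i) ^ 2 \<le> (real (k + i) - 2) ^ (2 * K + 2)"
            by (simp only: power_add)
        qed (use k C0 in auto)
        finally show "\<bar>h (Suc (k + i)) - h (k + i)\<bar> \<le> 2 * C0 / (real k - 2) ^ (2 * K) * inverse (real (Suc i) ^ 2)"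
          by (simp add: divide_inverse)
      qed
      also have "\<dots> = 2 * C0 / (real k - 2) ^ (2 * K) * (\<Sum>i<J. inverse (real (Suc i) ^ 2))"
        by (rule sum_distrib_left[symmetric])
      also have "\<dots> \<le> 2 * C0 / (real k - 2) ^ (2 * K) * S"
        unfolding S_def using k C0 by (intro mult_left_mono sum_le_suminf summable) auto
      finally show ?thesis by (simp add: abs_le_iff) linarith
    qed
    have "(\<lambda>J. \<bar>h (J + k)\<bar> + 2 * C0 * S / (real k - 2) ^ (2 * K)) \<longlonglongrightarrow> \<bar>0\<bar> + 2 * C0 * S / (real k - 2) ^ (2 * K)"
      by (intro tendsto_add tendsto_rabs tendsto_const LIMSEQ_ignore_initial_segment h_lim)
    then have "\<bar>h k\<bar> \<le> \<bar>0\<bar> + 2 * C0 * S / (real k - 2) ^ (2 * K)"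
      by (rule LIMSEQ_le_const) (use bound in \<open>auto simp: add.commute\<close>)
    then show "\<bar>ln (Gamma (real k - e)) - ln (Gamma (real k)) - (barnes_diff K (real k - e) - barnes_diff K (real k))\<bar>
      \<le> 2 * C0 * S / (real k - 2) ^ (2 * K)"
      by (simp add: h_def E_def abs_minus_commute algebra_simps)
  qed
qed

lemma sum_ln_Gamma_ratio_barnes:
  obtains C where "0 \<le> C" "\<And>e n m. 0 \<le> e \<Longrightarrow> e < 1 \<Longrightarrow> n + 2 \<le> m \<Longrightarrow>
    \<bar>(\<Sum>k<n. ln (Gamma (real m - real k - e)) - ln (Gamma (real m - real k)))
      - ((barnes_sum K (real m - e) - barnes_sum K (real m))
        - (barnes_sum K (real m - real n - e) - barnes_sum K (real m - real n)))\<bar>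
      \<le> C * real n / (real m - real n - 1) ^ (2 * K)"
proof -
  obtain C where C: "0 \<le> C" "\<And>e k. 0 \<le> e \<Longrightarrow> e < 1 \<Longrightarrow> 3 \<le> k \<Longrightarrow>
    \<bar>ln (Gamma (real k - e)) - ln (Gamma (real k)) - (barnes_diff K (real k - e) - barnes_diff K (real k))\<bar>
      \<le> C / (real k - 2) ^ (2 * K)"
    using ln_Gamma_ratio_barnes by blast
  show ?thesis
  proof (rule that[OF C(1)])
    fix e :: real and n m :: nat assume e: "0 \<le> e" "e < 1" and nm: "n + 2 \<le> m"
    have tele: "(\<Sum>k<n. barnes_diff K (real m - real k - a)) = barnes_sum K (real m - a) - barnes_sum K (real m - real n - a)" for a
      by (induction n) (auto simp: barnes_diff_def algebra_simps)
    have "(\<Sum>k<n. ln (Gamma (real m - real k - e)) - ln (Gamma (real m - real k)))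
      - ((barnes_sum K (real m - e) - barnes_sum K (real m))
        - (barnes_sum K (real m - real n - e) - barnes_sum K (real m - real n)))
      = (\<Sum>k<n. ln (Gamma (real m - real k - e)) - ln (Gamma (real m - real k))
          - (barnes_diff K (real m - real k - e) - barnes_diff K (real m - real k)))"
      using tele[of e] tele[of 0] by (simp add: sum_subtractf)
    also have "\<bar>\<dots>\<bar> \<le> (\<Sum>k<n. C / (real m - real n - 1) ^ (2 * K))"
    proof (rule order_trans[OF sum_abs sum_mono])
      fix k assume "k \<in> {..<n}"
      then have k: "k < n" by simp
      have eq: "real m - real k = real (m - k)" using k nm by simp
      have "\<bar>ln (Gamma (real m - real k - e)) - ln (Gamma (real m - real k))
          - (barnes_diff K (real m - real k - e) - barnes_diff K (real m - real k))\<bar> \<le> C / (real (m - k) - 2) ^ (2 * K)"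
        unfolding eq using k nm e by (intro C(2)) auto
      also have "\<dots> \<le> C / (real m - real n - 1) ^ (2 * K)"
        using k nm C(1) by (intro divide_left_mono power_mono mult_pos_pos zero_less_power) auto
      finally show "\<bar>ln (Gamma (real m - real k - e)) - ln (Gamma (real m - real k))
          - (barnes_diff K (real m - real k - e) - barnes_diff K (real m - real k))\<bar> \<le> C / (real m - real n - 1) ^ (2 * K)" .
    qed
    finally show "\<bar>(\<Sum>k<n. ln (Gamma (real m - real k - e)) - ln (Gamma (real m - real k)))
      - ((barnes_sum K (real m - e) - barnes_sum K (real m))
        - (barnes_sum K (real m - real n - e) - barnes_sum K (real m - real n)))\<bar>
      \<le> C * real n / (real m - real n - 1) ^ (2 * K)"
      by (simp add: mult.commute)
  qed
qed

section \<open>Calculus of asymptotic expansions\<close>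

text \<open>
  Storing the coefficients in a formal power series turns operations on expansions into ring
  operations.
\<close>
definition expands :: "'b filter \<Rightarrow> ('b \<Rightarrow> real) \<Rightarrow> nat \<Rightarrow> ('b \<Rightarrow> real) \<Rightarrow> real fps \<Rightarrow> bool" where
  "expands F u N f A \<longleftrightarrow> (\<lambda>x. f x - (\<Sum>q\<le>N. fps_nth A q * u x ^ q)) \<in> O[F](\<lambda>x. u x ^ Suc N)"

lemma expands_cong:
  assumes "expands F u N f A" "eventually (\<lambda>x. f x = g x) F" "\<And>q. q \<le> N \<Longrightarrow> fps_nth A q = fps_nth B q"
  shows "expands F u N g B"
proof -
  have "(\<lambda>x. f x - (\<Sum>q\<le>N. fps_nth A q * u x ^ q)) \<in> O[F](\<lambda>x. u x ^ Suc N) \<longleftrightarrow>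
      (\<lambda>x. g x - (\<Sum>q\<le>N. fps_nth B q * u x ^ q)) \<in> O[F](\<lambda>x. u x ^ Suc N)"
    using assms(2) by (intro landau_o.big.in_cong) (auto elim!: eventually_mono simp: assms(3))
  then show ?thesis using assms(1) by (simp add: expands_def)
qed

lemma expands_add:
  assumes "expands F u N f A" "expands F u N g B"
  shows "expands F u N (\<lambda>x. f x + g x) (A + B)"
  using sum_in_bigo(1)[OF assms[unfolded expands_def]]
  by (simp add: expands_def algebra_simps sum.distrib)

lemma expands_cmult:
  assumes "expands F u N f A"
  shows "expands F u N (\<lambda>x. c * f x) (fps_const c * A)"
proof -
  have "(\<lambda>x. c * (f x - (\<Sum>q\<le>N. fps_nth A q * u x ^ q))) \<in> O[F](\<lambda>x. u x ^ Suc N)"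
    using assms unfolding expands_def by (cases "c = 0") auto
  then show ?thesis
    by (simp add: expands_def right_diff_distrib sum_distrib_left mult.assoc)
qed

lemma expands_diff:
  assumes "expands F u N f A" "expands F u N g B"
  shows "expands F u N (\<lambda>x. f x - g x) (A - B)"
proof -
  have "A + fps_const (- 1) * B = A - B" by (simp add: fps_ext)
  then show ?thesis
    using expands_add[OF assms(1) expands_cmult[OF assms(2), of "- 1"]] by simp
qed

lemma expands_bigo:
  "f \<in> O[F](\<lambda>x. u x ^ Suc N) \<Longrightarrow> expands F u N f 0"
  by (simp add: expands_def)

lemma expands_const: "expands F u N (\<lambda>_. c) (fps_const c)"
proof -
  have "(\<Sum>q\<le>N. fps_nth (fps_const c) q * u x ^ q) = c" for x
    by (subst sum.remove[of _ 0]) (auto intro!: sum.neutral)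
  then show ?thesis by (simp add: expands_def)
qed

lemma expands_sum:
  assumes "\<And>i. i \<in> I \<Longrightarrow> expands F u N (f i) (A i)"
  shows "expands F u N (\<lambda>x. \<Sum>i\<in>I. f i x) (\<Sum>i\<in>I. A i)"
  using assms
proof (induction I rule: infinite_finite_induct)
  case (insert i I)
  then show ?case by (simp add: expands_add)
qed (use expands_const[of F u N 0] in auto)

lemma expands_linear: "expands F u N (\<lambda>x. u x) fps_X"
proof (cases N)
  case 0
  then show ?thesis by (simp add: expands_def)
next
  case (Suc M)
  have "(\<Sum>q\<le>N. fps_nth fps_X q * u x ^ q) = u x" for x
    using Suc by (subst sum.remove[of _ 1]) (auto intro!: sum.neutral simp: fps_X_def)
  then show ?thesis by (simp add: expands_def)
qed

lemma bigo_power_mono: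
  fixes u :: "'b \<Rightarrow> real"
  assumes u: "(u \<longlongrightarrow> 0) F" and mn: "m \<le> n"
  shows "(\<lambda>x. u x ^ n) \<in> O[F](\<lambda>x. u x ^ m)"
proof (rule bigoI[of _ 1])
  have "\<forall>\<^sub>F x in F. norm (u x) < 1"
    using tendstoD[OF u, of 1] by (simp add: dist_norm)
  then show "\<forall>\<^sub>F x in F. norm (u x ^ n) \<le> 1 * norm (u x ^ m)"
  proof eventually_elim
    case (elim x)
    have "\<bar>u x\<bar> ^ n \<le> \<bar>u x\<bar> ^ m"
      using elim mn by (intro power_decreasing) auto
    then show ?case by (simp add: power_abs)
  qed
qed

lemma expands_bounded:
  assumes u: "(u \<longlongrightarrow> 0) F" and f: "expands F u N f A"
  shows "f \<in> O[F](\<lambda>_. 1)"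
proof -
  have "(\<lambda>x. u x ^ Suc N) \<in> O[F](\<lambda>x. u x ^ 0)"
    by (rule bigo_power_mono[OF u]) simp
  with f have 1: "(\<lambda>x. f x - (\<Sum>q\<le>N. fps_nth A q * u x ^ q)) \<in> O[F](\<lambda>_. 1)"
    unfolding expands_def by (auto intro: landau_o.big_trans)
  have 2: "(\<lambda>x. \<Sum>q\<le>N. fps_nth A q * u x ^ q) \<in> O[F](\<lambda>_. 1)"
  proof (rule big_sum_in_bigo)
    fix q
    have "(\<lambda>x. u x ^ q) \<in> O[F](\<lambda>_. 1)"
      using bigo_power_mono[OF u, of 0 q] by simp
    then show "(\<lambda>x. fps_nth A q * u x ^ q) \<in> O[F](\<lambda>_. 1)"
      by (cases "fps_nth A q = 0") auto
  qed
  from sum_in_bigo(1)[OF 1 2] show ?thesis by simp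
qed

text \<open>
  The products of the two truncations differ from the truncated Cauchy product by monomials of degree
  greater than \<open>N\<close>.
\<close>
lemma expands_mult:
  assumes u: "(u \<longlongrightarrow> 0) F" and f: "expands F u N f A" and g: "expands F u N g B"
  shows "expands F u N (\<lambda>x. f x * g x) (A * B)"
proof -
  define a where "a x = (\<Sum>q\<le>N. fps_nth A q * u x ^ q)" for x
  define b where "b x = (\<Sum>q\<le>N. fps_nth B q * u x ^ q)" for x
  have fa: "(\<lambda>x. f x - a x) \<in> O[F](\<lambda>x. u x ^ Suc N)" and gb: "(\<lambda>x. g x - b x) \<in> O[F](\<lambda>x. u x ^ Suc N)"
    using f g by (simp_all add: expands_def a_def b_def)
  have b1: "b \<in> O[F](\<lambda>_. 1)"
    by (rule expands_bounded[OF u, of N _ B]) (simp add: expands_def b_def)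
  have f1: "f \<in> O[F](\<lambda>_. 1)" by (rule expands_bounded[OF u f])
  have 1: "(\<lambda>x. f x * (g x - b x)) \<in> O[F](\<lambda>x. u x ^ Suc N)"
    using landau_o.big.mult[OF f1 gb] by simp
  have 2: "(\<lambda>x. (f x - a x) * b x) \<in> O[F](\<lambda>x. u x ^ Suc N)"
    using landau_o.big.mult[OF fa b1] by simp
  let ?P = "{..N} \<times> {..N}"
  have ab: "a x * b x = (\<Sum>q\<le>N. fps_nth (A * B) q * u x ^ q) +
      (\<Sum>(i, j)\<in>{(i, j)\<in>?P. N < i + j}. fps_nth A i * fps_nth B j * u x ^ (i + j))" for x
  proof -
    have "a x * b x = (\<Sum>(i, j)\<in>?P. fps_nth A i * fps_nth B j * u x ^ (i + j))"
      by (simp add: a_def b_def sum_product sum.cartesian_product power_add mult_ac)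
    also have "?P = {(i, j)\<in>?P. i + j \<le> N} \<union> {(i, j)\<in>?P. N < i + j}" by auto
    also have "(\<Sum>(i, j)\<in>\<dots>. fps_nth A i * fps_nth B j * u x ^ (i + j))
        = (\<Sum>(i, j)\<in>{(i, j)\<in>?P. i + j \<le> N}. fps_nth A i * fps_nth B j * u x ^ (i + j))
          + (\<Sum>(i, j)\<in>{(i, j)\<in>?P. N < i + j}. fps_nth A i * fps_nth B j * u x ^ (i + j))"
      by (rule sum.union_disjoint) (auto intro: finite_subset[of _ ?P])
    also have "(\<Sum>(i, j)\<in>{(i, j)\<in>?P. i + j \<le> N}. fps_nth A i * fps_nth B j * u x ^ (i + j))
        = (\<Sum>(q, i)\<in>Sigma {..N} (\<lambda>q. {0..q}). fps_nth A i * fps_nth B (q - i) * u x ^ q)"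
      by (rule sum.reindex_bij_witness[of _ "\<lambda>(q, i). (i, q - i)" "\<lambda>(i, j). (i + j, i)"]) auto
    also have "\<dots> = (\<Sum>q\<le>N. \<Sum>i=0..q. fps_nth A i * fps_nth B (q - i) * u x ^ q)"
      by (simp add: sum.Sigma)
    also have "\<dots> = (\<Sum>q\<le>N. fps_nth (A * B) q * u x ^ q)"
      by (simp add: fps_mult_nth sum_distrib_right)
    finally show ?thesis .
  qed
  have 3: "(\<lambda>x. \<Sum>(i, j)\<in>{(i, j)\<in>?P. N < i + j}. fps_nth A i * fps_nth B j * u x ^ (i + j)) \<in> O[F](\<lambda>x. u x ^ Suc N)"
  proof (rule big_sum_in_bigo)
    fix p assume "p \<in> {(i, j)\<in>?P. N < i + j}"
    then obtain i j where p: "p = (i, j)" "Suc N \<le> i + j" by auto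
    have "(\<lambda>x. u x ^ (i + j)) \<in> O[F](\<lambda>x. u x ^ Suc N)"
      by (rule bigo_power_mono[OF u p(2)])
    then show "(\<lambda>x. case p of (i, j) \<Rightarrow> fps_nth A i * fps_nth B j * u x ^ (i + j)) \<in> O[F](\<lambda>x. u x ^ Suc N)"
      unfolding p by (cases "fps_nth A i * fps_nth B j = 0") auto
  qed
  have "f x * g x - (\<Sum>q\<le>N. fps_nth (A * B) q * u x ^ q) = f x * (g x - b x) + (f x - a x) * b x +
      (\<Sum>(i, j)\<in>{(i, j)\<in>?P. N < i + j}. fps_nth A i * fps_nth B j * u x ^ (i + j))" for x
    using ab[of x] by (simp add: algebra_simps)
  then show ?thesis
    unfolding expands_def using sum_in_bigo(1)[OF sum_in_bigo(1)[OF 1 2] 3] by simp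
qed

lemma expands_power:
  assumes "(u \<longlongrightarrow> 0) F" "expands F u N f A"
  shows "expands F u N (\<lambda>x. f x ^ k) (A ^ k)"
proof (induction k)
  case 0
  then show ?case using expands_const[of F u N 1] by simp
next
  case (Suc k)
  then show ?case using expands_mult[OF assms(1,2) Suc] by simp
qed

lemma expands_prod:
  assumes u: "(u \<longlongrightarrow> 0) F" and f: "\<And>i. i \<in> I \<Longrightarrow> expands F u N (f i) (A i)"
  shows "expands F u N (\<lambda>x. \<Prod>i\<in>I. f i x) (\<Prod>i\<in>I. A i)"
  using f
proof (induction I rule: infinite_finite_induct)
  case (insert i I)
  then show ?case by (simp add: expands_mult[OF u])
qed (use expands_const[of F u N 1] in auto)

lemma expands_divide:
  assumes f: "expands F u (Suc N) f A" and A: "fps_nth A 0 = 0" and u0: "eventually (\<lambda>x. u x \<noteq> 0) F"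
  shows "expands F u N (\<lambda>x. f x / u x) (fps_shift 1 A)"
proof -
  have "(\<lambda>x. (f x - (\<Sum>q\<le>Suc N. fps_nth A q * u x ^ q)) / u x) \<in> O[F](\<lambda>x. u x ^ Suc (Suc N) / u x)"
    using f u0 unfolding expands_def by (intro landau_o.big.divide_right) auto
  also have "?this \<longleftrightarrow> ?thesis"
    unfolding expands_def
  proof (rule landau_o.big.cong_ex)
    show "\<forall>\<^sub>F x in F. (f x - (\<Sum>q\<le>Suc N. fps_nth A q * u x ^ q)) / u x
        = f x / u x - (\<Sum>q\<le>N. fps_nth (fps_shift 1 A) q * u x ^ q)"
      using u0 by eventually_elim
        (simp add: sum.atMost_Suc_shift A diff_divide_distrib sum_divide_distrib del: sum.atMost_Suc)
    show "\<forall>\<^sub>F x in F. u x ^ Suc (Suc N) / u x = u x ^ Suc N"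
      using u0 by eventually_elim simp
  qed
  finally show ?thesis .
qed

lemma expands_power_series:
  assumes u: "(u \<longlongrightarrow> 0) F" and r: "0 < r"
    and f: "\<And>x. \<bar>x\<bar> < r \<Longrightarrow> (\<lambda>n. fps_nth A n * x ^ n) sums f x"
  shows "expands F u N (\<lambda>x. f (u x)) A"
proof -
  define B where "B = (\<Sum>n. \<bar>fps_nth A (n + Suc N)\<bar> * (r / 2) ^ n)"
  have s: "summable (\<lambda>n. \<bar>fps_nth A n\<bar> * (r / 2) ^ n)"
  proof -
    have "summable (\<lambda>n. norm (fps_nth A n * (r / 2) ^ n))"
      by (rule powser_insidea[of _ "3 * r / 4"]) (use r f[of "3 * r / 4"] in \<open>auto simp: sums_iff\<close>)
    then show ?thesis using r by (simp add: abs_mult power_abs)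
  qed
  have sN: "summable (\<lambda>n. \<bar>fps_nth A (n + Suc N)\<bar> * (r / 2) ^ n)"
  proof -
    have "summable (\<lambda>n. \<bar>fps_nth A (n + Suc N)\<bar> * (r / 2) ^ (n + Suc N) * (1 / (r / 2) ^ Suc N))"
      using summable_ignore_initial_segment[OF s, of "Suc N"] by (rule summable_mult2)
    then show ?thesis using r by (simp add: power_add)
  qed
  have bound: "\<bar>f x - (\<Sum>q\<le>N. fps_nth A q * x ^ q)\<bar> \<le> B * \<bar>x ^ Suc N\<bar>" if x: "\<bar>x\<bar> \<le> r / 2" for x
  proof -
    have x': "\<bar>x\<bar> < r" using x r by linarith
    have "(\<lambda>n. fps_nth A (n + Suc N) * x ^ (n + Suc N)) sums (f x - (\<Sum>q<Suc N. fps_nth A q * x ^ q))"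
      by (rule sums_split_initial_segment[OF f[OF x']])
    then have sm: "(\<lambda>n. fps_nth A (n + Suc N) * x ^ (n + Suc N)) sums (f x - (\<Sum>q\<le>N. fps_nth A q * x ^ q))"
      by (simp only: lessThan_Suc_atMost)
    have le: "norm (fps_nth A (n + Suc N) * x ^ (n + Suc N)) \<le> \<bar>fps_nth A (n + Suc N)\<bar> * (r / 2) ^ n * \<bar>x ^ Suc N\<bar>" for n
    proof -
      have "\<bar>x\<bar> ^ n \<le> (r / 2) ^ n" using x by (intro power_mono) auto
      then have "\<bar>fps_nth A (n + Suc N)\<bar> * \<bar>x\<bar> ^ n * \<bar>x ^ Suc N\<bar> \<le> \<bar>fps_nth A (n + Suc N)\<bar> * (r / 2) ^ n * \<bar>x ^ Suc N\<bar>"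
        by (intro mult_right_mono mult_left_mono) auto
      then show ?thesis
        by (simp add: abs_mult power_add power_abs mult_ac)
    qed
    have "\<bar>\<Sum>n. fps_nth A (n + Suc N) * x ^ (n + Suc N)\<bar> \<le> (\<Sum>n. \<bar>fps_nth A (n + Suc N)\<bar> * (r / 2) ^ n * \<bar>x ^ Suc N\<bar>)"
      using norm_suminf_le[OF le summable_mult2[OF sN]] by simp
    also have "\<dots> = B * \<bar>x ^ Suc N\<bar>"
      unfolding B_def by (rule suminf_mult2[OF sN, symmetric])
    finally show ?thesis using sm by (simp add: sums_iff)
  qed
  have "\<forall>\<^sub>F x in F. \<bar>u x\<bar> < r / 2"
    using tendstoD[OF u, of "r / 2"] r by (simp add: dist_norm)
  then have "\<forall>\<^sub>F x in F. norm (f (u x) - (\<Sum>q\<le>N. fps_nth A q * u x ^ q)) \<le> B * norm (u x ^ Suc N)"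
    by eventually_elim (use bound in simp)
  then show ?thesis unfolding expands_def by (rule bigoI)
qed

section \<open>The exponential of an expansion\<close>

text \<open>
  The set \<open>index_solutions j\<close> is the case \<open>R = j\<close>. Separating the number of parts from the total allows
  induction on the former.
\<close>
definition bounded_solutions :: "nat \<Rightarrow> nat \<Rightarrow> (nat \<Rightarrow> nat) set" where
  "bounded_solutions R j = {i \<in> {1..R} \<rightarrow>\<^sub>E UNIV. (\<Sum>r=1..R. r * i r) = j}"

lemma finite_bounded_solutions: "finite (bounded_solutions R j)"
proof (rule finite_subset)
  show "bounded_solutions R j \<subseteq> {1..R} \<rightarrow>\<^sub>E {..j}"
  proof
    fix i assume i: "i \<in> bounded_solutions R j"
    have "i r \<le> j" if r: "r \<in> {1..R}" for r
    proof -
      have "i r \<le> r * i r" using r by simp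
      also have "\<dots> \<le> (\<Sum>r=1..R. r * i r)"
        using r by (intro member_le_sum) auto
      finally show ?thesis using i by (simp add: bounded_solutions_def)
    qed
    with i show "i \<in> {1..R} \<rightarrow>\<^sub>E {..j}"
      by (auto simp: bounded_solutions_def PiE_iff)
  qed
qed (intro finite_PiE, auto)

definition exp_monom_fps :: "real \<Rightarrow> nat \<Rightarrow> real fps" where
  "exp_monom_fps a r = Abs_fps (\<lambda>q. if r dvd q then a ^ (q div r) / fact (q div r) else 0)"

lemma exp_monom_sums:
  assumes r: "0 < r"
  shows "(\<lambda>n. fps_nth (exp_monom_fps a r) n * x ^ n) sums exp (a * x ^ r)"
proof -
  have "(\<lambda>i. fps_nth (exp_monom_fps a r) (r * i) * x ^ (r * i)) sums exp (a * x ^ r)"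
    using exp_converges[of "a * x ^ r"] r
    by (simp add: exp_monom_fps_def power_mult_distrib power_mult[symmetric] field_simps)
  then show ?thesis
    using r by (subst (asm) sums_mono_reindex) (auto simp: strict_mono_def exp_monom_fps_def)
qed

text \<open>
  In the induction step the exponent of the new factor is determined by the degree that is left over
  for it.
\<close>
lemma fps_nth_prod_exp_monom:
  "fps_nth (\<Prod>r=1..R. exp_monom_fps (a r) r) j = (\<Sum>i\<in>bounded_solutions R j. \<Prod>r=1..R. a r ^ i r / fact (i r))"
proof (induction R arbitrary: j)
  case 0
  have "bounded_solutions 0 j = (if j = 0 then {\<lambda>_. undefined} else {})"
    by (auto simp: bounded_solutions_def)
  then show ?case by simp
next
  case (Suc R)
  let ?w = "\<lambda>R i. \<Prod>r=1..R. a r ^ i r / fact (i r)"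
  let ?D = "{(q, i). q \<in> {0..j} \<and> Suc R dvd (j - q) \<and> i \<in> bounded_solutions R q}"
  let ?E = "exp_monom_fps (a (Suc R)) (Suc R)"
  have upd: "(\<Sum>r=1..R. r * (i(Suc R := t)) r) = (\<Sum>r=1..R. r * i r)" "?w R (i(Suc R := t)) = ?w R i" for i t
    by (auto intro!: sum.cong prod.cong)
  have res: "(\<Sum>r=1..R. r * (restrict i {1..R}) r) = (\<Sum>r=1..R. r * i r)" for i
    by (auto intro!: sum.cong)
  have "fps_nth (\<Prod>r=1..Suc R. exp_monom_fps (a r) r) j
      = (\<Sum>q=0..j. \<Sum>i\<in>bounded_solutions R q. ?w R i * fps_nth ?E (j - q))"
  proof -
    have "(\<Prod>r=1..Suc R. exp_monom_fps (a r) r) = (\<Prod>r=1..R. exp_monom_fps (a r) r) * ?E" by simp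
    then show ?thesis by (simp only: fps_mult_nth Suc.IH sum_distrib_right)
  qed
  also have "\<dots> = (\<Sum>(q, i)\<in>Sigma {0..j} (bounded_solutions R). ?w R i * fps_nth ?E (j - q))"
    by (rule sum.Sigma) (auto intro: finite_bounded_solutions)
  also have "\<dots> = (\<Sum>(q, i)\<in>?D. ?w R i * fps_nth ?E (j - q))"
    by (rule sum.mono_neutral_right)
       (auto intro!: finite_SigmaI finite_bounded_solutions simp: exp_monom_fps_def split: if_splits)
  also have "\<dots> = (\<Sum>i\<in>bounded_solutions (Suc R) j. ?w (Suc R) i)"
  proof (rule sum.reindex_bij_witness[of _ "\<lambda>i. (\<Sum>r=1..R. r * i r, restrict i {1..R})"
        "\<lambda>(q, i). i(Suc R := (j - q) div Suc R)"])
    fix p assume p: "p \<in> ?D"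
    then obtain q i where qi: "p = (q, i)" "q \<le> j" "Suc R dvd (j - q)" "i \<in> bounded_solutions R q"
      by auto
    have i: "i \<in> extensional {1..R}" "(\<Sum>r=1..R. r * i r) = q"
      using qi(4) by (auto simp: bounded_solutions_def PiE_def)
    have r: "restrict (i(Suc R := t)) {1..R} = i" for t
      using i(1) by (auto simp: restrict_def extensional_def fun_eq_iff)
    show "(\<Sum>r=1..R. r * (case p of (q, i) \<Rightarrow> i(Suc R := (j - q) div Suc R)) r,
        restrict (case p of (q, i) \<Rightarrow> i(Suc R := (j - q) div Suc R)) {1..R}) = p"
      unfolding qi(1) prod.case upd r i(2) ..
    have "q + Suc R * ((j - q) div Suc R) = j"
      using qi(2,3) by (simp only: dvd_mult_div_cancel le_add_diff_inverse)
    then show "(case p of (q, i) \<Rightarrow> i(Suc R := (j - q) div Suc R)) \<in> bounded_solutions (Suc R) j"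
      using i unfolding qi(1) prod.case bounded_solutions_def
      by (simp only: mem_Collect_eq sum.cl_ivl_Suc upd)
         (auto simp: PiE_iff extensional_def)
    show "?w (Suc R) (case p of (q, i) \<Rightarrow> i(Suc R := (j - q) div Suc R)) = (case p of (q, i) \<Rightarrow> ?w R i * fps_nth ?E (j - q))"
      using qi(3) unfolding qi(1) prod.case
      by (simp only: prod.cl_ivl_Suc upd) (simp add: exp_monom_fps_def del: div_mult_self2 div_mult_self1)
  next
    fix i assume "i \<in> bounded_solutions (Suc R) j"
    then have i: "i \<in> extensional {1..Suc R}" "(\<Sum>r=1..R. r * i r) + Suc R * i (Suc R) = j"
      by (auto simp: bounded_solutions_def PiE_def)
    have jq: "j - (\<Sum>r=1..R. r * i r) = Suc R * i (Suc R)" using i(2) by simp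
    have jq': "(j - (\<Sum>r=1..R. r * i r)) div Suc R = i (Suc R)"
      unfolding jq by (rule nonzero_mult_div_cancel_left) simp
    show "(case (\<Sum>r=1..R. r * i r, restrict i {1..R}) of (q, i) \<Rightarrow> i(Suc R := (j - q) div Suc R)) = i"
      unfolding prod.case jq' using i(1) by (auto simp: restrict_def extensional_def fun_eq_iff)
    show "(\<Sum>r=1..R. r * i r, restrict i {1..R}) \<in> ?D"
      using i(2) jq by (auto simp: bounded_solutions_def res simp del: mult_Suc)
  qed
  finally show ?case .
qed

text \<open>
  The factors with \<open>r > j\<close> are 1 up to order \<open>j\<close>.
\<close>
lemma fps_nth_prod_exp_monom_stable:
  assumes "j \<le> R"
  shows "fps_nth (\<Prod>r=1..R. exp_monom_fps (a r) r) j = fps_nth (\<Prod>r=1..j. exp_monom_fps (a r) r) j"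
  using assms
proof (induction R rule: dec_induct)
  case (step R)
  let ?E = "exp_monom_fps (a (Suc R)) (Suc R)"
  have E: "fps_nth ?E (j - q) = (if q = j then 1 else 0)" if "q \<le> j" for q
    using that step.hyps by (auto simp: exp_monom_fps_def dest: dvd_imp_le)
  have "fps_nth (\<Prod>r=1..Suc R. exp_monom_fps (a r) r) j
      = (\<Sum>q=0..j. fps_nth (\<Prod>r=1..R. exp_monom_fps (a r) r) q * fps_nth ?E (j - q))"
    by (simp add: fps_mult_nth)
  also have "\<dots> = (\<Sum>q=0..j. if q = j then fps_nth (\<Prod>r=1..R. exp_monom_fps (a r) r) j else 0)"
    by (intro sum.cong) (auto simp: E)
  finally show ?case using step.IH by simp
qed simp

text \<open>
  The exponential of the truncated expansion is a product of exponentials of monomials, and the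
  exponential of the error is \<open>1 + O(u ^ (N + 1))\<close>.
\<close>
lemma expands_exp:
  assumes u: "(u \<longlongrightarrow> 0) F" and f: "expands F u N f A"
  shows "expands F u N (\<lambda>x. exp (f x)) (Abs_fps (\<lambda>j. exp (fps_nth A 0) *
    (\<Sum>i\<in>index_solutions j. \<Prod>r=1..j. fps_nth A r ^ i r / fact (i r))))"
proof -
  define \<rho> where "\<rho> x = f x - (\<Sum>q\<le>N. fps_nth A q * u x ^ q)" for x
  have \<rho>: "\<rho> \<in> O[F](\<lambda>x. u x ^ Suc N)"
    using f by (simp add: expands_def \<rho>_def[abs_def])
  have \<rho>0: "(\<rho> \<longlongrightarrow> 0) F"
  proof -
    have "((\<lambda>x. u x ^ Suc N) \<longlongrightarrow> 0) F"
      using tendsto_power[OF u, of "Suc N"] by simp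
    then have "(\<lambda>x. u x ^ Suc N) \<in> o[F](\<lambda>_. 1)"
      by (intro smalloI_tendsto) auto
    then have "\<rho> \<in> o[F](\<lambda>_. 1)"
      by (rule landau_o.big_small_trans[OF \<rho>])
    then show ?thesis by (rule smalloD_tendsto[where g = "\<lambda>_. 1 :: real", simplified])
  qed
  have "expands F \<rho> 0 (\<lambda>x. exp (\<rho> x)) (fps_exp 1)"
  proof (rule expands_power_series[OF \<rho>0, of 1])
    fix x :: real
    show "(\<lambda>n. fps_nth (fps_exp 1) n * x ^ n) sums exp x"
      using exp_converges[of x] by (simp add: divide_inverse_commute)
  qed simp
  then have "(\<lambda>x. exp (\<rho> x) - 1) \<in> O[F](\<rho>)"
    by (simp add: expands_def)
  then have "(\<lambda>x. exp (\<rho> x) - 1) \<in> O[F](\<lambda>x. u x ^ Suc N)"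
    using \<rho> by (rule landau_o.big_trans)
  then have E\<rho>: "expands F u N (\<lambda>x. exp (\<rho> x)) 1"
    using expands_add[OF expands_bigo[of "\<lambda>x. exp (\<rho> x) - 1"] expands_const[of F u N 1]] by (simp del: power_Suc)
  have "expands F u N (\<lambda>x. \<Prod>r=1..N. exp (fps_nth A r * u x ^ r)) (\<Prod>r=1..N. exp_monom_fps (fps_nth A r) r)"
    by (intro expands_prod[OF u] expands_power_series[OF u, of 1]) (auto intro: exp_monom_sums)
  note expands_mult[OF u expands_cmult[OF this, of "exp (fps_nth A 0)"] E\<rho>]
  moreover have "exp (fps_nth A 0) * (\<Prod>r=1..N. exp (fps_nth A r * u x ^ r)) * exp (\<rho> x) = exp (f x)" for x
  proof -
    have "f x = fps_nth A 0 + (\<Sum>r=1..N. fps_nth A r * u x ^ r) + \<rho> x"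
      by (simp add: \<rho>_def atMost_atLeast0 sum.atLeast_Suc_atMost)
    then show ?thesis by (simp add: exp_add exp_sum)
  qed
  moreover have "fps_nth (fps_const (exp (fps_nth A 0)) * (\<Prod>r=1..N. exp_monom_fps (fps_nth A r) r) * 1) j
     = exp (fps_nth A 0) * (\<Sum>i\<in>index_solutions j. \<Prod>r=1..j. fps_nth A r ^ i r / fact (i r))" if "j \<le> N" for j
  proof -
    have "fps_nth (fps_const (exp (fps_nth A 0)) * B * 1) j = exp (fps_nth A 0) * fps_nth B j" for B :: "real fps"
      by simp
    then show ?thesis
      by (simp only: fps_nth_prod_exp_monom_stable[OF that])
        (simp only: fps_nth_prod_exp_monom bounded_solutions_def index_solutions_def)
  qed
  ultimately show ?thesis
    by (intro expands_cong[where B = "Abs_fps _"]) auto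
qed

section \<open>Differences of the Barnes sum\<close>

lemma expands_scaled_series:
  assumes u: "(u \<longlongrightarrow> 0) F" and t: "0 < t"
    and f: "\<And>x. \<bar>x\<bar> < 1 \<Longrightarrow> (\<lambda>n. a n * x ^ n) sums f x"
  shows "expands F u N (\<lambda>x. f (t * u x)) (Abs_fps (\<lambda>n. a n * t ^ n))"
proof (rule expands_power_series[OF u, of "1 / t"])
  fix x :: real assume "\<bar>x\<bar> < 1 / t"
  then have "\<bar>t * x\<bar> < 1" using t by (simp add: abs_mult field_simps)
  from f[OF this] show "(\<lambda>n. fps_nth (Abs_fps (\<lambda>n. a n * t ^ n)) n * x ^ n) sums f (t * x)"
    by (simp add: power_mult_distrib mult.assoc)
qed (use t in auto)

lemma expands_ln:
  assumes "(u \<longlongrightarrow> 0) F" "0 < t"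
  shows "expands F u N (\<lambda>x. ln (1 - t * u x)) (Abs_fps (\<lambda>n. - 1 / real n * t ^ n))"
proof (rule expands_scaled_series[OF assms])
  fix x :: real assume "\<bar>x\<bar> < 1"
  with ln_series'[of "- x"] show "(\<lambda>n. - 1 / real n * x ^ n) sums ln (1 - x)"
    by simp
qed

lemma expands_neg_powr:
  assumes "(u \<longlongrightarrow> 0) F" "0 < t"
  shows "expands F u N (\<lambda>x. (1 - t * u x) powr - a) (Abs_fps (\<lambda>n. pochhammer a n / fact n * t ^ n))"
proof (rule expands_scaled_series[OF assms])
  fix x :: real assume "\<bar>x\<bar> < 1"
  then have "(\<lambda>n. (- a gchoose n) * (- x) ^ n) sums (1 + (- x)) powr - a"
    by (intro gen_binomial_real) simp
  also have "(\<lambda>n. (- a gchoose n) * (- x) ^ n) = (\<lambda>n. pochhammer a n / fact n * x ^ n)"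
  proof
    fix n
    show "(- a gchoose n) * (- x) ^ n = pochhammer a n / fact n * x ^ n"
      by (cases "even n") (auto simp: gbinomial_pochhammer)
  qed
  finally show "(\<lambda>n. pochhammer a n / fact n * x ^ n) sums (1 - x) powr - a" by simp
qed

definition barnes_coeff :: "nat \<Rightarrow> real" where
  "barnes_coeff j = bernoulli (2 * j + 2) / (4 * real j * (real j + 1))"

text \<open>
  The factorials cancel; what remains are the classical coefficients in the asymptotic series of the
  logarithm of the Barnes function.
\<close>
lemma inv_diff2_coeff_ln_tower:
  assumes j: "1 \<le> j"
  shows "inv_diff2_coeff (Suc j) * ln_tower (2 * Suc j) z = barnes_coeff j / z ^ (2 * j)"
proof -
  obtain i where i: "j = Suc i" using j by (cases j) auto
  have f: "fact (2 * Suc j) = (2 * real j + 2) * (2 * real j + 1) * (2 * real j) * fact (2 * j - 1)"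
    by (simp add: i algebra_simps)
  have "ln_tower (2 * Suc j) z = - fact (2 * j - 1) / z ^ (2 * j)"
    using j by (simp add: ln_tower_def)
  then have "inv_diff2_coeff (Suc j) * ln_tower (2 * Suc j) z
    = (1 - 2 * real (Suc j)) * bernoulli (2 * j + 2) / ((2 * real j + 2) * (2 * real j + 1) * (2 * real j) * fact (2 * j - 1))
      * (- fact (2 * j - 1) / z ^ (2 * j))"
    by (simp only: inv_diff2_coeff_def f) simp
  also have "\<dots> = (2 * real j + 1) * bernoulli (2 * j + 2) / ((2 * real j + 2) * (2 * real j + 1) * (2 * real j)) / z ^ (2 * j)"
  proof -
    have "(1 - 2 * real (Suc j)) = - (2 * real j + 1)" by simp
    moreover have "(fact (2 * j - 1) :: real) \<noteq> 0" by simp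
    ultimately show ?thesis by (simp only: mult_minus_left mult_minus_right minus_divide_left[symmetric] minus_minus) (simp del: fact_nonzero bernoulli.simps)
  qed
  also have "(2 * real j + 1) * bernoulli (2 * j + 2) / ((2 * real j + 2) * (2 * real j + 1) * (2 * real j)) = barnes_coeff j"
  proof -
    have "2 * real j + 1 \<noteq> 0" by linarith
    then have "(2 * real j + 1) * bernoulli (2 * j + 2) / ((2 * real j + 2) * (2 * real j + 1) * (2 * real j))
        = bernoulli (2 * j + 2) / ((2 * real j + 2) * (2 * real j))"
      by (simp del: bernoulli.simps)
    also have "(2 * real j + 2) * (2 * real j) = 4 * real j * (real j + 1)" by (simp add: algebra_simps)
    finally show ?thesis by (simp only: barnes_coeff_def)
  qed
  finally show ?thesis .
qed

lemma barnes_sum_Suc: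
  "barnes_sum (Suc K) z = z\<^sup>2 / 2 * ln z - 3 / 4 * z\<^sup>2 - 1 / 12 * ln z + (\<Sum>j=1..K. barnes_coeff j / z ^ (2 * j))"
proof -
  have "barnes_sum (Suc K) z = inv_diff2_coeff 0 * ln_tower 0 z + (\<Sum>k\<le>K. inv_diff2_coeff (Suc k) * ln_tower (2 * Suc k) z)"
    unfolding barnes_sum_def by (subst sum.atMost_Suc_shift) simp
  also have "(\<Sum>k\<le>K. inv_diff2_coeff (Suc k) * ln_tower (2 * Suc k) z)
      = inv_diff2_coeff 1 * ln_tower 2 z + (\<Sum>j=1..K. inv_diff2_coeff (Suc j) * ln_tower (2 * Suc j) z)"
    unfolding atMost_atLeast0 by (subst sum.atLeast_Suc_atMost) (auto simp: numeral_2_eq_2)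
  also have "(\<Sum>j=1..K. inv_diff2_coeff (Suc j) * ln_tower (2 * Suc j) z) = (\<Sum>j=1..K. barnes_coeff j / z ^ (2 * j))"
    by (intro sum.cong refl inv_diff2_coeff_ln_tower) auto
  finally show ?thesis
    by (simp add: inv_diff2_coeff_0 inv_diff2_coeff_1[unfolded One_nat_def] ln_tower_def)
qed

text \<open>
  The difference of \<open>barnes_sum (Suc K)\<close> at \<open>z * (1 - t * v)\<close> and at \<open>z\<close>, for \<open>z^2 = l / v\<close>, without its term in
  \<open>ln z\<close>. In this form it depends on \<open>v\<close> alone.
\<close>
definition barnes_ratio :: "nat \<Rightarrow> real \<Rightarrow> real \<Rightarrow> real \<Rightarrow> real" where
  "barnes_ratio K l t v = l * (((1 - t * v)\<^sup>2 / 2 * ln (1 - t * v) - 3 / 4 * ((t * v)\<^sup>2 - 2 * (t * v))) / v)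
     - 1 / 12 * ln (1 - t * v)
     + (\<Sum>j=1..K. barnes_coeff j / l ^ j * (v ^ j * ((1 - t * v) powr - real (2 * j) - 1)))"

lemma barnes_sum_ratio:
  assumes z: "0 < z" and v: "0 < v" and t: "t * v < 1" and l: "0 < l" "z\<^sup>2 = l / v"
  shows "barnes_sum (Suc K) (z * (1 - t * v)) - barnes_sum (Suc K) z
    = barnes_ratio K l t v + z\<^sup>2 / 2 * ((t * v)\<^sup>2 - 2 * (t * v)) * ln z"
proof -
  define y where "y = 1 - t * v"
  have y: "0 < y" using t by (simp add: y_def)
  have ln: "ln (z * y) = ln z + ln y" using z y by (simp add: ln_mult)
  have pw: "barnes_coeff j / (z * y) ^ (2 * j) - barnes_coeff j / z ^ (2 * j)
      = barnes_coeff j / l ^ j * (v ^ j * (y powr - real (2 * j) - 1))" for j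
  proof -
    have zz: "z ^ (2 * j) = l ^ j / v ^ j"
      by (simp only: power_mult l(2) power_divide)
    have yy: "y powr - real (2 * j) = 1 / y ^ (2 * j)"
      using y by (simp only: powr_minus_divide powr_realpow)
    show ?thesis
      unfolding power_mult_distrib zz yy using y v l(1) by (simp add: field_simps)
  qed
  have "barnes_sum (Suc K) (z * y) - barnes_sum (Suc K) z
     = (z\<^sup>2 * y\<^sup>2 / 2 * (ln z + ln y) - 3 / 4 * (z\<^sup>2 * y\<^sup>2)) - (z\<^sup>2 / 2 * ln z - 3 / 4 * z\<^sup>2)
       - 1 / 12 * ln y + (\<Sum>j=1..K. barnes_coeff j / (z * y) ^ (2 * j) - barnes_coeff j / z ^ (2 * j))"
    unfolding barnes_sum_Suc ln power_mult_distrib[of z y 2]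
    by (simp add: sum_subtractf algebra_simps)
  also have "\<dots> = z\<^sup>2 * (y\<^sup>2 / 2 * ln y - 3 / 4 * (y\<^sup>2 - 1)) - 1 / 12 * ln y
       + (\<Sum>j=1..K. barnes_coeff j / l ^ j * (v ^ j * (y powr - real (2 * j) - 1)))
       + z\<^sup>2 / 2 * (y\<^sup>2 - 1) * ln z"
    unfolding pw by (simp add: algebra_simps add_divide_distrib diff_divide_distrib)
  also have "y\<^sup>2 - 1 = (t * v)\<^sup>2 - 2 * (t * v)"
    by (simp add: y_def power2_eq_square algebra_simps)
  also have "z\<^sup>2 * (y\<^sup>2 / 2 * ln y - 3 / 4 * ((t * v)\<^sup>2 - 2 * (t * v)))
      = l * ((y\<^sup>2 / 2 * ln y - 3 / 4 * ((t * v)\<^sup>2 - 2 * (t * v))) / v)"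
    by (simp add: l(2))
  finally show ?thesis by (simp only: barnes_ratio_def y_def)
qed

definition barnes_ratio_coeff :: "nat \<Rightarrow> real \<Rightarrow> real \<Rightarrow> nat \<Rightarrow> real" where
  "barnes_ratio_coeff K l t q =
     (if q = 0 then l * t
      else if q = 1 then t / 12
      else - (l * t ^ (q + 1) / (real q * (real q + 1) * (real q - 1))) + t ^ q / (12 * real q)
        + (\<Sum>j=1..q-1. barnes_coeff j / l ^ j * (pochhammer (real (2 * j)) (q - j) / fact (q - j) * t ^ (q - j))))"

text \<open>
  The quadratic term is divided by \<open>v\<close>, so its series is needed one order further; its coefficient of
  \<open>v^2\<close> vanishes, which is why order 1 has to be treated apart from the higher orders.
\<close>
lemma expands_barnes_ratio:
  assumes u: "(u \<longlongrightarrow> 0) F" and u0: "eventually (\<lambda>x. u x \<noteq> 0) F" and t: "0 < t" and NK: "N \<le> K"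
  shows "expands F u N (\<lambda>x. barnes_ratio K l t (u x)) (Abs_fps (barnes_ratio_coeff K l t))"
proof -
  define L where "L = Abs_fps (\<lambda>n. - 1 / real n * t ^ n)"
  define P where "P j = Abs_fps (\<lambda>n. pochhammer (real (2 * j)) n / fact n * t ^ n)" for j
  define X where "X = fps_const t * fps_X"
  define Psi where "Psi = fps_const (1 / 2) * ((1 - X) ^ 2 * L) - fps_const (3 / 4) * (X ^ 2 - fps_const 2 * X)"
  have EX: "expands F u N (\<lambda>x. t * u x) X" for N
    unfolding X_def by (intro expands_cmult expands_linear)
  have E1X: "expands F u N (\<lambda>x. 1 - t * u x) (1 - X)" for N
    using expands_diff[OF expands_const[of F u N 1] EX] by simp
  have EL: "expands F u N (\<lambda>x. ln (1 - t * u x)) L" for N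
    unfolding L_def by (rule expands_ln[OF u t])
  have EPsi: "expands F u N (\<lambda>x. 1 / 2 * ((1 - t * u x)\<^sup>2 * ln (1 - t * u x)) - 3 / 4 * ((t * u x)\<^sup>2 - 2 * (t * u x))) Psi" for N
    unfolding Psi_def
    by (intro expands_diff expands_cmult expands_mult[OF u] expands_power[OF u] EX E1X EL)
  have X_mult: "fps_nth (X * B) n = (if n = 0 then 0 else t * fps_nth B (n - 1))" for B n
    by (simp add: X_def mult.assoc)
  have sq: "(1 - X) ^ 2 * L = L - 2 * (X * L) + X * (X * L)"
    by (simp add: power2_eq_square algebra_simps)
  have Psi_nth: "fps_nth Psi n = 1 / 2 * (fps_nth L n - 2 * fps_nth (X * L) n + fps_nth (X * (X * L)) n)
      - 3 / 4 * (fps_nth (X * X) n - 2 * fps_nth X n)" for n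
    unfolding Psi_def sq by (simp add: power2_eq_square fps_numeral_fps_const)
  have Xn: "fps_nth X n = (if n = 1 then t else 0)" for n
    by (simp add: X_def)
  have Psi0: "fps_nth Psi 0 = 0"
    by (simp add: Psi_nth X_mult Xn L_def)
  have Psi1: "fps_nth Psi (Suc 0) = t"
    by (simp add: Psi_nth X_mult Xn L_def)
  have Psi2: "fps_nth Psi 2 = 0"
    by (simp add: Psi_nth X_mult Xn L_def power2_eq_square)
  have Psi3: "fps_nth Psi (Suc q) = - (t ^ (q + 1) / (real q * (real q + 1) * (real q - 1)))" if q: "2 \<le> q" for q
  proof -
    define x where "x = real q"
    have x: "x + 1 \<noteq> 0" "x \<noteq> 0" "x - 1 \<noteq> 0" "real (Suc q) = x + 1" "real (q - 1) = x - 1"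
      using q by (auto simp: x_def)
    have pw: "t * t ^ q = t ^ (q + 1)" "t * (t * t ^ (q - 1)) = t ^ (q + 1)"
      using q by (simp_all add: power_Suc[symmetric] del: power_Suc)
    have "fps_nth Psi (Suc q) = 1 / 2 * (- 1 / real (Suc q) * t ^ (q + 1) - 2 * (t * (- 1 / real q * t ^ q))
        + t * (t * (- 1 / real (q - 1) * t ^ (q - 1))))"
      using q by (simp add: Psi_nth X_mult Xn L_def del: of_nat_Suc)
    also have "\<dots> = 1 / 2 * (- 1 / (x + 1) * t ^ (q + 1) - 2 * (- 1 / x * (t * t ^ q)) + - 1 / (x - 1) * (t * (t * t ^ (q - 1))))"
      unfolding x(4,5) x_def[symmetric] by (simp only: mult_ac)
    also have "\<dots> = t ^ (q + 1) * (1 / 2 * (- 1 / (x + 1) + 2 / x - 1 / (x - 1)))"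
      unfolding pw by (simp add: algebra_simps)
    also have "1 / 2 * (- 1 / (x + 1) + 2 / x - 1 / (x - 1)) = - (1 / (x * (x + 1) * (x - 1)))"
      using x(1-3) by (simp add: divide_simps) (simp add: algebra_simps)
    finally show ?thesis by (simp add: x_def)
  qed
  have "expands F u N (\<lambda>x. l * ((1 / 2 * ((1 - t * u x)\<^sup>2 * ln (1 - t * u x)) - 3 / 4 * ((t * u x)\<^sup>2 - 2 * (t * u x))) / u x)
     - 1 / 12 * ln (1 - t * u x)
     + (\<Sum>j=1..K. barnes_coeff j / l ^ j * (u x ^ j * ((1 - t * u x) powr - real (2 * j) - 1))))
     (fps_const l * fps_shift 1 Psi - fps_const (1 / 12) * L + (\<Sum>j=1..K. fps_const (barnes_coeff j / l ^ j) * (fps_X ^ j * (P j - fps_const 1))))"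
    unfolding P_def
    by (intro expands_add expands_diff expands_cmult expands_divide[OF EPsi Psi0 u0] EL expands_sum
        expands_mult[OF u] expands_power[OF u] expands_linear expands_neg_powr[OF u t] expands_const)
  then show ?thesis
  proof (rule expands_cong)
    show "\<forall>\<^sub>F x in F. l * ((1 / 2 * ((1 - t * u x)\<^sup>2 * ln (1 - t * u x)) - 3 / 4 * ((t * u x)\<^sup>2 - 2 * (t * u x))) / u x)
     - 1 / 12 * ln (1 - t * u x)
     + (\<Sum>j=1..K. barnes_coeff j / l ^ j * (u x ^ j * ((1 - t * u x) powr - real (2 * j) - 1))) = barnes_ratio K l t (u x)"
      by (simp add: barnes_ratio_def)
    fix q assume q: "q \<le> N"
    have S: "fps_nth (\<Sum>j=1..K. fps_const (barnes_coeff j / l ^ j) * (fps_X ^ j * (P j - fps_const 1))) q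
        = (\<Sum>j=1..q-1. barnes_coeff j / l ^ j * (pochhammer (real (2 * j)) (q - j) / fact (q - j) * t ^ (q - j)))"
    proof -
      have "fps_nth (\<Sum>j=1..K. fps_const (barnes_coeff j / l ^ j) * (fps_X ^ j * (P j - fps_const 1))) q
          = (\<Sum>j=1..K. barnes_coeff j / l ^ j * (if q \<le> j then 0 else pochhammer (real (2 * j)) (q - j) / fact (q - j) * t ^ (q - j)))"
        unfolding fps_sum_nth
        by (intro sum.cong refl) (auto simp: fps_X_power_mult_nth P_def)
      also have "\<dots> = (\<Sum>j=1..q-1. barnes_coeff j / l ^ j * (if q \<le> j then 0 else pochhammer (real (2 * j)) (q - j) / fact (q - j) * t ^ (q - j)))"
        using q NK by (intro sum.mono_neutral_right) auto
      also have "\<dots> = (\<Sum>j=1..q-1. barnes_coeff j / l ^ j * (pochhammer (real (2 * j)) (q - j) / fact (q - j) * t ^ (q - j)))"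
        by (intro sum.cong refl) auto
      finally show ?thesis .
    qed
    show "fps_nth (fps_const l * fps_shift 1 Psi - fps_const (1 / 12) * L + (\<Sum>j=1..K. fps_const (barnes_coeff j / l ^ j) * (fps_X ^ j * (P j - fps_const 1)))) q
      = fps_nth (Abs_fps (barnes_ratio_coeff K l t)) q"
    proof -
      consider "q = 0" | "q = 1" | "2 \<le> q" by linarith
      then show ?thesis
        unfolding fps_add_nth S
        by cases (auto simp: barnes_ratio_coeff_def Psi1 Psi2[unfolded numeral_2_eq_2] Psi3 L_def)
    qed
  qed
qed

section \<open>The logarithm of the moment\<close>

lemma fixed_ratio_eventually:
  "eventually P (fixed_ratio_at_top p c) \<longleftrightarrow>
    (\<exists>n0. \<forall>n m. n0 \<le> n \<longrightarrow> (n, m) \<in> admissible p c \<longrightarrow> P (n, m))"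
  unfolding fixed_ratio_at_top_def eventually_inf_principal eventually_filtercomap eventually_at_top_linorder
proof safe
  fix Q N assume "\<forall>n\<ge>N. Q n" "\<forall>x. Q (fst x) \<longrightarrow> x \<in> admissible p c \<longrightarrow> P x"
  then show "\<exists>n0. \<forall>n m. n0 \<le> n \<longrightarrow> (n, m) \<in> admissible p c \<longrightarrow> P (n, m)"
    by (intro exI[of _ N]) auto
next
  fix n0 assume "\<forall>n m. n0 \<le> n \<longrightarrow> (n, m) \<in> admissible p c \<longrightarrow> P (n, m)"
  then show "\<exists>Q. (\<exists>N. \<forall>n\<ge>N. Q n) \<and> (\<forall>x. Q (fst x) \<longrightarrow> x \<in> admissible p c \<longrightarrow> P x)"
    by (intro exI[of _ "\<lambda>n. n0 \<le> n"]) auto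
qed

lemma ln_Gamma_ratio_nat:
  assumes "p < k"
  shows "ln (Gamma (real k)) - ln (Gamma (real k - real p)) = real p * ln (real k) + (\<Sum>j=1..p. ln (1 - real j / real k))"
  using assms
proof (induction p)
  case (Suc p)
  have pos: "0 < real k - real (Suc p)" using Suc.prems by simp
  have "Gamma (real k - real p) = (real k - real (Suc p)) * Gamma (real k - real (Suc p))"
  proof -
    have "real k - real (Suc p) \<notin> \<int>\<^sub>\<le>\<^sub>0"
      using pos by (auto elim!: nonpos_Ints_cases)
    from Gamma_plus1[OF this] show ?thesis by simp
  qed
  moreover have "Gamma (real k - real (Suc p)) \<noteq> 0"
    using Gamma_real_pos[OF pos] by linarith
  ultimately have "ln (Gamma (real k - real p)) = ln (real k - real (Suc p)) + ln (Gamma (real k - real (Suc p)))"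
    using pos by (simp only:) (subst ln_mult, auto)
  moreover have "ln (real k - real (Suc p)) = ln (real k) + ln (1 - real (Suc p) / real k)"
  proof -
    have "real k - real (Suc p) = real k * (1 - real (Suc p) / real k)"
      using Suc.prems by (simp add: field_simps)
    moreover have "1 - real (Suc p) / real k \<noteq> 0" "real k \<noteq> 0"
      using Suc.prems by (auto simp: field_simps)
    ultimately show ?thesis by (simp only: ln_mult) simp
  qed
  ultimately show ?case
    using Suc by (simp add: algebra_simps)
qed simp

definition log_moment_fps :: "nat \<Rightarrow> real \<Rightarrow> nat \<Rightarrow> real fps" where
  "log_moment_fps p c K = fps_const (real p * (1 - c) / c * ln (1 - c))
    - fps_const ((real p)\<^sup>2 / 2 * ln (1 - c)) * fps_X
    + (\<Sum>j=1..p. Abs_fps (\<lambda>n. - 1 / real n * (real j * c) ^ n))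
    + (Abs_fps (barnes_ratio_coeff K (1 / c\<^sup>2) (real p * c))
       - Abs_fps (barnes_ratio_coeff K ((1 - c)\<^sup>2 / c\<^sup>2) (real p * c / (1 - c))))"

text \<open>
  For \<open>q \<ge> 2\<close> the four contributions are the two quadratic terms, the logarithms, the harmonic sum from
  \<open>Gamma (n m) / Gamma (n m - p)\<close>, and the Bernoulli terms of the two Barnes sums.
\<close>
lemma log_moment_fps_nth:
  assumes p: "0 < p" and c: "0 < c" "c < 1"
  shows "fps_nth (log_moment_fps p c K) q = coeff_A p q c"
proof -
  have H: "(\<Sum>j=1..p. - 1 / real q * (real j * c) ^ q) = - (c ^ q / real q * gen_harmonic p (- int q))" for q
    by (simp add: gen_harmonic_def sum_distrib_left power_mult_distrib mult_ac sum_negf)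
  have nth: "fps_nth (log_moment_fps p c K) q = (if q = 0 then real p * (1 - c) / c * ln (1 - c) else 0)
      - (if q = 1 then (real p)\<^sup>2 / 2 * ln (1 - c) else 0)
      - c ^ q / real q * gen_harmonic p (- int q)
      + (barnes_ratio_coeff K (1 / c\<^sup>2) (real p * c) q - barnes_ratio_coeff K ((1 - c)\<^sup>2 / c\<^sup>2) (real p * c / (1 - c)) q)"
    unfolding log_moment_fps_def using H[of q] by (simp add: fps_sum_nth)
  consider "q = 0" | "q = 1" | "2 \<le> q" by linarith
  then show ?thesis
  proof cases
    case 1
    then show ?thesis
      using c unfolding nth by (simp add: coeff_A_def barnes_ratio_coeff_def power2_eq_square field_simps)
  next
    case 2
    have g: "gen_harmonic p (- 1) = real p * (real p + 1) / 2"
      unfolding gen_harmonic_def by (induction p) (auto simp: field_simps)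
    have "fps_nth (log_moment_fps p c K) q = - ((real p)\<^sup>2 / 2 * ln (1 - c)) - c * (real p * (real p + 1) / 2)
        + (real p * c / 12 - real p * c / (1 - c) / 12)"
      unfolding nth using 2 g by (simp add: barnes_ratio_coeff_def)
    also have "\<dots> = coeff_A p q c"
    proof -
      have "1 - c \<noteq> 0" "c - 1 \<noteq> 0" using c by auto
      then have "- c * (real p * (real p + 1) / 2) + (real p * c / 12 - real p * c / (1 - c) / 12)
        = c * real p * (12 - 11 * c + 6 * (1 - real p) * (c - 1)) / (12 * (c - 1))"
        by (simp add: divide_simps) (simp add: algebra_simps)
      then show ?thesis using 2 by (simp add: coeff_A_def)
    qed
    finally show ?thesis .
  next
    case 3
    define P where "P = real p"
    define Q where "Q = real q"
    define d where "d = 1 - c"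
    have d: "0 < d" "c = 1 - d" using c by (auto simp: d_def)
    have Q: "2 \<le> Q" using 3 by (simp add: Q_def)
    have gen: "b / k / (1 / w) * (h / f * e) - b / k / (y / w) * (h / f * (e / x)) = b * w * h * e / (k * f) * (1 - 1 / (y * x))"
      if "w \<noteq> 0" for w b k h f e x y :: real
      using that by (simp add: right_diff_distrib diff_divide_distrib mult_ac)
    have sum: "(\<Sum>j=1..q-1. barnes_coeff j / (1 / c\<^sup>2) ^ j * (pochhammer (real (2 * j)) (q - j) / fact (q - j) * (P * c) ^ (q - j)))
       - (\<Sum>j=1..q-1. barnes_coeff j / (d\<^sup>2 / c\<^sup>2) ^ j * (pochhammer (real (2 * j)) (q - j) / fact (q - j) * (P * c / d) ^ (q - j)))
      = (\<Sum>j=1..q-1.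
             bernoulli (2 * j + 2) * c ^ (2 * j) * pochhammer (real (2 * j)) (q - j)
               * (P * c) ^ (q - j)
             / (4 * real j * (real j + 1) * fact (q - j))
             * (1 - d powi (- int j - int q)))"
      unfolding sum_subtractf[symmetric]
    proof (intro sum.cong refl)
      fix j assume "j \<in> {1..q-1}"
      then have j: "1 \<le> j" "j \<le> q" by auto
      have "d powi (- int j - int q) = d powi (- int (j + q))" by (simp add: algebra_simps)
      also have "\<dots> = 1 / d ^ (j + q)"
        by (simp only: power_int_minus power_int_of_nat inverse_eq_divide)
      finally have dp: "d powi (- int j - int q) = 1 / d ^ (j + q)" .
      have dd: "d ^ (j + q) = d ^ (2 * j) * d ^ (q - j)"
        using j by (simp add: power_add[symmetric])
      have l1: "(1 / c\<^sup>2) ^ j = 1 / c ^ (2 * j)" and l2: "(d\<^sup>2 / c\<^sup>2) ^ j = d ^ (2 * j) / c ^ (2 * j)"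
        by (simp_all add: power_divide power_mult)
      have l3: "(P * c / d) ^ (q - j) = (P * c) ^ (q - j) / d ^ (q - j)"
        by (simp add: power_divide)
      show "barnes_coeff j / (1 / c\<^sup>2) ^ j * (pochhammer (real (2 * j)) (q - j) / fact (q - j) * (P * c) ^ (q - j))
        - barnes_coeff j / (d\<^sup>2 / c\<^sup>2) ^ j * (pochhammer (real (2 * j)) (q - j) / fact (q - j) * (P * c / d) ^ (q - j))
        = bernoulli (2 * j + 2) * c ^ (2 * j) * pochhammer (real (2 * j)) (q - j)
               * (P * c) ^ (q - j)
             / (4 * real j * (real j + 1) * fact (q - j))
             * (1 - d powi (- int j - int q))"
        unfolding l1 l2 l3 dp dd barnes_coeff_def by (rule gen) (use c in simp)
    qed
    have main: "- (1 / c\<^sup>2 * (P * c) ^ (q + 1) / (Q * (Q + 1) * (Q - 1))) + (P * c) ^ q / (12 * Q)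
        - (- (d\<^sup>2 / c\<^sup>2 * (P * c / d) ^ (q + 1) / (Q * (Q + 1) * (Q - 1))) + (P * c / d) ^ q / (12 * Q))
      = (c * P) ^ q * (c + 12 * P - 12 * c * P - c * Q\<^sup>2) / (12 * c * Q * (Q\<^sup>2 - 1) * d ^ q)
        + (c * P) ^ q * (- 12 * P + c * (Q\<^sup>2 - 1)) / (12 * c * Q * (Q\<^sup>2 - 1))"
    proof -
      define E where "E = (P * c) ^ q"
      have Q2: "Q\<^sup>2 - 1 = (Q + 1) * (Q - 1)" by (simp add: power2_eq_square algebra_simps)
      have nz: "Q \<noteq> 0" "Q + 1 \<noteq> 0" "Q - 1 \<noteq> 0" "c \<noteq> 0" "d \<noteq> 0" "d ^ q \<noteq> 0" using Q c d by auto
      have a: "1 / c\<^sup>2 * (P * c) ^ (q + 1) = E * P / c"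
        using nz by (simp add: E_def power2_eq_square)
      have b: "d\<^sup>2 / c\<^sup>2 * (P * c / d) ^ (q + 1) = E / d ^ q * P * d / c"
        using nz by (simp add: E_def power2_eq_square power_divide mult_ac)
      have e: "(P * c / d) ^ q = E / d ^ q" "(c * P) ^ q = E" "(P * c) ^ q = E"
        by (simp_all add: E_def power_divide mult.commute)
      have c1: "c + 12 * P - 12 * c * P - c * Q\<^sup>2 = 12 * P * d - c * ((Q + 1) * (Q - 1))"
        unfolding Q2[symmetric] by (simp add: d_def algebra_simps)
      have t1: "- (E * P / c / (Q * (Q + 1) * (Q - 1))) + E / (12 * Q)
          = E * (- 12 * P + c * ((Q + 1) * (Q - 1))) / (12 * c * Q * ((Q + 1) * (Q - 1)))"
        using nz(1-4) by (simp add: divide_simps) (simp add: algebra_simps)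
      have t2: "- (- (E' * P * d / c / (Q * (Q + 1) * (Q - 1))) + E' / (12 * Q))
          = E' * (12 * P * d - c * ((Q + 1) * (Q - 1))) / (12 * c * Q * ((Q + 1) * (Q - 1)))" for E'
        using nz(1-4) by (simp add: divide_simps) (simp add: algebra_simps)
      have t2': "E / d ^ q * (12 * P * d - c * ((Q + 1) * (Q - 1))) / (12 * c * Q * ((Q + 1) * (Q - 1)))
          = E * (12 * P * d - c * ((Q + 1) * (Q - 1))) / (12 * c * Q * ((Q + 1) * (Q - 1)) * d ^ q)"
        by simp
      show ?thesis
        unfolding a b e c1 Q2 using t1 t2[of "E / d ^ q"] unfolding t2' by linarith
    qed
    have "fps_nth (log_moment_fps p c K) q
      = (- (1 / c\<^sup>2 * (P * c) ^ (q + 1) / (Q * (Q + 1) * (Q - 1))) + (P * c) ^ q / (12 * Q)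
        - (- (d\<^sup>2 / c\<^sup>2 * (P * c / d) ^ (q + 1) / (Q * (Q + 1) * (Q - 1))) + (P * c / d) ^ q / (12 * Q)))
      - c ^ q / Q * gen_harmonic p (- int q)
      + ((\<Sum>j=1..q-1. barnes_coeff j / (1 / c\<^sup>2) ^ j * (pochhammer (real (2 * j)) (q - j) / fact (q - j) * (P * c) ^ (q - j)))
       - (\<Sum>j=1..q-1. barnes_coeff j / (d\<^sup>2 / c\<^sup>2) ^ j * (pochhammer (real (2 * j)) (q - j) / fact (q - j) * (P * c / d) ^ (q - j))))"
    proof -
      have q: "(q = 0) = False" "(q = 1) = False" using 3 by auto
      show ?thesis
        unfolding nth barnes_ratio_coeff_def q if_False P_def[symmetric] Q_def[symmetric] d_def[symmetric]
        by (simp only: diff_conv_add_uminus minus_add_distrib minus_minus add_ac add_0 minus_zero)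
    qed
    also have "\<dots> = coeff_A p q c"
      unfolding main sum coeff_A_def using 3
      by (simp add: P_def Q_def d_def)
    finally show ?thesis .
  qed
qed

definition log_moment_main :: "nat \<Rightarrow> real \<Rightarrow> nat \<Rightarrow> real \<Rightarrow> real" where
  "log_moment_main p c K v = real p * (1 - c) / c * ln (1 - c) - (real p)\<^sup>2 / 2 * ln (1 - c) * v
     + (\<Sum>j=1..p. ln (1 - real j * c * v))
     + (barnes_ratio K (1 / c\<^sup>2) (real p * c) v - barnes_ratio K ((1 - c)\<^sup>2 / c\<^sup>2) (real p * c / (1 - c)) v)"

lemma expands_log_moment_main:
  assumes u: "(u \<longlongrightarrow> 0) F" and u0: "eventually (\<lambda>x. u x \<noteq> 0) F"
    and p: "0 < p" and c: "0 < c" "c < 1" and NK: "N \<le> K"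
  shows "expands F u N (\<lambda>x. log_moment_main p c K (u x)) (log_moment_fps p c K)"
  unfolding log_moment_main_def log_moment_fps_def
  by (intro expands_add expands_diff expands_const expands_sum expands_cmult expands_linear
      expands_ln[OF u] expands_barnes_ratio[OF u u0 _ NK]) (use p c in auto)

text \<open>
  The Barnes sums are evaluated at \<open>m\<close> and at \<open>m - n = (1 - c) m\<close>. The terms with logarithms of \<open>m\<close> and
  \<open>m - n\<close> that \<open>barnes_ratio\<close> omits combine with \<open>p * ln (n m)\<close> and \<open>- p * ln n\<close> to an affine function of \<open>1 / n^2\<close>
  (\<open>rest\<close>).
\<close>
lemma ln_moment_ratio_eq:
  fixes n m p :: nat
  assumes p: "0 < p" and c: "0 < c" "c < 1" and nm: "0 < n" "real n / real m = c" "p < n" "n + 2 \<le> m"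
  defines "\<epsilon> \<equiv> real p / real n"
  shows "ln (Gamma (real (n * m))) - ln (Gamma (real (n * m) - real p)) - real p * ln (real n)
      + ((barnes_sum (Suc K) (real m - \<epsilon>) - barnes_sum (Suc K) (real m))
        - (barnes_sum (Suc K) (real m - real n - \<epsilon>) - barnes_sum (Suc K) (real m - real n)))
    = log_moment_main p c K (1 / (real n)\<^sup>2)"
proof -
  define v where "v = 1 / (real n)\<^sup>2"
  define b where "b = real m - real n"
  have m0: "0 < real m" "0 < real n" using nm by auto
  have n_eq: "real n = c * real m" using nm(2) m0 by (simp add: field_simps)
  have m_eq: "real m = real n / c" using n_eq c by simp
  have b_eq: "b = (1 - c) * real m" by (simp add: b_def n_eq algebra_simps)
  have b_eq': "b = (1 - c) * real n / c" by (simp add: b_eq m_eq)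
  have e: "0 < \<epsilon>" "\<epsilon> < 1" using p nm(3) by (auto simp: \<epsilon>_def)
  have b2: "2 \<le> b" using nm(4) by (simp add: b_def)
  have v: "0 < v" using m0 by (simp add: v_def)
  have t1: "real p * c * v = \<epsilon> / real m"
    using m0 c by (simp add: v_def \<epsilon>_def m_eq power2_eq_square)
  have t2: "real p * c / (1 - c) * v = \<epsilon> / b"
    using m0 c by (simp add: v_def \<epsilon>_def b_eq' power2_eq_square)
  have l1: "(real m)\<^sup>2 = 1 / c\<^sup>2 / v"
    by (simp add: m_eq v_def power_divide)
  have l2: "b\<^sup>2 = (1 - c)\<^sup>2 / c\<^sup>2 / v"
    by (simp add: b_eq' v_def power_divide power_mult_distrib)
  have s1: "real m * (1 - real p * c * v) = real m - \<epsilon>"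
    unfolding t1 using m0 by (simp add: right_diff_distrib)
  have s2: "b * (1 - real p * c / (1 - c) * v) = b - \<epsilon>"
    unfolding t2 using b2 by (simp add: right_diff_distrib)
  have B1: "barnes_sum (Suc K) (real m - \<epsilon>) - barnes_sum (Suc K) (real m)
     = barnes_ratio K (1 / c\<^sup>2) (real p * c) v + (real m)\<^sup>2 / 2 * ((\<epsilon> / real m)\<^sup>2 - 2 * (\<epsilon> / real m)) * ln (real m)"
    unfolding s1[symmetric] t1[symmetric]
  proof (rule barnes_sum_ratio)
    show "real p * c * v < 1" unfolding t1 using e nm(4) by simp
  qed (use m0 v c l1 in auto)
  have B2: "barnes_sum (Suc K) (b - \<epsilon>) - barnes_sum (Suc K) b
     = barnes_ratio K ((1 - c)\<^sup>2 / c\<^sup>2) (real p * c / (1 - c)) v + b\<^sup>2 / 2 * ((\<epsilon> / b)\<^sup>2 - 2 * (\<epsilon> / b)) * ln b"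
    unfolding s2[symmetric] t2[symmetric]
  proof (rule barnes_sum_ratio)
    show "real p * c / (1 - c) * v < 1" unfolding t2 using e b2 by simp
  qed (use b2 v c l2 in auto)
  have q1: "(real m)\<^sup>2 / 2 * ((\<epsilon> / real m)\<^sup>2 - 2 * (\<epsilon> / real m)) = \<epsilon>\<^sup>2 / 2 - \<epsilon> * real m"
    using m0 by (simp add: power2_eq_square field_simps)
  have q2: "b\<^sup>2 / 2 * ((\<epsilon> / b)\<^sup>2 - 2 * (\<epsilon> / b)) = \<epsilon>\<^sup>2 / 2 - \<epsilon> * b"
    using b2 by (simp add: power2_eq_square field_simps)
  have lnb: "ln b = ln (1 - c) + ln (real m)"
    unfolding b_eq using c m0 by (simp add: ln_mult)
  have rest: "(\<epsilon>\<^sup>2 / 2 - \<epsilon> * real m) * ln (real m) - (\<epsilon>\<^sup>2 / 2 - \<epsilon> * b) * ln b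
     = - real p * ln (real m) - (real p)\<^sup>2 / 2 * ln (1 - c) * v + real p * (1 - c) / c * ln (1 - c)"
  proof -
    have "\<epsilon> * real m - \<epsilon> * b = \<epsilon> * real n"
      by (simp add: b_def algebra_simps)
    then have "\<epsilon> * real m - \<epsilon> * b = real p"
      using m0 by (simp add: \<epsilon>_def)
    moreover have "\<epsilon>\<^sup>2 = (real p)\<^sup>2 * v"
      by (simp add: \<epsilon>_def v_def power_divide)
    moreover have eb: "\<epsilon> * b = real p * (1 - c) / c"
      using m0 by (simp add: \<epsilon>_def b_eq')
    ultimately have em: "\<epsilon> * real m = real p + real p * (1 - c) / c" and e2: "\<epsilon>\<^sup>2 = (real p)\<^sup>2 * v" by auto
    define D where "D = real p * (1 - c) / c"
    show ?thesis unfolding lnb em eb e2 D_def[symmetric] by (simp add: field_simps)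
  qed
  have "n * 1 \<le> n * m" using nm(4) by (intro mult_le_mono2) auto
  then have pnm: "p < n * m" using nm(3) by linarith
  have "ln (Gamma (real (n * m))) - ln (Gamma (real (n * m) - real p))
      = real p * (ln (real n) + ln (real m)) + (\<Sum>j=1..p. ln (1 - real j / real (n * m)))"
    using ln_Gamma_ratio_nat[OF pnm] m0 by (simp add: ln_mult)
  also have "(\<Sum>j=1..p. ln (1 - real j / real (n * m))) = (\<Sum>j=1..p. ln (1 - real j * c * v))"
  proof (intro sum.cong refl)
    fix j
    have "1 / real (n * m) = c * v" using m0 c by (simp add: m_eq v_def power2_eq_square)
    then have "real j / real (n * m) = real j * c * v"
      by (metis mult.assoc mult.right_neutral times_divide_eq_right)
    then show "ln (1 - real j / real (n * m)) = ln (1 - real j * c * v)" by simp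
  qed
  finally have G: "ln (Gamma (real (n * m))) - ln (Gamma (real (n * m) - real p))
      = real p * (ln (real n) + ln (real m)) + (\<Sum>j=1..p. ln (1 - real j * c * v))" .
  show ?thesis
    unfolding b_def[symmetric] G B1 B2 q1 q2 log_moment_main_def v_def[symmetric]
    using rest by (simp add: algebra_simps)
qed

section \<open>The expansion of the moment\<close>

lemma tendsto_fixed_ratio: "((\<lambda>x. 1 / (real (fst x))\<^sup>2) \<longlongrightarrow> 0) (fixed_ratio_at_top p c)"
proof -
  have "filterlim fst at_top (fixed_ratio_at_top p c)"
    unfolding fixed_ratio_at_top_def
    by (rule filterlim_mono[OF filterlim_filtercomap order_refl inf_le1])
  moreover have "(\<lambda>n. 1 / (real n)\<^sup>2) \<longlonglongrightarrow> 0" by real_asymp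
  ultimately show ?thesis by (rule filterlim_compose[rotated])
qed

text \<open>
  At \<open>j = 0\<close> the sum has the single empty solution, so the separate first case of \<open>coeff_beta\<close> follows the
  general pattern.
\<close>
lemma exp_coeff_A_eq_coeff_beta:
  "exp (coeff_A p 0 c) * (\<Sum>i\<in>index_solutions j. \<Prod>r=1..j. coeff_A p r c ^ i r / fact (i r)) = coeff_beta p j c"
proof (cases "j = 0")
  case True
  have "index_solutions 0 = {\<lambda>_. undefined}"
    by (auto simp: index_solutions_def)
  with True show ?thesis by (simp add: coeff_beta_def)
qed (simp add: coeff_beta_def)

text \<open>
  The bound holds uniformly in the probability space, the matrix and its variance, which may all change
  with \<open>n\<close>.
\<close>
lemma moment_W0_approx:
  assumes p: "0 < p" and c: "0 < c" "c < 1"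
  shows "\<exists>n0 C. \<forall>n m (M :: 'a measure) X s. n0 \<le> n \<longrightarrow> (n, m) \<in> admissible p c \<longrightarrow> 0 < s \<longrightarrow>
    gaussian_matrix M n m s X \<longrightarrow>
    (\<exists>R. \<bar>R\<bar> \<le> C * (1 / (real n)\<^sup>2) ^ Suc N \<and>
      moment_W0 M X p = exp (log_moment_main p c (Suc N) (1 / (real n)\<^sup>2) + R))"
proof -
  \<comment> \<open>the error sums up to \<open>O(n * n ^ (-2 * K))\<close>, so \<open>K = N + 2\<close> leaves a power of \<open>n\<close> to spare\<close>
  define K where "K = Suc (Suc N)"
  obtain C where C: "0 \<le> C" "\<And>e n m. 0 \<le> e \<Longrightarrow> e < 1 \<Longrightarrow> n + 2 \<le> m \<Longrightarrow>
    \<bar>(\<Sum>k<n. ln (Gamma (real m - real k - e)) - ln (Gamma (real m - real k)))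
      - ((barnes_sum K (real m - e) - barnes_sum K (real m))
        - (barnes_sum K (real m - real n - e) - barnes_sum K (real m - real n)))\<bar>
      \<le> C * real n / (real m - real n - 1) ^ (2 * K)"
    using sum_ln_Gamma_ratio_barnes[of K] by blast
  define k where "k = (1 - c) / c"
  have k: "0 < k" using c by (simp add: k_def)
  obtain n1 :: nat where n1: "2 / k \<le> real n1" using real_arch_simple by blast
  show ?thesis
  proof (rule exI[of _ "max n1 (Suc p)"], rule exI[of _ "C * (2 / k) ^ (2 * K)"], intro allI impI)
    fix n m and M :: "'a measure" and X s
    assume n: "max n1 (Suc p) \<le> n" and adm: "(n, m) \<in> admissible p c" and s: "0 < s"
      and X: "gaussian_matrix M n m s X"
    define e where "e = real p / real n"
    have n0: "0 < n" "p < n" using n by auto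
    have ratio: "real n / real m = c" and m0: "0 < m" and padm: "real p < real n * (real m - real n + 1)"
      using adm by (auto simp: admissible_def)
    have m_eq: "real m = real n / c" using ratio m0 c by (simp add: field_simps)
    have b_eq: "real m - real n = k * real n" using c by (simp add: m_eq k_def field_simps)
    have kn: "2 \<le> k * real n"
    proof -
      have "2 / k \<le> real n" using n1 n by linarith
      then show ?thesis using k by (simp add: field_simps)
    qed
    have nm2: "n + 2 \<le> m"
    proof -
      have "real (n + 2) \<le> real m" using b_eq kn by simp
      then show ?thesis by (simp only: of_nat_le_iff)
    qed
    have e: "0 \<le> e" "e < 1" using n0 by (auto simp: e_def)
    define S where "S = (\<Sum>k<n. ln (Gamma (real m - real k - e)) - ln (Gamma (real m - real k)))"
    define B where "B = (barnes_sum K (real m - e) - barnes_sum K (real m))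
        - (barnes_sum K (real m - real n - e) - barnes_sum K (real m - real n))"
    have "\<bar>S - B\<bar> \<le> C * real n / (real m - real n - 1) ^ (2 * K)"
      unfolding S_def B_def by (rule C(2)[OF e nm2])
    also have "\<dots> \<le> C * real n / (k * real n / 2) ^ (2 * K)"
      using kn C(1) unfolding b_eq by (intro divide_left_mono power_mono mult_nonneg_nonneg mult_pos_pos zero_less_power) auto
    also have "\<dots> = C * (2 / k) ^ (2 * K) * (real n / real n ^ (2 * K))"
      using k n0 by (simp add: power_divide power_mult_distrib)
    also have "\<dots> \<le> C * (2 / k) ^ (2 * K) * (1 / (real n)\<^sup>2) ^ Suc N"
    proof (rule mult_left_mono)
      have "real n ^ (2 * K) = real n ^ (2 * Suc N) * (real n * real n)"
        by (simp add: K_def)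
      then have "real n / real n ^ (2 * K) = 1 / real n ^ (2 * Suc N) * (1 / real n)"
        using n0 by (simp only:) simp
      also have "\<dots> \<le> 1 / real n ^ (2 * Suc N) * 1"
        using n0 by (intro mult_left_mono) auto
      finally show "real n / real n ^ (2 * K) \<le> (1 / (real n)\<^sup>2) ^ Suc N"
        by (simp only: power_mult power_one_over mult_1_right)
      show "0 \<le> C * (2 / k) ^ (2 * K)" using C(1) k by simp
    qed
    finally have R: "\<bar>S - B\<bar> \<le> C * (2 / k) ^ (2 * K) * (1 / (real n)\<^sup>2) ^ Suc N" .
    have G: "0 < Gamma (real m - real j - e)" "0 < Gamma (real m - real j)" if "j < n" for j
      using that nm2 e by (auto intro!: Gamma_real_pos)
    have pnm: "real p < real (n * m)"
    proof -
      have "real n * (real m - real n + 1) \<le> real n * real m"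
        using n0 by (intro mult_left_mono) auto
      with padm show ?thesis by simp
    qed
    have G2: "0 < Gamma (real (n * m))" "0 < Gamma (real (n * m) - real p)"
      using pnm p by (auto intro!: Gamma_real_pos)
    have "ln (Gamma (real (n * m))) - ln (Gamma (real (n * m) - real p)) - real p * ln (real n) + B
        = log_moment_main p c (Suc N) (1 / (real n)\<^sup>2)"
      unfolding B_def e_def K_def using ratio n0 nm2 p c by (intro ln_moment_ratio_eq) auto
    then have "exp (log_moment_main p c (Suc N) (1 / (real n)\<^sup>2) + (S - B))
        = exp (ln (Gamma (real (n * m))) - ln (Gamma (real (n * m) - real p)) - real p * ln (real n) + S)"
      by (intro arg_cong[where f=exp]) simp
    also have "\<dots> = Gamma (real (n * m)) / Gamma (real (n * m) - real p) / real n ^ p * exp S"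
      using G2 n0 by (simp only: exp_add exp_diff exp_ln exp_of_nat_mult of_nat_0_less_iff)
    also have "exp S = (\<Prod>j<n. Gamma (real m - real j - e) / Gamma (real m - real j))"
      unfolding S_def using G by (simp add: exp_sum exp_diff)
    finally have "exp (log_moment_main p c (Suc N) (1 / (real n)\<^sup>2) + (S - B)) = moment_W0 M X p"
      using moment_W0_eq[OF X s p n0(1) padm] by (simp only: e_def)
    with R show "\<exists>R. \<bar>R\<bar> \<le> C * (2 / k) ^ (2 * K) * (1 / (real n)\<^sup>2) ^ Suc N \<and>
      moment_W0 M X p = exp (log_moment_main p c (Suc N) (1 / (real n)\<^sup>2) + R)"
      by (intro exI[of _ "S - B"]) auto
  qed
qed

theorem proposition1:
  fixes p :: nat and c :: real
    and M :: "nat \<Rightarrow> nat \<Rightarrow> 'a measure"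
    and X :: "nat \<Rightarrow> nat \<Rightarrow> 'a \<Rightarrow> complex mat"
    and N\<^sub>0 :: "nat \<Rightarrow> nat \<Rightarrow> real"
  assumes "0 < p" and "0 < c" and "c < 1"
    and "\<And>n m. (n, m) \<in> admissible p c \<Longrightarrow> 0 < N\<^sub>0 n m"
    and "\<And>n m. (n, m) \<in> admissible p c \<Longrightarrow> gaussian_matrix (M n m) n m (N\<^sub>0 n m) (X n m)"
  shows "\<forall>N. (\<lambda>(n, m). moment_W0 (M n m) (X n m) p
                - (\<Sum>j\<le>N. coeff_beta p j c / real n ^ (2 * j)))
             \<in> O[fixed_ratio_at_top p c](\<lambda>(n, m). 1 / real n ^ (2 * (N + 1)))"
proof
  fix N
  let ?F = "fixed_ratio_at_top p c"
  define u where "u x = 1 / (real (fst x))\<^sup>2" for x :: "nat \<times> nat"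
  define \<mu> where "\<mu> x = moment_W0 (M (fst x) (snd x)) (X (fst x) (snd x)) p" for x
  let ?main = "\<lambda>x. log_moment_main p c (Suc N) (u x)"
  from moment_W0_approx[OF assms(1-3)]
  obtain n0 C where n0: "\<forall>n m (M :: 'a measure) X s. n0 \<le> n \<longrightarrow> (n, m) \<in> admissible p c \<longrightarrow> 0 < s \<longrightarrow>
    gaussian_matrix M n m s X \<longrightarrow>
    (\<exists>R. \<bar>R\<bar> \<le> C * (1 / (real n)\<^sup>2) ^ Suc N \<and>
      moment_W0 M X p = exp (log_moment_main p c (Suc N) (1 / (real n)\<^sup>2) + R))"
    by blast
  have u: "(u \<longlongrightarrow> 0) ?F"
    using tendsto_fixed_ratio by (simp add: u_def[abs_def])
  have u0: "eventually (\<lambda>x. u x \<noteq> 0) ?F"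
    unfolding fixed_ratio_eventually by (auto simp: u_def admissible_def)
  have ev: "eventually (\<lambda>x. 0 < \<mu> x \<and> \<bar>ln (\<mu> x) - ?main x\<bar> \<le> C * u x ^ Suc N) ?F"
    unfolding fixed_ratio_eventually
  proof (intro exI[of _ n0] allI impI)
    fix n m assume n: "n0 \<le> n" and adm: "(n, m) \<in> admissible p c"
    from n0[rule_format, OF n adm assms(4)[OF adm] assms(5)[OF adm]] obtain R where
      "\<bar>R\<bar> \<le> C * (1 / (real n)\<^sup>2) ^ Suc N"
      "moment_W0 (M n m) (X n m) p = exp (log_moment_main p c (Suc N) (1 / (real n)\<^sup>2) + R)"
      by auto
    then show "0 < \<mu> (n, m) \<and> \<bar>ln (\<mu> (n, m)) - ?main (n, m)\<bar> \<le> C * u (n, m) ^ Suc N"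
      by (simp add: \<mu>_def u_def del: power_Suc)
  qed
  have "(\<lambda>x. ln (\<mu> x) - ?main x) \<in> O[?F](\<lambda>x. u x ^ Suc N)"
  proof (rule bigoI[of _ C])
    show "\<forall>\<^sub>F x in ?F. norm (ln (\<mu> x) - ?main x) \<le> C * norm (u x ^ Suc N)"
      using ev by eventually_elim (simp add: u_def del: power_Suc)
  qed
  from expands_add[OF expands_log_moment_main[OF u u0 assms(1-3) le_SucI[OF order_refl]] expands_bigo[OF this]]
  have "expands ?F u N (\<lambda>x. ln (\<mu> x)) (log_moment_fps p c (Suc N))"
    by simp
  from expands_exp[OF u this]
  have "expands ?F u N (\<lambda>x. exp (ln (\<mu> x))) (Abs_fps (\<lambda>j. coeff_beta p j c))"
    by (simp only: log_moment_fps_nth[OF assms(1-3)] exp_coeff_A_eq_coeff_beta)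
  then have "expands ?F u N \<mu> (Abs_fps (\<lambda>j. coeff_beta p j c))"
  proof (rule expands_cong)
    show "\<forall>\<^sub>F x in ?F. exp (ln (\<mu> x)) = \<mu> x"
      using ev by eventually_elim simp
  qed simp
  moreover have "u x ^ q = 1 / real (fst x) ^ (2 * q)" for x q
    by (simp add: u_def power_one_over power_mult)
  ultimately show "(\<lambda>(n, m). moment_W0 (M n m) (X n m) p
                - (\<Sum>j\<le>N. coeff_beta p j c / real n ^ (2 * j)))
             \<in> O[?F](\<lambda>(n, m). 1 / real n ^ (2 * (N + 1)))"
    by (simp only: expands_def \<mu>_def case_prod_beta' fps_nth_Abs_fps times_divide_eq_right mult_1_right Suc_eq_plus1)
qed

end
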